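(* Let $d\ge2$, let $c,\delta,c_d\in\mathbb{C}$ with $|c|>1$, $\delta\ne0$, $c_d\neq0$, and let $H:\mathbb{C}\times\mathbb{C}^2\to\mathbb{C}\times\mathbb{C}^2$ be defined by $$H(\lambda,x,y)=(c\lambda,\ y,\ p_\lambda(y)-\delta x),\qquad p_\lambda(y)=c_dy^d+c_{d-1}(\lambda)y^{d-1}+\cdots+c_0(\lambda),$$ where $c_0,\dots,c_{d-1}$ are polynomials in $\lambda$. Let $U_H^+=\bigcup_{n\ge0}H^{-n}(V_R^+)$ be the escaping region of $H$, with $R>0$ sufficiently large. Then the fundamental group of $U_H^+$ is isomorphic to $\mathbb{Z}[1/d]$, and the intermediate cover $\hat U_H^+$ of $U_H^+$ whose fundamental group is isomorphic to $\mathbb{Z}$ (corresponding to the subgroup $\mathbb{Z}\subset\mathbb{Z}[1/d]$) is biholomorphic to $\mathbb{C}^2\times(\mathbb{C}\setminus\overline{\mathbb{D}})$. Moreover, $H$ lifts to the map $\tilde H:\mathbb{C}^2\times(\mathbb{C}\setminus\overline{\mathbb{D}})\to\mathbb{C}^2\times(\mathbb{C}\setminus\overline{\mathbb{D}})$ given by $$\tilde H(\lambda,s,t)=\left(c\lambda,\ \frac{\delta}{d}\,s+Q_H(\lambda,t),\ t^d\right),$$ where, for each $\lambda\in\mathbb{C}$, $Q_H(\lambda,\cdot)$ is a polynomial in $t$ of degree $d+1$.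
   Context: $\mathbb{D}$ is the open unit disk in $\mathbb{C}$, and $\mathbb{Z}[1/d]=\{k/d^n:k\in\mathbb{Z},\,n\ge0\}$ as an additive group. Let $l_j=\deg(c_j)$ for $0\le j\le d$ (so $l_d=0$) and $\tilde d=\max\{l_j+j:0\le j\le d\}$. For $R>0$ set $$V_R^+=\{(\lambda,x,y)\in\mathbb{C}^3:\ |y|>\max\{R,|x|,|\lambda|^{\tilde d+1}\}\}.$$ It is known that $H(V_R^+)\subset V_R^+$ for all sufficiently large $R$; fix such a sufficiently large $R$. The map $H$ is a biholomorphism of $\mathbb{C}^3$ and $H(U_H^+)=U_H^+$. The isomorphism $\pi_1(U_H^+)\cong\mathbb{Z}[1/d]$ is normalized so that the image of $\pi_1(V_R^+)\cong\mathbb{Z}$ corresponds to $\mathbb{Z}\subset\mathbb{Z}[1/d]$; $\hat U_H^+\to U_H^+$ is the connected covering corresponding to this subgroup, with the pulled-back complex structure. "$H$ lifts to $\tilde H$" means: identifying $\hat U_H^+$ with $\mathbb{C}^2\times(\mathbb{C}\setminus\overline{\mathbb{D}})$ by a suitable biholomorphism, and writing $p:\mathbb{C}^2\times(\mathbb{C}\setminus\overline{\mathbb{D}})\to U_H^+$ for the resulting holomorphic covering map, one has $p\circ\tilde H=H\circ p$. *)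

theory Defs
  imports
    "HOL-Analysis.Analysis"
    "HOL-Algebra.Elementary_Groups"
    "HOL-Computational_Algebra.Polynomial"
begin

section \<open>The fundamental group\<close>

definition loops_at :: "'a::real_normed_vector set \<Rightarrow> 'a \<Rightarrow> (real \<Rightarrow> 'a) set" where
  "loops_at S a = {\<gamma>. path \<gamma> \<and> path_image \<gamma> \<subseteq> S \<and> pathstart \<gamma> = a \<and> pathfinish \<gamma> = a}"

definition path_class :: "'a::real_normed_vector set \<Rightarrow> (real \<Rightarrow> 'a) \<Rightarrow> (real \<Rightarrow> 'a) set" where
  "path_class S \<gamma> = {\<gamma>'. homotopic_paths S \<gamma> \<gamma>'}"

definition fundamental_group ::
    "'a::real_normed_vector set \<Rightarrow> 'a \<Rightarrow> (real \<Rightarrow> 'a) set monoid" where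
  "fundamental_group S a =
     \<lparr>carrier = path_class S ` loops_at S a,
      monoid.mult = (\<lambda>A B. \<Union>\<alpha>\<in>A. \<Union>\<beta>\<in>B. path_class S (\<alpha> +++ \<beta>)),
      one = path_class S (linepath a a)\<rparr>"

text \<open>The map of fundamental groups induced by \<^term>\<open>f\<close>, where \<^term>\<open>T\<close> is the target space of
  \<^term>\<open>f\<close>.\<close>

definition induced_map ::
    "'b::real_normed_vector set \<Rightarrow> ('a::real_normed_vector \<Rightarrow> 'b)
      \<Rightarrow> (real \<Rightarrow> 'a) set \<Rightarrow> (real \<Rightarrow> 'b) set" where
  "induced_map T f A = (\<Union>\<alpha>\<in>A. path_class T (f \<circ> \<alpha>))"

lemma path_class_eqI:
  assumes "homotopic_paths S \<gamma> \<gamma>'"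
  shows "path_class S \<gamma> = path_class S \<gamma>'"
  unfolding path_class_def
  using homotopic_paths_trans[OF assms] homotopic_paths_trans[OF homotopic_paths_sym[OF assms]]
  by blast

lemma fundamental_group_mult:
  assumes "\<alpha> \<in> loops_at S a" "\<beta> \<in> loops_at S a"
  shows "path_class S \<alpha> \<otimes>\<^bsub>fundamental_group S a\<^esub> path_class S \<beta> = path_class S (\<alpha> +++ \<beta>)"
proof -
  have "path_class S (\<alpha>' +++ \<beta>') = path_class S (\<alpha> +++ \<beta>)"
    if "homotopic_paths S \<alpha> \<alpha>'" "homotopic_paths S \<beta> \<beta>'" for \<alpha>' \<beta>'
  proof -
    have "homotopic_paths S (\<alpha> +++ \<beta>) (\<alpha>' +++ \<beta>')"
      using that assms by (intro homotopic_paths_join) (auto simp: loops_at_def)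
    from this[THEN homotopic_paths_sym] show ?thesis
      by (rule path_class_eqI)
  qed
  then have "path_class S (\<alpha>' +++ \<beta>') = path_class S (\<alpha> +++ \<beta>)"
    if "\<alpha>' \<in> path_class S \<alpha>" "\<beta>' \<in> path_class S \<beta>" for \<alpha>' \<beta>'
    using that by (simp add: path_class_def[of S \<alpha>] path_class_def[of S \<beta>])
  moreover have "\<alpha> \<in> path_class S \<alpha>" "\<beta> \<in> path_class S \<beta>"
    using assms by (simp_all add: loops_at_def path_class_def)
  ultimately have "(\<Union>\<alpha>'\<in>path_class S \<alpha>. \<Union>\<beta>'\<in>path_class S \<beta>. path_class S (\<alpha>' +++ \<beta>'))
      = path_class S (\<alpha> +++ \<beta>)"
    by blast
  then show ?thesis
    by (simp add: fundamental_group_def)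
qed

lemma loops_at_join:
  "\<alpha> \<in> loops_at S a \<Longrightarrow> \<beta> \<in> loops_at S a \<Longrightarrow> \<alpha> +++ \<beta> \<in> loops_at S a"
  by (auto simp: loops_at_def path_image_join)

lemma group_fundamental_group:
  assumes "a \<in> S"
  shows "group (fundamental_group S a)"
proof -
  let ?G = "fundamental_group S a"
  have carr: "carrier ?G = path_class S ` loops_at S a"
    and one: "\<one>\<^bsub>?G\<^esub> = path_class S (linepath a a)"
    by (simp_all add: fundamental_group_def)
  have const: "linepath a a \<in> loops_at S a"
    using assms by (auto simp: loops_at_def)
  show ?thesis
  proof (rule groupI)
    fix x y assume "x \<in> carrier ?G" "y \<in> carrier ?G"
    then show "x \<otimes>\<^bsub>?G\<^esub> y \<in> carrier ?G"
      by (auto simp: carr fundamental_group_mult loops_at_join)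
  next
    show "\<one>\<^bsub>?G\<^esub> \<in> carrier ?G" using const by (auto simp: carr one)
  next
    fix x y z assume "x \<in> carrier ?G" "y \<in> carrier ?G" "z \<in> carrier ?G"
    then obtain \<alpha> \<beta> \<gamma> where *: "\<alpha> \<in> loops_at S a" "\<beta> \<in> loops_at S a" "\<gamma> \<in> loops_at S a"
      "x = path_class S \<alpha>" "y = path_class S \<beta>" "z = path_class S \<gamma>"
      by (auto simp: carr)
    have "homotopic_paths S (\<alpha> +++ (\<beta> +++ \<gamma>)) ((\<alpha> +++ \<beta>) +++ \<gamma>)"
      using * by (intro homotopic_paths_assoc) (auto simp: loops_at_def)
    then have "path_class S (\<alpha> +++ (\<beta> +++ \<gamma>)) = path_class S ((\<alpha> +++ \<beta>) +++ \<gamma>)"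
      by (rule path_class_eqI)
    then show "x \<otimes>\<^bsub>?G\<^esub> y \<otimes>\<^bsub>?G\<^esub> z = x \<otimes>\<^bsub>?G\<^esub> (y \<otimes>\<^bsub>?G\<^esub> z)"
      using * by (simp add: fundamental_group_mult loops_at_join)
  next
    fix x assume "x \<in> carrier ?G"
    then obtain \<alpha> where *: "\<alpha> \<in> loops_at S a" "x = path_class S \<alpha>"
      by (auto simp: carr)
    have "homotopic_paths S (linepath a a +++ \<alpha>) \<alpha>"
      using * homotopic_paths_lid[of \<alpha> S] by (auto simp: loops_at_def)
    then have "path_class S (linepath a a +++ \<alpha>) = path_class S \<alpha>"
      by (rule path_class_eqI)
    then show "\<one>\<^bsub>?G\<^esub> \<otimes>\<^bsub>?G\<^esub> x = x"
      using * const by (simp add: one fundamental_group_mult)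
  next
    fix x assume "x \<in> carrier ?G"
    then obtain \<alpha> where *: "\<alpha> \<in> loops_at S a" "x = path_class S \<alpha>"
      by (auto simp: carr)
    have r: "reversepath \<alpha> \<in> loops_at S a" using * by (auto simp: loops_at_def)
    have "homotopic_paths S (reversepath \<alpha> +++ \<alpha>) (linepath a a)"
      using * homotopic_paths_linv[of \<alpha> S] by (auto simp: loops_at_def)
    then have "path_class S (reversepath \<alpha> +++ \<alpha>) = path_class S (linepath a a)"
      by (rule path_class_eqI)
    then show "\<exists>y\<in>carrier ?G. y \<otimes>\<^bsub>?G\<^esub> x = \<one>\<^bsub>?G\<^esub>"
      using * r by (intro bexI[of _ "path_class S (reversepath \<alpha>)"])
        (auto simp: one carr fundamental_group_mult)
  qed
qed

text \<open>The additive group \<open>\<int>[1/d]\<close>.\<close>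

definition Z_inverse_group :: "nat \<Rightarrow> rat monoid" where
  "Z_inverse_group d =
     \<lparr>carrier = {of_int k / of_nat d ^ n | (k::int) (n::nat). True}, monoid.mult = (+), one = 0\<rparr>"


section \<open>Holomorphic maps in three variables and holomorphic coverings\<close>

type_synonym complex3 = "complex \<times> complex \<times> complex"

definition cscale :: "complex \<Rightarrow> complex3 \<Rightarrow> complex3" where
  "cscale w = (\<lambda>(u, v, z). (w * u, w * v, w * z))"

text \<open>A map is holomorphic on an open set if it has a complex-linear Frechet derivative at
  every point (\<^const>\<open>has_derivative\<close> only provides a real-linear one).\<close>

definition holomorphic3 :: "(complex3 \<Rightarrow> complex3) \<Rightarrow> complex3 set \<Rightarrow> bool" where
  "holomorphic3 f S \<longleftrightarrow> open S \<and>
     (\<forall>z\<in>S. \<exists>f'. (f has_derivative f') (at z) \<and> (\<forall>w v. f' (cscale w v) = cscale w (f' v)))"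

definition biholomorphic3 :: "(complex3 \<Rightarrow> complex3) \<Rightarrow> complex3 set \<Rightarrow> complex3 set \<Rightarrow> bool" where
  "biholomorphic3 f S T \<longleftrightarrow>
     bij_betw f S T \<and> holomorphic3 f S \<and> holomorphic3 (the_inv_into S f) T"

text \<open>A covering \<open>p: M \<rightarrow> U\<close> that is locally biholomorphic, i.e. for which the given complex
  structure on \<open>M\<close> is the one pulled back from \<open>U\<close>.\<close>

definition holomorphic_covering :: "complex3 set \<Rightarrow> (complex3 \<Rightarrow> complex3) \<Rightarrow> complex3 set \<Rightarrow> bool" where
  "holomorphic_covering M p U \<longleftrightarrow>
     covering_space M p U \<and> holomorphic3 p M \<and>
     (\<forall>z\<in>M. \<exists>W. z \<in> W \<and> W \<subseteq> M \<and> biholomorphic3 p W (p ` W))"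

text \<open>The pointed connected covering \<open>p: (M, b) \<rightarrow> (U, a)\<close> corresponds to the subgroup \<open>G\<close> of
  \<open>\<pi>\<^sub>1(U, a)\<close>: the induced map of fundamental groups has image \<open>G\<close>.  This determines the covering
  up to isomorphism; for a \<^const>\<open>holomorphic_covering\<close>, which carries the pulled-back complex
  structure, that isomorphism is biholomorphic.\<close>

definition corresponds_to_subgroup ::
    "'a::real_normed_vector set \<Rightarrow> 'a \<Rightarrow> ('a \<Rightarrow> 'b::real_normed_vector)
      \<Rightarrow> 'b set \<Rightarrow> 'b \<Rightarrow> (real \<Rightarrow> 'b) set set \<Rightarrow> bool" where
  "corresponds_to_subgroup M b p U a G \<longleftrightarrow>
     connected M \<and> b \<in> M \<and> p b = a \<and> induced_map U p ` carrier (fundamental_group M b) = G"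


section \<open>The skew Henon map and its escaping region\<close>

text \<open>The coefficients \<open>c\<^sub>0, \<dots>, c\<^sub>d\<close> are given as a family \<open>C\<close> of polynomials, of which only
  \<open>C 0, \<dots>, C d\<close> matter; that \<open>c\<^sub>d\<close> is constant is a hypothesis on \<open>C d\<close>.\<close>

definition henon_map :: "nat \<Rightarrow> complex \<Rightarrow> complex \<Rightarrow> (nat \<Rightarrow> complex poly) \<Rightarrow> complex3 \<Rightarrow> complex3" where
  "henon_map d c \<delta> C = (\<lambda>(l, x, y). (c * l, y, (\<Sum>j\<le>d. poly (C j) l * y ^ j) - \<delta> * x))"

text \<open>The number \<open>max {deg c\<^sub>j + j | 0 \<le> j \<le> d}\<close>.  For a vanishing \<open>C j\<close> the convention
  \<^term>\<open>degree 0 = 0\<close> is harmless, as the term for \<open>j = d\<close> is already at least \<open>j\<close>.\<close>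

definition d_tilde :: "nat \<Rightarrow> (nat \<Rightarrow> complex poly) \<Rightarrow> nat" where
  "d_tilde d C = Max ((\<lambda>j. degree (C j) + j) ` {..d})"

definition V_plus :: "nat \<Rightarrow> (nat \<Rightarrow> complex poly) \<Rightarrow> real \<Rightarrow> complex3 set" where
  "V_plus d C R =
     {(l, x, y). norm y > Max {R, norm x, norm l ^ (d_tilde d C + 1)}}"

definition U_plus ::
    "nat \<Rightarrow> complex \<Rightarrow> complex \<Rightarrow> (nat \<Rightarrow> complex poly) \<Rightarrow> real \<Rightarrow> complex3 set" where
  "U_plus d c \<delta> C R = (\<Union>n. (henon_map d c \<delta> C ^^ n) -` V_plus d C R)"

text \<open>\<open>\<complex>\<^sup>2 \<times> (\<complex> \<setminus> closed unit disk)\<close>\<close>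

definition model_space :: "complex3 set" where
  "model_space = UNIV \<times> UNIV \<times> (- cball 0 1)"

definition model_map ::
    "nat \<Rightarrow> complex \<Rightarrow> complex \<Rightarrow> (complex \<Rightarrow> complex poly) \<Rightarrow> complex3 \<Rightarrow> complex3" where
  "model_map d c \<delta> Q = (\<lambda>(l, s, t). (c * l, \<delta> / of_nat d * s + poly (Q l) t, t ^ d))"

end

theory Submission
  imports Defs "HOL-Complex_Analysis.Complex_Analysis"
begin

text \<open>In the coordinates \<open>k = x/y\<close>, \<open>v = 1/(\<alpha>y)\<close> with \<open>\<alpha>\<^sup>d\<^sup>-\<^sup>1 = c\<^sub>d\<close>, the Henon map extends
  holomorphically to a neighbourhood of \<open>v = 0\<close>, where it is superattracting; a Boettcher coordinate
  \<open>w = v e\<^sup>-\<^sup>g\<close> satisfies \<open>w \<circ> H = w\<^sup>d\<close>, and \<open>t = 1/w\<close>. On each level curve of \<open>t\<close> in a fibre, a second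
  coordinate is obtained by integrating the form \<open>ds\<close> determined by \<open>ds \<and> dt = const \<cdot> t dx \<and> dy\<close>. Since \<open>H\<close>
  multiplies \<open>dx \<and> dy\<close> by \<open>\<delta>\<close>, the function \<open>s \<circ> H - (\<delta>/d) s\<close> depends on \<open>(\<lambda>, t)\<close> only. It is a Laurent
  series in \<open>t\<close> of degree \<open>d + 1\<close>, and its negative part is removed by adding to \<open>s\<close> a rapidly
  converging series. The result is a chart \<open>\<Psi>\<close> of \<open>V\<close> into the model that semiconjugates \<open>H\<close> to the model
  map \<open>F\<close>, and \<open>p = H\<^sup>-\<^sup>n \<circ> \<Psi>\<^sup>-\<^sup>1 \<circ> F\<^sup>n\<close> extends its inverse to the whole model. On the universal cover
  \<open>\<complex>\<^sup>2 \<times> {Re \<tau> > 0}\<close> of the model the lift of \<open>F\<close> is invertible, so the translations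
  \<open>\<tau> \<mapsto> \<tau> + 2\<pi>i k\<close>, conjugated by its iterates, form a free action of \<open>\<int>[1/d]\<close> with quotient \<open>U\<close>, in
  which the subgroup \<open>\<int>\<close> has the model as quotient.\<close>

text \<open>The factor t in t dx \<and> dy makes the multiplier constant: H multiplies dx \<and> dy
  by \<delta> and t by t^(d-1), while dt becomes d t^(d-1) dt, so d(s \<circ> H) \<and> dt =
  (\<delta>/d) ds \<and> dt in a fibre. In the coordinates (k, v), with w = v e^-g, the form is a
  constant times dk \<and> dv / (w v^3); hence the cube of e^-g in the density of w^2 s. The scaling
  by w^2 keeps this density holomorphic at v = 0. The obstacle is the expanding base map \<lambda>
  \<mapsto> c \<lambda>: bounds on Laurent coefficients in a fibre cannot be uniform in \<lambda>.
  The neighbourhood of infinity is therefore cut out by a bound on |v| |\<lambda>|^m with m above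
  all degrees of the coefficients, and fibrewise estimates are scaled to the radius that this leaves
  for v. The losses along an orbit grow like a power of |c|^n and are beaten by w^(d^n). Since t
  \<mapsto> t^d is not injective, p identifies points whose F-orbits merge, after n steps say; this
  is where the denominators d^n come from.\<close>

section \<open>Quotients by free group actions\<close>

text \<open>Every representative of the class has the same image class, so the union that defines
  \<open>induced_map\<close> is a union of equal sets.\<close>

lemma induced_map_path_class:
  assumes f: "continuous_on S f" "f ` S \<subseteq> T" and \<gamma>: "\<gamma> \<in> loops_at S a"
  shows "induced_map T f (path_class S \<gamma>) = path_class T (f \<circ> \<gamma>)"
proof -
  have "homotopic_paths S \<gamma> \<gamma>" using \<gamma> by (simp add: loops_at_def)
  moreover have "path_class T (f \<circ> \<alpha>) = path_class T (f \<circ> \<gamma>)" if "homotopic_paths S \<gamma> \<alpha>" for \<alpha>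
  proof -
    have "f \<in> S \<rightarrow> T" using f(2) by auto
    from homotopic_paths_continuous_image[OF that f(1) this] show ?thesis
      using path_class_eqI by blast
  qed
  ultimately show ?thesis
    unfolding induced_map_def path_class_def[of S] by blast
qed

text \<open>Even covering comes from local injectivity of \<open>P\<close> and freeness: if two
  translates of an injectivity neighbourhood meet in T g n = T h n', then P n = P n', so n = n' and
  g = h. This suits \<int>[1/d], whose translations are dense in the imaginary direction of \<tau>,
  so that separation cannot be read off from that coordinate.\<close>

locale deck_action = group G
  for G :: "('g, 'm) monoid_scheme" (structure) +
  fixes E :: "'a::real_normed_vector set" and P :: "'a \<Rightarrow> 'b::real_normed_vector"
    and U :: "'b set" and T :: "'g \<Rightarrow> 'a \<Rightarrow> 'a"
  assumes open_E: "open E"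
    and cont_P: "continuous_on E P"
    and P_image: "P ` E = U"
    and P_open_map: "\<And>N. open N \<Longrightarrow> N \<subseteq> E \<Longrightarrow> open (P ` N)"
    and P_locally_inj: "\<And>z. z \<in> E \<Longrightarrow> \<exists>N. open N \<and> z \<in> N \<and> N \<subseteq> E \<and> inj_on P N"
    and T_in: "\<And>g z. g \<in> carrier G \<Longrightarrow> z \<in> E \<Longrightarrow> T g z \<in> E"
    and T_cont: "\<And>g. g \<in> carrier G \<Longrightarrow> continuous_on E (T g)"
    and T_one: "\<And>z. z \<in> E \<Longrightarrow> T \<one> z = z"
    and T_mult: "\<And>g h z. g \<in> carrier G \<Longrightarrow> h \<in> carrier G \<Longrightarrow> z \<in> E \<Longrightarrow> T (g \<otimes> h) z = T g (T h z)"
    and T_free: "\<And>g z. g \<in> carrier G \<Longrightarrow> z \<in> E \<Longrightarrow> T g z = z \<Longrightarrow> g = \<one>"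
    and P_eq_iff: "\<And>z z'. z \<in> E \<Longrightarrow> z' \<in> E \<Longrightarrow> P z = P z' \<longleftrightarrow> (\<exists>g\<in>carrier G. z' = T g z)"
begin

lemma T_inv [simp]:
  assumes "g \<in> carrier G" and "z \<in> E"
  shows "T (inv g) (T g z) = z" "T g (T (inv g) z) = z"
proof -
  have "T (inv g) (T g z) = T (inv g \<otimes> g) z" "T g (T (inv g) z) = T (g \<otimes> inv g) z"
    by (rule T_mult[symmetric]; use assms in simp)+
  then show "T (inv g) (T g z) = z" "T g (T (inv g) z) = z"
    by (simp_all only: l_inv[OF assms(1)] r_inv[OF assms(1)] T_one[OF assms(2)])
qed

lemma T_eq_imp_eq:
  assumes "g \<in> carrier G" "h \<in> carrier G" "z \<in> E" "T g z = T h z"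
  shows "g = h"
proof -
  have "T (inv h \<otimes> g) z = z"
    using assms T_mult[of "inv h" g z] T_inv(1)[of h z] by (metis inv_closed)
  then have "inv h \<otimes> g = \<one>"
    using assms by (intro T_free[of _ z]) auto
  then show ?thesis
    using assms by (metis inv_closed inv_equality inv_inv)
qed

lemma P_T [simp]:
  assumes "g \<in> carrier G" "z \<in> E"
  shows "P (T g z) = P z"
  using P_eq_iff[OF assms(2) T_in[OF assms]] assms(1) by auto

lemma T_open:
  assumes "g \<in> carrier G" "open N" "N \<subseteq> E"
  shows "open (T g ` N)"
proof -
  have "T g ` N = E \<inter> T (inv g) -` N"
  proof (intro equalityI subsetI)
    fix y assume "y \<in> E \<inter> T (inv g) -` N"
    then have "y = T g (T (inv g) y)" "T (inv g) y \<in> N" using assms by auto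
    then show "y \<in> T g ` N" by blast
  qed (use assms T_in in \<open>auto simp: subset_iff\<close>)
  then show ?thesis
    using continuous_open_preimage[OF T_cont[of "inv g"] open_E assms(2)] assms(1) by simp
qed

text \<open>The sheets over P(N), for an injectivity neighbourhood N, are the sets \<pi>(T g N). Two
  that meet are equal: a common point gives n = n' by injectivity, then h = k g with k \<in> K by
  freeness, and k identifies the two sheets entirely. The covering by \<open>E\<close> itself is the
  case K = {1}; the model arises from K = \<int>.\<close>

lemma intermediate_covering:
  fixes \<pi> :: "'a \<Rightarrow> 'c::real_normed_vector" and p :: "'c \<Rightarrow> 'b"
  assumes K: "K \<subseteq> carrier G"
    and \<pi>: "continuous_on E \<pi>" "\<pi> ` E = M" "\<And>N. open N \<Longrightarrow> N \<subseteq> E \<Longrightarrow> open (\<pi> ` N)"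
    and p: "continuous_on M p" "\<And>z. z \<in> E \<Longrightarrow> p (\<pi> z) = P z"
    and \<pi>_eq_iff: "\<And>z z'. z \<in> E \<Longrightarrow> z' \<in> E \<Longrightarrow> \<pi> z = \<pi> z' \<longleftrightarrow> (\<exists>k\<in>K. z' = T k z)"
  shows "covering_space M p U"
proof
  show "continuous_on M p" by fact
  show "p ` M = U"
  proof -
    have "(\<lambda>z. p (\<pi> z)) ` E = P ` E" using p(2) by (rule image_cong[OF refl])
    then show ?thesis using P_image \<pi>(2) by (metis image_image)
  qed
  fix x assume "x \<in> U"
  then obtain z where z: "z \<in> E" "x = P z" using P_image by blast
  obtain N where N: "open N" "z \<in> N" "N \<subseteq> E" "inj_on P N"
    using P_locally_inj[OF z(1)] by blast
  \<comment> \<open>Indexing by all g repeats sheets, since g and k g with k \<in> K give the same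
    one; as a set of sets the family is still pairwise disjoint.\<close>
  define v where "v = (\<lambda>g. \<pi> ` T g ` N) ` carrier G"
  have T_N: "T g ` N \<subseteq> E" if "g \<in> carrier G" for g
    using that T_in N by auto
  have "\<Union>v = M \<inter> p -` (P ` N)"
  proof (intro equalityI subsetI)
    fix m assume "m \<in> \<Union>v"
    then obtain g n where g: "g \<in> carrier G" "n \<in> N" "m = \<pi> (T g n)"
      by (auto simp: v_def)
    then have "n \<in> E" using N by auto
    then show "m \<in> M \<inter> p -` (P ` N)"
      using g \<pi>(2) p(2) T_in by auto
  next
    fix m assume m: "m \<in> M \<inter> p -` (P ` N)"
    then obtain z' where z': "z' \<in> E" "m = \<pi> z'" using \<pi>(2) by blast
    then obtain n where n: "n \<in> N" "P z' = P n" using m p(2) by auto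
    then obtain g where "g \<in> carrier G" "z' = T g n"
      using P_eq_iff[of n z'] z' N by auto
    then show "m \<in> \<Union>v" using n z' by (auto simp: v_def)
  qed
  moreover have "\<forall>u\<in>v. openin (top_of_set M) u"
  proof
    fix u assume "u \<in> v"
    then obtain g where g: "g \<in> carrier G" "u = \<pi> ` T g ` N" by (auto simp: v_def)
    then have "open u" using \<pi>(3)[OF T_open T_N] N by auto
    moreover have "u \<subseteq> M" using g T_N \<pi>(2) by blast
    ultimately show "openin (top_of_set M) u" by (simp add: open_subset)
  qed
  moreover have "pairwise disjnt v"
  proof (rule pairwiseI, rule ccontr)
    fix u u' assume "u \<in> v" "u' \<in> v" and ne: "u \<noteq> u'" and "\<not> disjnt u u'"
    then obtain g h where g: "g \<in> carrier G" "u = \<pi> ` T g ` N"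
      and h: "h \<in> carrier G" "u' = \<pi> ` T h ` N" by (auto simp: v_def)
    obtain n n' where n: "n \<in> N" "n' \<in> N" "\<pi> (T g n) = \<pi> (T h n')"
      using \<open>\<not> disjnt u u'\<close> g h by (auto simp: disjnt_iff)
    have E: "n \<in> E" "n' \<in> E" using n N by auto
    obtain k where k: "k \<in> K" "T h n' = T k (T g n)"
      using \<pi>_eq_iff[of "T g n" "T h n'"] n g h E T_in by auto
    have kG: "k \<in> carrier G" using k K by auto
    have "P n = P n'"
      using P_T[OF g(1) E(1)] P_T[OF h(1) E(2)] P_T[OF kG T_in[OF g(1) E(1)]] k by simp
    then have "n = n'" using N(4) n by (auto dest: inj_onD)
    then have "h = k \<otimes> g"
      using k E kG g h by (intro T_eq_imp_eq[of _ _ n]) (auto simp: T_mult)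
    then have "\<pi> (T h y) = \<pi> (T g y)" if "y \<in> N" for y
      using \<pi>_eq_iff[of "T g y" "T h y"] that N k kG g h T_in T_mult by (auto simp: subset_iff)
    then have "u = u'" by (force simp: g h image_image)
    then show False using ne by simp
  qed
  moreover have "\<exists>q. homeomorphism u (P ` N) p q" if "u \<in> v" for u
  proof -
    obtain g where g: "g \<in> carrier G" "u = \<pi> ` T g ` N" using \<open>u \<in> v\<close> by (auto simp: v_def)
    have uM: "u \<subseteq> M" using g T_N \<pi>(2) by blast
    have pu: "p (\<pi> (T g n)) = P n" if "n \<in> N" for n
      using that N g T_in p(2) by (auto simp: subset_iff)
    have "inj_on p u"
      using N(4) by (auto simp: inj_on_def g pu)
    moreover have "p ` u = P ` N"
      by (auto simp: g image_image pu)
    \<comment> \<open>Openness of \<open>p\<close> is borrowed from \<open>P\<close>: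
      \<open>O'\<close> is pulled back to \<open>E\<close> along the surjection \<pi>, and p \<circ>
      \<pi> = P there.\<close>
    moreover have "openin (top_of_set (P ` N)) (p ` O')" if O': "openin (top_of_set u) O'" for O'
    proof -
      have "open u" using \<pi>(3)[OF T_open T_N] N g by auto
      then have O2: "open O'" "O' \<subseteq> u" using O' openin_open_eq by blast+
      have *: "open (E \<inter> \<pi> -` O')" using \<pi>(1) open_E O2 by (simp add: continuous_open_preimage)
      have "O' = \<pi> ` (E \<inter> \<pi> -` O')"
        using O2 uM \<pi>(2) by blast
      then have "p ` O' = (\<lambda>z. p (\<pi> z)) ` (E \<inter> \<pi> -` O')"
        by (metis image_image)
      also have "\<dots> = P ` (E \<inter> \<pi> -` O')"
        using p(2) by (intro image_cong) auto
      finally have "p ` O' = P ` (E \<inter> \<pi> -` O')" .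
      then have "open (p ` O')" using P_open_map[OF *] by auto
      then show ?thesis
        using O2 \<open>p ` u = P ` N\<close> by (intro open_subset) auto
    qed
    ultimately show ?thesis
      using homeomorphism_injective_open_map continuous_on_subset[OF p(1) uM] by metis
  qed
  moreover have "openin (top_of_set U) (P ` N)"
    using P_open_map N P_image by (intro open_subset) auto
  ultimately show "\<exists>T. x \<in> T \<and> openin (top_of_set U) T \<and>
      (\<exists>v. \<Union>v = M \<inter> p -` T \<and> (\<forall>u\<in>v. openin (top_of_set M) u) \<and> pairwise disjnt v \<and>
        (\<forall>u\<in>v. \<exists>q. homeomorphism u T p q))"
    using z N by (intro exI[of _ "P ` N"]) (auto intro!: exI[of _ v])
qed

lemma covering: "covering_space E P U"
  by (rule intermediate_covering[of "{\<one>}" id]) (use cont_P T_one in auto)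

lemma lift_loop:
  assumes "e \<in> E" "\<gamma> \<in> loops_at U (P e)"
  obtains \<beta> g where "path \<beta>" "path_image \<beta> \<subseteq> E" "pathstart \<beta> = e" "g \<in> carrier G"
    "pathfinish \<beta> = T g e" "path_class U (P \<circ> \<beta>) = path_class U \<gamma>"
proof -
  have \<gamma>: "path \<gamma>" "path_image \<gamma> \<subseteq> U" "pathstart \<gamma> = P e" "pathfinish \<gamma> = P e"
    using assms by (auto simp: loops_at_def)
  obtain \<beta> where \<beta>: "path \<beta>" "path_image \<beta> \<subseteq> E" "pathstart \<beta> = e"
    "\<And>t. t \<in> {0..1} \<Longrightarrow> P (\<beta> t) = \<gamma> t"
    using covering_space_lift_path_strong[OF covering assms(1) \<gamma>(1-3)] by metis
  have "pathfinish \<beta> \<in> E" using \<beta> by (meson pathfinish_in_path_image subsetD)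
  moreover have "P (pathfinish \<beta>) = P e"
    using \<beta>(4)[of 1] \<gamma>(4) by (simp add: pathfinish_def)
  ultimately obtain g where g: "g \<in> carrier G" "pathfinish \<beta> = T g e"
    using P_eq_iff[of e "pathfinish \<beta>"] assms by auto
  have "homotopic_paths U \<gamma> (P \<circ> \<beta>)"
    using \<gamma> \<beta>(4) by (intro homotopic_paths_eq) auto
  then have "path_class U (P \<circ> \<beta>) = path_class U \<gamma>"
    by (metis path_class_eqI)
  with \<beta> g show thesis using that by blast
qed

text \<open>The endpoint of the lift starting at \<open>e\<close>, read as a group element. The
  class may be represented by several P \<circ> \<beta>; monodromy together with freeness makes g
  unique (\<open>deck_of_eq\<close>).\<close>

definition deck_of :: "'a \<Rightarrow> (real \<Rightarrow> 'b) set \<Rightarrow> 'g" where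
  "deck_of e A = (THE g. g \<in> carrier G \<and> (\<exists>\<beta>. path \<beta> \<and> path_image \<beta> \<subseteq> E \<and> pathstart \<beta> = e \<and>
     pathfinish \<beta> = T g e \<and> path_class U (P \<circ> \<beta>) = A))"

lemma path_P:
  assumes "path \<beta>" "path_image \<beta> \<subseteq> E"
  shows "path (P \<circ> \<beta>)" "path_image (P \<circ> \<beta>) \<subseteq> U"
  using assms cont_P P_image continuous_on_subset
  by (auto intro!: path_continuous_image simp: path_image_compose)

lemma deck_of_eq:
  assumes e: "e \<in> E" and g: "g \<in> carrier G"
    and \<beta>: "path \<beta>" "path_image \<beta> \<subseteq> E" "pathstart \<beta> = e" "pathfinish \<beta> = T g e"
  shows "deck_of e (path_class U (P \<circ> \<beta>)) = g"
  unfolding deck_of_def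
proof (rule the_equality)
  show "g \<in> carrier G \<and> (\<exists>\<alpha>. path \<alpha> \<and> path_image \<alpha> \<subseteq> E \<and> pathstart \<alpha> = e \<and>
     pathfinish \<alpha> = T g e \<and> path_class U (P \<circ> \<alpha>) = path_class U (P \<circ> \<beta>))"
    using assms by blast
next
  fix h assume "h \<in> carrier G \<and> (\<exists>\<alpha>. path \<alpha> \<and> path_image \<alpha> \<subseteq> E \<and> pathstart \<alpha> = e \<and>
     pathfinish \<alpha> = T h e \<and> path_class U (P \<circ> \<alpha>) = path_class U (P \<circ> \<beta>))"
  then obtain \<alpha> where h: "h \<in> carrier G" and \<alpha>: "path \<alpha>" "path_image \<alpha> \<subseteq> E" "pathstart \<alpha> = e"
    "pathfinish \<alpha> = T h e" "path_class U (P \<circ> \<alpha>) = path_class U (P \<circ> \<beta>)" by blast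
  have "homotopic_paths U (P \<circ> \<beta>) (P \<circ> \<beta>)"
    using path_P[OF \<beta>(1,2)] by simp
  then have "homotopic_paths U (P \<circ> \<alpha>) (P \<circ> \<beta>)"
    using \<alpha>(5) unfolding path_class_def by blast
  then have "pathfinish \<alpha> = pathfinish \<beta>"
    using \<alpha> \<beta> path_P
    by (intro covering_space_monodromy[OF covering, of "P \<circ> \<alpha>" "P \<circ> \<beta>"]) auto
  then show "h = g"
    using T_eq_imp_eq[OF h g e] \<alpha> \<beta> by simp
qed

text \<open>The product of two loops lifts to \<alpha> followed by the translate T g \<circ>
  \<beta>, which ends at T g (T h e), so the order of the factors is preserved. Simple connectedness
  gives injectivity, since lifts with common endpoints are homotopic, and path-connectedness gives
  surjectivity.\<close>

lemma deck_of_iso: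
  assumes e: "e \<in> E" and sc: "simply_connected E"
  shows "deck_of e \<in> iso (fundamental_group U (P e)) G"
proof (rule isoI)
  let ?\<pi> = "fundamental_group U (P e)"
  have carr: "carrier ?\<pi> = path_class U ` loops_at U (P e)"
    by (simp add: fundamental_group_def)
  have lift: "\<exists>\<beta> g. path \<beta> \<and> path_image \<beta> \<subseteq> E \<and> pathstart \<beta> = e \<and> g \<in> carrier G \<and>
      pathfinish \<beta> = T g e \<and> A = path_class U (P \<circ> \<beta>)" if "A \<in> carrier ?\<pi>" for A
  proof -
    obtain \<gamma> where "\<gamma> \<in> loops_at U (P e)" "A = path_class U \<gamma>"
      using \<open>A \<in> carrier ?\<pi>\<close> carr by blast
    then show ?thesis using lift_loop[OF e, of \<gamma>] by metis
  qed
  have loop: "P \<circ> \<beta> \<in> loops_at U (P e)"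
    if "path \<beta>" "path_image \<beta> \<subseteq> E" "pathstart \<beta> = e" "g \<in> carrier G" "pathfinish \<beta> = T g e" for \<beta> g
    using that path_P[of \<beta>] e by (auto simp: loops_at_def pathstart_compose pathfinish_compose)
  show "deck_of e \<in> hom ?\<pi> G"
  proof (rule homI)
    fix A assume "A \<in> carrier ?\<pi>"
    then show "deck_of e A \<in> carrier G" using lift[of A] deck_of_eq[OF e] by auto
  next
    fix A B assume A: "A \<in> carrier ?\<pi>" and B: "B \<in> carrier ?\<pi>"
    obtain \<alpha> g where \<alpha>: "path \<alpha>" "path_image \<alpha> \<subseteq> E" "pathstart \<alpha> = e" "g \<in> carrier G"
      "pathfinish \<alpha> = T g e" "A = path_class U (P \<circ> \<alpha>)" using lift[OF A] by blast
    obtain \<beta> h where \<beta>: "path \<beta>" "path_image \<beta> \<subseteq> E" "pathstart \<beta> = e" "h \<in> carrier G"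
      "pathfinish \<beta> = T h e" "B = path_class U (P \<circ> \<beta>)" using lift[OF B] by blast
    have T\<beta>: "path (T g \<circ> \<beta>)" "path_image (T g \<circ> \<beta>) \<subseteq> E"
      "pathstart (T g \<circ> \<beta>) = T g e" "pathfinish (T g \<circ> \<beta>) = T (g \<otimes> h) e"
      using \<beta> \<alpha> T_cont[of g] T_in T_mult e continuous_on_subset
      by (auto intro!: path_continuous_image simp: path_image_compose pathstart_compose pathfinish_compose)
    define \<gamma> where "\<gamma> = \<alpha> +++ (T g \<circ> \<beta>)"
    have \<gamma>: "path \<gamma>" "path_image \<gamma> \<subseteq> E" "pathstart \<gamma> = e" "pathfinish \<gamma> = T (g \<otimes> h) e"
      using \<alpha> T\<beta> by (auto simp: \<gamma>_def path_image_join)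
    have pT: "P (T g (\<beta> t)) = P (\<beta> t)" if "t \<in> {0..1}" for t
    proof -
      have "\<beta> t \<in> E" using that \<beta>(2) by (auto simp: path_image_def)
      then show ?thesis using \<alpha>(4) by simp
    qed
    have "homotopic_paths U ((P \<circ> \<alpha>) +++ (P \<circ> \<beta>)) (P \<circ> \<gamma>)"
    proof (rule homotopic_paths_eq)
      show "path ((P \<circ> \<alpha>) +++ (P \<circ> \<beta>))" "path_image ((P \<circ> \<alpha>) +++ (P \<circ> \<beta>)) \<subseteq> U"
        using loops_at_join[OF loop loop, of \<alpha> g \<beta> h] \<alpha> \<beta> by (auto simp: loops_at_def)
      show "((P \<circ> \<alpha>) +++ (P \<circ> \<beta>)) t = (P \<circ> \<gamma>) t" if "t \<in> {0..1}" for t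
        using that pT by (auto simp: \<gamma>_def joinpaths_def)
    qed
    then have "A \<otimes>\<^bsub>?\<pi>\<^esub> B = path_class U (P \<circ> \<gamma>)"
      using fundamental_group_mult[OF loop loop, of \<alpha> g \<beta> h] \<alpha> \<beta> by (simp add: path_class_eqI)
    then show "deck_of e (A \<otimes>\<^bsub>?\<pi>\<^esub> B) = deck_of e A \<otimes> deck_of e B"
      using \<alpha> \<beta> \<gamma> e by (simp add: deck_of_eq)
  qed
  show "bij_betw (deck_of e) (carrier ?\<pi>) (carrier G)"
    unfolding bij_betw_def
  proof
    show "inj_on (deck_of e) (carrier ?\<pi>)"
    proof (rule inj_onI)
      fix A B assume A: "A \<in> carrier ?\<pi>" and B: "B \<in> carrier ?\<pi>" and eq: "deck_of e A = deck_of e B"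
      obtain \<alpha> g where \<alpha>: "path \<alpha>" "path_image \<alpha> \<subseteq> E" "pathstart \<alpha> = e" "g \<in> carrier G"
        "pathfinish \<alpha> = T g e" "A = path_class U (P \<circ> \<alpha>)" using lift[OF A] by blast
      obtain \<beta> h where \<beta>: "path \<beta>" "path_image \<beta> \<subseteq> E" "pathstart \<beta> = e" "h \<in> carrier G"
        "pathfinish \<beta> = T h e" "B = path_class U (P \<circ> \<beta>)" using lift[OF B] by blast
      have "g = h" using eq \<alpha> \<beta> e by (simp add: deck_of_eq)
      then have "homotopic_paths E \<alpha> \<beta>"
        using sc \<alpha> \<beta> unfolding simply_connected_eq_homotopic_paths by metis
      then have "homotopic_paths U (P \<circ> \<alpha>) (P \<circ> \<beta>)"
        using cont_P P_image by (intro homotopic_paths_continuous_image) auto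
      then show "A = B" using \<alpha> \<beta> path_class_eqI by blast
    qed
    show "deck_of e ` carrier ?\<pi> = carrier G"
    proof (intro equalityI subsetI)
      fix g assume "g \<in> deck_of e ` carrier ?\<pi>"
      then show "g \<in> carrier G" using lift deck_of_eq[OF e] by fastforce
    next
      fix g assume g: "g \<in> carrier G"
      obtain \<beta> where \<beta>: "path \<beta>" "path_image \<beta> \<subseteq> E" "pathstart \<beta> = e" "pathfinish \<beta> = T g e"
        using simply_connected_imp_path_connected[OF sc] e T_in[OF g e]
        unfolding path_connected_def by metis
      then have "path_class U (P \<circ> \<beta>) \<in> carrier ?\<pi>" using loop[of \<beta> g] g carr by auto
      then show "g \<in> deck_of e ` carrier ?\<pi>"
        using deck_of_eq[OF e g \<beta>] by (metis image_eqI)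
    qed
  qed
qed

text \<open>A loop in \<open>U\<close> comes from a loop in \<open>M\<close>, up to homotopy,
  exactly when its lift to \<open>E\<close> ends in the \<pi>-fibre of \<open>e\<close>, that is, at
  T k e with k \<in> K.\<close>

lemma intermediate_subgroup:
  fixes \<pi> :: "'a \<Rightarrow> 'c::real_normed_vector" and p :: "'c \<Rightarrow> 'b"
  assumes e: "e \<in> E" and sc: "simply_connected E" and K: "K \<subseteq> carrier G"
    and cov: "covering_space E \<pi> M"
    and p: "continuous_on M p" "\<And>z. z \<in> E \<Longrightarrow> p (\<pi> z) = P z"
    and \<pi>_eq_iff: "\<And>z z'. z \<in> E \<Longrightarrow> z' \<in> E \<Longrightarrow> \<pi> z = \<pi> z' \<longleftrightarrow> (\<exists>k\<in>K. z' = T k z)"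
  shows "induced_map U p ` carrier (fundamental_group M (\<pi> e)) =
    {A \<in> carrier (fundamental_group U (P e)). deck_of e A \<in> K}" (is "?L = ?R")
proof -
  have contpi: "continuous_on E \<pi>" and piE: "\<pi> ` E = M"
    using cov covering_space_imp_continuous covering_space_imp_surjective by blast+
  have pM: "p ` M = U"
  proof -
    have "(\<lambda>z. p (\<pi> z)) ` E = P ` E" using p(2) by (rule image_cong[OF refl])
    then show ?thesis using P_image piE by (metis image_image)
  qed
  have ind: "induced_map U p (path_class M \<gamma>) = path_class U (p \<circ> \<gamma>)" if "\<gamma> \<in> loops_at M (\<pi> e)" for \<gamma>
    using induced_map_path_class[OF p(1) _ that] pM by blast
  have carrM: "carrier (fundamental_group M (\<pi> e)) = path_class M ` loops_at M (\<pi> e)"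
    and carrU: "carrier (fundamental_group U (P e)) = path_class U ` loops_at U (P e)"
    by (simp_all add: fundamental_group_def)
  show ?thesis
  proof (intro equalityI subsetI)
    fix A assume "A \<in> ?L"
    then obtain \<gamma> where \<gamma>: "\<gamma> \<in> loops_at M (\<pi> e)" "A = path_class U (p \<circ> \<gamma>)"
      using ind carrM by auto
    have pth: "path \<gamma>" "path_image \<gamma> \<subseteq> M" "pathstart \<gamma> = \<pi> e" "pathfinish \<gamma> = \<pi> e"
      using \<gamma> by (auto simp: loops_at_def)
    obtain \<beta> where \<beta>: "path \<beta>" "path_image \<beta> \<subseteq> E" "pathstart \<beta> = e"
      "\<And>t. t \<in> {0..1} \<Longrightarrow> \<pi> (\<beta> t) = \<gamma> t"
      using covering_space_lift_path_strong[OF cov e pth(1-3)] by metis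
    have fE: "pathfinish \<beta> \<in> E" using \<beta> by (meson pathfinish_in_path_image subsetD)
    moreover have "\<pi> (pathfinish \<beta>) = \<pi> e"
      using \<beta>(4)[of 1] pth(4) by (simp add: pathfinish_def)
    ultimately obtain k where k: "k \<in> K" "pathfinish \<beta> = T k e"
      using \<pi>_eq_iff[of e "pathfinish \<beta>"] e by auto
    have eq: "P (\<beta> t) = p (\<gamma> t)" if "t \<in> {0..1}" for t
    proof -
      have "\<beta> t \<in> E" using that \<beta>(2) by (auto simp: path_image_def)
      then show ?thesis using p(2) \<beta>(4)[OF that] by metis
    qed
    have "path (p \<circ> \<gamma>)" "path_image (p \<circ> \<gamma>) \<subseteq> U"
      using pth(1,2) p(1) pM continuous_on_subset
      by (auto intro!: path_continuous_image simp: path_image_compose)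
    then have "homotopic_paths U (p \<circ> \<gamma>) (P \<circ> \<beta>)"
      using eq by (intro homotopic_paths_eq) auto
    then have A: "A = path_class U (P \<circ> \<beta>)"
      using path_class_eqI \<gamma> by blast
    have "P \<circ> \<beta> \<in> loops_at U (P e)"
      using path_P[OF \<beta>(1,2)] \<beta>(3) k K e by (auto simp: loops_at_def pathstart_compose pathfinish_compose)
    then show "A \<in> ?R"
      using A deck_of_eq[OF e _ \<beta>(1-3) k(2)] k K carrU by auto
  next
    fix A assume "A \<in> ?R"
    then obtain \<gamma> where \<gamma>: "\<gamma> \<in> loops_at U (P e)" "A = path_class U \<gamma>" "deck_of e A \<in> K"
      using carrU by auto
    obtain \<beta> g where \<beta>: "path \<beta>" "path_image \<beta> \<subseteq> E" "pathstart \<beta> = e" "g \<in> carrier G"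
      "pathfinish \<beta> = T g e" "path_class U (P \<circ> \<beta>) = path_class U \<gamma>"
      using lift_loop[OF e \<gamma>(1)] .
    have "g \<in> K" using deck_of_eq[OF e \<beta>(4,1-3,5)] \<beta> \<gamma> by simp
    then have "\<pi> (T g e) = \<pi> e"
      using \<pi>_eq_iff[OF e T_in[OF \<beta>(4) e]] by auto
    then have l: "\<pi> \<circ> \<beta> \<in> loops_at M (\<pi> e)"
      using \<beta> contpi piE continuous_on_subset
      by (auto intro!: path_continuous_image simp: loops_at_def path_image_compose
          pathstart_compose pathfinish_compose)
    have "homotopic_paths U (P \<circ> \<beta>) (p \<circ> (\<pi> \<circ> \<beta>))"
    proof (rule homotopic_paths_eq[OF path_P[OF \<beta>(1,2)]])
      fix t :: real assume "t \<in> {0..1}"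
      then have "\<beta> t \<in> E" using \<beta>(2) by (auto simp: path_image_def)
      then show "(P \<circ> \<beta>) t = (p \<circ> (\<pi> \<circ> \<beta>)) t" using p(2) by simp
    qed
    then have "A = path_class U (p \<circ> (\<pi> \<circ> \<beta>))"
      using path_class_eqI \<gamma> \<beta> by metis
    then show "A \<in> ?L" using ind[OF l] l carrM by auto
  qed
qed

end

section \<open>Holomorphic functions of three variables\<close>

definition hol :: "(complex3 \<Rightarrow> complex) \<Rightarrow> complex3 set \<Rightarrow> bool" where
  "hol f S \<longleftrightarrow> open S \<and>
     (\<forall>z\<in>S. \<exists>f'. (f has_derivative f') (at z) \<and> (\<forall>w v. f' (cscale w v) = w * f' v))"

lemma holI:
  assumes "open S"
    and "\<And>z. z \<in> S \<Longrightarrow> \<exists>f'. (f has_derivative f') (at z) \<and> (\<forall>w v. f' (cscale w v) = w * f' v)"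
  shows "hol f S"
  using assms by (simp add: hol_def)

lemma holE:
  assumes "hol f S" "z \<in> S"
  obtains f' where "(f has_derivative f') (at z)" "\<And>w v. f' (cscale w v) = w * f' v"
  using assms unfolding hol_def by blast

lemma hol_open: "hol f S \<Longrightarrow> open S"
  by (simp add: hol_def)

lemma hol_subset: "hol f S \<Longrightarrow> open T \<Longrightarrow> T \<subseteq> S \<Longrightarrow> hol f T"
  unfolding hol_def by blast

lemma hol_local:
  assumes "open S" "\<And>z. z \<in> S \<Longrightarrow> \<exists>N. z \<in> N \<and> hol f N"
  shows "hol f S"
  using assms unfolding hol_def by blast

lemma hol_cong:
  assumes "hol f S" "\<And>z. z \<in> S \<Longrightarrow> g z = f z"
  shows "hol g S"
proof (rule holI)
  show "open S" using assms by (simp add: hol_def)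
  fix z assume z: "z \<in> S"
  obtain f' where f': "(f has_derivative f') (at z)" "\<forall>w v. f' (cscale w v) = w * f' v"
    using assms z by (auto simp: hol_def)
  have "(g has_derivative f') (at z)"
    using has_derivative_transform_within_open[OF f'(1) \<open>open S\<close> z] assms by auto
  with f' show "\<exists>f'. (g has_derivative f') (at z) \<and> (\<forall>w v. f' (cscale w v) = w * f' v)" by blast
qed

lemma hol_imp_continuous_on: "hol f S \<Longrightarrow> continuous_on S f"
  unfolding hol_def
  by (metis continuous_at_imp_continuous_on has_derivative_continuous)

lemma hol_const [intro, simp]: "open S \<Longrightarrow> hol (\<lambda>z. a) S"
  by (rule holI) (auto intro!: exI[of _ "\<lambda>_. 0"])

lemma hol_coords:
  assumes "open S"
  shows "hol fst S" "hol (\<lambda>z. fst (snd z)) S" "hol (\<lambda>z. snd (snd z)) S"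
proof -
  show "hol fst S"
    using assms by (intro holI exI[of _ fst]) (auto intro!: derivative_eq_intros simp: cscale_def)
  show "hol (\<lambda>z. fst (snd z)) S"
    using assms by (intro holI exI[of _ "\<lambda>z. fst (snd z)"])
      (auto intro!: derivative_eq_intros simp: cscale_def)
  show "hol (\<lambda>z. snd (snd z)) S"
    using assms by (intro holI exI[of _ "\<lambda>z. snd (snd z)"])
      (auto intro!: derivative_eq_intros simp: cscale_def)
qed

lemma hol_add:
  assumes "hol f S" "hol g S"
  shows "hol (\<lambda>z. f z + g z) S"
proof (rule holI)
  fix z assume "z \<in> S"
  then obtain f' g' where *: "(f has_derivative f') (at z)" "\<And>w v. f' (cscale w v) = w * f' v"
    "(g has_derivative g') (at z)" "\<And>w v. g' (cscale w v) = w * g' v"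
    using holE[OF assms(1)] holE[OF assms(2)] by metis
  show "\<exists>h. ((\<lambda>z. f z + g z) has_derivative h) (at z) \<and> (\<forall>w v. h (cscale w v) = w * h v)"
    using * by (intro exI[of _ "\<lambda>v. f' v + g' v"]) (auto intro!: derivative_intros simp: algebra_simps)
qed (use assms hol_open in blast)

lemma hol_mult:
  assumes "hol f S" "hol g S"
  shows "hol (\<lambda>z. f z * g z) S"
proof (rule holI)
  fix z assume "z \<in> S"
  then obtain f' g' where *: "(f has_derivative f') (at z)" "\<And>w v. f' (cscale w v) = w * f' v"
    "(g has_derivative g') (at z)" "\<And>w v. g' (cscale w v) = w * g' v"
    using holE[OF assms(1)] holE[OF assms(2)] by metis
  show "\<exists>h. ((\<lambda>z. f z * g z) has_derivative h) (at z) \<and> (\<forall>w v. h (cscale w v) = w * h v)"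
    using * by (intro exI[of _ "\<lambda>v. f z * g' v + f' v * g z"])
      (auto intro!: derivative_intros simp: algebra_simps)
qed (use assms hol_open in blast)

lemma hol_compose_holomorphic:
  assumes "hol f S" "g holomorphic_on T" "open T" "f ` S \<subseteq> T"
  shows "hol (\<lambda>z. g (f z)) S"
proof (rule holI)
  fix z assume z: "z \<in> S"
  then obtain f' where *: "(f has_derivative f') (at z)" "\<And>w v. f' (cscale w v) = w * f' v"
    using holE[OF assms(1)] by metis
  obtain D where "(g has_field_derivative D) (at (f z))"
    using assms z holomorphic_on_imp_differentiable_at[of g T "f z"]
    by (auto simp: field_differentiable_def)
  then have "((\<lambda>z. g (f z)) has_derivative (\<lambda>v. D * f' v)) (at z)"
    using has_derivative_compose[OF *(1), of g "(*) D"] by (simp add: has_field_derivative_def)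
  then show "\<exists>h. ((\<lambda>z. g (f z)) has_derivative h) (at z) \<and> (\<forall>w v. h (cscale w v) = w * h v)"
    using * by (intro exI[of _ "\<lambda>v. D * f' v"]) auto
qed (use assms hol_open in blast)

lemma hol_entire:
  assumes "hol f S" "g holomorphic_on UNIV"
  shows "hol (\<lambda>z. g (f z)) S"
  using hol_compose_holomorphic[OF assms] by auto

lemma hol_uminus: "hol f S \<Longrightarrow> hol (\<lambda>z. - f z) S"
  by (rule hol_entire[where g = uminus]) (auto intro!: holomorphic_intros)

lemma hol_diff:
  assumes "hol f S" "hol g S"
  shows "hol (\<lambda>z. f z - g z) S"
  using hol_add[OF assms(1) hol_uminus[OF assms(2)]] by simp

lemma hol_power: "hol f S \<Longrightarrow> hol (\<lambda>z. f z ^ n) S"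
  by (rule hol_entire[where g = "\<lambda>w. w ^ n"]) (auto intro!: holomorphic_intros)

lemma hol_exp: "hol f S \<Longrightarrow> hol (\<lambda>z. exp (f z)) S"
  by (rule hol_entire[where g = exp]) (auto intro!: holomorphic_intros)

lemma hol_poly: "hol f S \<Longrightarrow> hol (\<lambda>z. poly p (f z)) S"
  by (rule hol_entire[where g = "poly p"]) (auto intro!: holomorphic_intros)

lemma hol_inverse:
  assumes "hol f S" "\<And>z. z \<in> S \<Longrightarrow> f z \<noteq> 0"
  shows "hol (\<lambda>z. inverse (f z)) S"
  using assms
  by (intro hol_compose_holomorphic[where g = inverse and T = "-{0}"]) (auto intro!: holomorphic_intros)

lemma hol_divide:
  assumes "hol f S" "hol g S" "\<And>z. z \<in> S \<Longrightarrow> g z \<noteq> 0"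
  shows "hol (\<lambda>z. f z / g z) S"
  using hol_mult[OF assms(1) hol_inverse[OF assms(2,3)]] by (simp add: divide_inverse)

lemma hol_sum:
  assumes "open S" "\<And>i. i \<in> I \<Longrightarrow> hol (f i) S"
  shows "hol (\<lambda>z. \<Sum>i\<in>I. f i z) S"
  using assms(2) by (induction I rule: infinite_finite_induct) (auto intro!: hol_add simp: assms(1))

lemmas hol_intros = hol_const hol_coords hol_add hol_diff hol_uminus hol_mult hol_power hol_exp
  hol_poly hol_sum

lemma holomorphic3_components:
  assumes "hol f S" "hol g S" "hol h S"
  shows "holomorphic3 (\<lambda>z. (f z, g z, h z)) S"
  unfolding holomorphic3_def
proof (intro conjI ballI)
  show "open S" using assms hol_open by blast
  fix z assume z: "z \<in> S"
  obtain f' where f: "(f has_derivative f') (at z)" "\<And>w v. f' (cscale w v) = w * f' v"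
    using holE[OF assms(1) z] by metis
  obtain g' where g: "(g has_derivative g') (at z)" "\<And>w v. g' (cscale w v) = w * g' v"
    using holE[OF assms(2) z] by metis
  obtain h' where h: "(h has_derivative h') (at z)" "\<And>w v. h' (cscale w v) = w * h' v"
    using holE[OF assms(3) z] by metis
  show "\<exists>F. ((\<lambda>z. (f z, g z, h z)) has_derivative F) (at z) \<and> (\<forall>w v. F (cscale w v) = cscale w (F v))"
    by (intro exI[of _ "\<lambda>v. (f' v, g' v, h' v)"] conjI has_derivative_Pair f g h)
      (use f(2) g(2) h(2) in \<open>simp add: cscale_def\<close>)
qed

lemma holomorphic3_compose:
  assumes "holomorphic3 f S" "holomorphic3 g T" "f ` S \<subseteq> T"
  shows "holomorphic3 (\<lambda>z. g (f z)) S"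
  unfolding holomorphic3_def
proof (intro conjI ballI)
  show "open S" using assms by (simp add: holomorphic3_def)
  fix z assume z: "z \<in> S"
  then obtain f' where f: "(f has_derivative f') (at z)" "\<And>w v. f' (cscale w v) = cscale w (f' v)"
    using assms(1) unfolding holomorphic3_def by blast
  have "f z \<in> T" using z assms(3) by blast
  then obtain g' where g: "(g has_derivative g') (at (f z))" "\<And>w v. g' (cscale w v) = cscale w (g' v)"
    using assms(2) unfolding holomorphic3_def by blast
  show "\<exists>h. ((\<lambda>z. g (f z)) has_derivative h) (at z) \<and> (\<forall>w v. h (cscale w v) = cscale w (h v))"
    using has_derivative_compose[OF f(1) g(1)] f g by (intro exI[of _ "\<lambda>v. g' (f' v)"]) auto
qed

lemma hol_compose:
  assumes "hol g T" "holomorphic3 f S" "f ` S \<subseteq> T"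
  shows "hol (\<lambda>z. g (f z)) S"
proof (rule holI)
  show "open S" using assms by (simp add: holomorphic3_def)
  fix z assume z: "z \<in> S"
  then obtain f' where f: "(f has_derivative f') (at z)" "\<And>w v. f' (cscale w v) = cscale w (f' v)"
    using assms(2) unfolding holomorphic3_def by blast
  have "f z \<in> T" using z assms(3) by blast
  then obtain g' where g: "(g has_derivative g') (at (f z))" "\<And>w v. g' (cscale w v) = w * g' v"
    using holE[OF assms(1)] by metis
  show "\<exists>h. ((\<lambda>z. g (f z)) has_derivative h) (at z) \<and> (\<forall>w v. h (cscale w v) = w * h v)"
    using has_derivative_compose[OF f(1) g(1)] f g by (intro exI[of _ "\<lambda>v. g' (f' v)"]) auto
qed

lemma hol_compose3:
  assumes "hol F T" "hol f S" "hol g S" "hol h S" "\<And>z. z \<in> S \<Longrightarrow> (f z, g z, h z) \<in> T"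
  shows "hol (\<lambda>z. F (f z, g z, h z)) S"
  by (rule hol_compose[OF assms(1) holomorphic3_components[OF assms(2-4)]]) (use assms(5) in blast)

lemma holomorphic3_subset: "holomorphic3 f S \<Longrightarrow> open T \<Longrightarrow> T \<subseteq> S \<Longrightarrow> holomorphic3 f T"
  unfolding holomorphic3_def by blast

lemma holomorphic3_local:
  assumes "open S" "\<And>z. z \<in> S \<Longrightarrow> \<exists>N. z \<in> N \<and> holomorphic3 f N"
  shows "holomorphic3 f S"
  using assms unfolding holomorphic3_def by blast

lemma holomorphic3_cong:
  assumes "holomorphic3 f S" "\<And>z. z \<in> S \<Longrightarrow> g z = f z"
  shows "holomorphic3 g S"
  unfolding holomorphic3_def
proof (intro conjI ballI)
  show "open S" using assms by (simp add: holomorphic3_def)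
  fix z assume z: "z \<in> S"
  obtain f' where f': "(f has_derivative f') (at z)" "\<forall>w v. f' (cscale w v) = cscale w (f' v)"
    using assms z by (auto simp: holomorphic3_def)
  have "(g has_derivative f') (at z)"
    using has_derivative_transform_within_open[OF f'(1) \<open>open S\<close> z] assms by auto
  with f' show "\<exists>f'. (g has_derivative f') (at z) \<and> (\<forall>w v. f' (cscale w v) = cscale w (f' v))" by blast
qed

lemma holomorphic3_imp_continuous_on: "holomorphic3 f S \<Longrightarrow> continuous_on S f"
  unfolding holomorphic3_def
  by (metis continuous_at_imp_continuous_on has_derivative_continuous)

lemma open_slice:
  fixes S :: "complex3 set"
  assumes "open S"
  shows "open {x. (x, b, c) \<in> S}" "open {x. (a, x, c) \<in> S}" "open {x. (a, b, x) \<in> S}"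
proof -
  have "open ((\<lambda>x. (x, b, c)) -` S)" "open ((\<lambda>x. (a, x, c)) -` S)" "open ((\<lambda>x. (a, b, x)) -` S)"
    by (intro open_vimage assms continuous_intros)+
  then show "open {x. (x, b, c) \<in> S}" "open {x. (a, x, c) \<in> S}" "open {x. (a, b, x) \<in> S}"
    by (simp_all add: vimage_def)
qed

lemma hol_slices:
  assumes "hol f S"
  shows "(\<lambda>x. f (x, b, c)) holomorphic_on {x. (x, b, c) \<in> S}"
    and "(\<lambda>x. f (a, x, c)) holomorphic_on {x. (a, x, c) \<in> S}"
    and "(\<lambda>x. f (a, b, x)) holomorphic_on {x. (a, b, x) \<in> S}"
proof -
  have slice: "(\<lambda>x. f (g x)) holomorphic_on {x. g x \<in> S}"
    if g: "\<And>x. (g has_derivative (\<lambda>h. cscale h e)) (at x)" for g e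
    unfolding holomorphic_on_def
  proof
    fix x assume "x \<in> {x. g x \<in> S}"
    then obtain f' where f': "(f has_derivative f') (at (g x))" "\<And>w v. f' (cscale w v) = w * f' v"
      using holE[OF assms] by blast
    have "((\<lambda>x. f (g x)) has_derivative (\<lambda>h. f' (cscale h e))) (at x)"
      using has_derivative_compose[OF g f'(1)] .
    then have "((\<lambda>x. f (g x)) has_field_derivative f' e) (at x)"
      by (simp add: f'(2) has_field_derivative_def mult.commute[of _ "f' e"])
    then show "(\<lambda>x. f (g x)) field_differentiable at x within {x. g x \<in> S}"
      using field_differentiable_at_within field_differentiable_def by blast
  qed
  show "(\<lambda>x. f (x, b, c)) holomorphic_on {x. (x, b, c) \<in> S}"
    by (rule slice[of _ "(1, 0, 0)"]) (auto intro!: derivative_eq_intros simp: cscale_def zero_prod_def)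
  show "(\<lambda>x. f (a, x, c)) holomorphic_on {x. (a, x, c) \<in> S}"
    by (rule slice[of _ "(0, 1, 0)"]) (auto intro!: derivative_eq_intros simp: cscale_def zero_prod_def)
  show "(\<lambda>x. f (a, b, x)) holomorphic_on {x. (a, b, x) \<in> S}"
    by (rule slice[of _ "(0, 0, 1)"]) (auto intro!: derivative_eq_intros simp: cscale_def)
qed

subsection \<open>Cauchy's formula with parameters and Osgood's lemma\<close>

text \<open>On the circle the velocity is 2 pi i (u - z0), which cancels the factor in Cauchy's
  formula and leaves an integral over a fixed interval. In this form parameters of \<open>f\<close>
  can be treated under the integral sign.\<close>

lemma deriv_eq_circle_integral:
  assumes r: "r > 0" and f: "continuous_on (cball z0 r) f" "f holomorphic_on ball z0 r" and z: "z \<in> ball z0 r"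
  shows "deriv f z = integral {0..1} (\<lambda>t. f (circlepath z0 r t) * (circlepath z0 r t - z0) / (circlepath z0 r t - z)\<^sup>2)"
proof -
  have "deriv f z = 1 / (2 * of_real pi * \<i>) * contour_integral (circlepath z0 r) (\<lambda>u. f u / (u - z)\<^sup>2)"
    using Cauchy_derivative_integral_circlepath(2)[OF f z] by (rule DERIV_imp_deriv)
  also have "\<dots> = 1 / (2 * of_real pi * \<i>) *
      integral {0..1} (\<lambda>t. (2 * of_real pi * \<i>) * (f (circlepath z0 r t) * (circlepath z0 r t - z0) / (circlepath z0 r t - z)\<^sup>2))"
  proof -
    have "contour_integral (circlepath z0 r) (\<lambda>u. f u / (u - z)\<^sup>2) =
      integral {0..1} (\<lambda>t. (2 * of_real pi * \<i>) * (f (circlepath z0 r t) * (circlepath z0 r t - z0) / (circlepath z0 r t - z)\<^sup>2))"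
      unfolding contour_integral_integral
    proof (rule Henstock_Kurzweil_Integration.integral_cong)
      fix t :: real
      have "vector_derivative (circlepath z0 r) (at t) = 2 * of_real pi * \<i> * (circlepath z0 r t - z0)"
        by (simp add: vector_derivative_circlepath, simp add: circlepath)
      then show "f (circlepath z0 r t) / (circlepath z0 r t - z)\<^sup>2 * vector_derivative (circlepath z0 r) (at t) =
        2 * of_real pi * \<i> * (f (circlepath z0 r t) * (circlepath z0 r t - z0) / (circlepath z0 r t - z)\<^sup>2)"
        by (simp only:) (simp add: mult.commute mult.left_commute)
    qed
    then show ?thesis by (rule arg_cong)
  qed
  also have "\<dots> = integral {0..1} (\<lambda>t. f (circlepath z0 r t) * (circlepath z0 r t - z0) / (circlepath z0 r t - z)\<^sup>2)"
    unfolding Henstock_Kurzweil_Integration.integral_mult_right by simp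
  finally show ?thesis .
qed

lemma circlepath_props:
  assumes "r > 0"
  shows "continuous_on A (circlepath z0 r)" "circlepath z0 r t \<in> cball z0 r" "dist z0 (circlepath z0 r t) = r"
  using assms by (auto simp: circlepath dist_norm norm_mult intro!: continuous_intros)

lemma continuous_on_deriv_param:
  fixes f :: "complex \<Rightarrow> 'p::topological_space \<Rightarrow> complex"
  assumes r: "r > 0" and cont: "continuous_on (cball z0 r \<times> X) (\<lambda>(z, p). f z p)"
    and hol: "\<And>p. p \<in> X \<Longrightarrow> (\<lambda>z. f z p) holomorphic_on ball z0 r"
  shows "continuous_on (ball z0 r \<times> X) (\<lambda>(z, p). deriv (\<lambda>z. f z p) z)"
proof -
  let ?c = "circlepath z0 r"
  let ?F = "\<lambda>zp t. f (?c t) (snd zp) * (?c t - z0) / (?c t - fst zp)\<^sup>2"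
  have "continuous_on ((ball z0 r \<times> X) \<times> cbox 0 1) (\<lambda>(zp, t). ?F zp t)"
    unfolding split_beta
  proof (intro continuous_intros continuous_on_compose2[OF circlepath_props(1)[OF r]])
    show "continuous_on ((ball z0 r \<times> X) \<times> cbox 0 1) (\<lambda>x. f (?c (snd x)) (snd (fst x)))"
    proof -
      have "continuous_on ((ball z0 r \<times> X) \<times> cbox 0 1)
        ((\<lambda>(z, p). f z p) \<circ> (\<lambda>x. (?c (snd x), snd (fst x))))"
        using circlepath_props[OF r]
        by (intro continuous_on_compose continuous_on_subset[OF cont] continuous_intros
            continuous_on_compose2[OF circlepath_props(1)[OF r]]) auto
      then show ?thesis by (simp add: o_def)
    qed
    show "\<forall>x\<in>(ball z0 r \<times> X) \<times> cbox 0 1. (?c (snd x) - fst (fst x))\<^sup>2 \<noteq> 0"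
      using circlepath_props(3)[OF r] by (fastforce simp: dist_norm)
  qed auto
  then have "continuous_on (ball z0 r \<times> X) (\<lambda>zp. integral (cbox 0 1) (?F zp))"
    by (rule integral_continuous_on_param)
  moreover have "(\<lambda>(z, p). deriv (\<lambda>z. f z p) z) zp = integral (cbox 0 1) (?F zp)"
    if zp: "zp \<in> ball z0 r \<times> X" for zp
  proof -
    have "continuous_on (cball z0 r) (\<lambda>z. f z (snd zp))"
      using zp by (intro continuous_on_compose2[OF cont, where f = "\<lambda>z. (z, snd zp)", simplified] continuous_intros) auto
    then show ?thesis
      using deriv_eq_circle_integral[OF r _ hol, of "snd zp" "fst zp"] zp by (auto simp: split_beta)
  qed
  ultimately show ?thesis
    by (simp cong: continuous_on_cong)
qed

text \<open>Adds one complex variable to a total derivative. Differentiability in \<open>p\<close>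
  enters only at the single value \<open>z0\<close>, because Cauchy's formula makes the partial
  derivative in \<open>z\<close> jointly continuous.\<close>

lemma has_derivative_param:
  fixes f :: "'p::real_normed_vector \<Rightarrow> complex \<Rightarrow> complex"
  assumes D: "open D" "(p0, z0) \<in> D" and cont: "continuous_on D (\<lambda>(p, z). f p z)"
    and hol: "\<And>p. f p holomorphic_on {z. (p, z) \<in> D}"
    and fx: "((\<lambda>p. f p z0) has_derivative fx) (at p0)"
  shows "((\<lambda>(p, z). f p z) has_derivative (\<lambda>(p, z). fx p + deriv (f p0) z0 * z)) (at (p0, z0))"
proof -
  obtain A B where AB: "open A" "open B" "p0 \<in> A" "z0 \<in> B" "A \<times> B \<subseteq> D"
    using open_prod_elim[OF D] by (metis mem_Sigma_iff)
  then obtain r where r: "r > 0" "cball z0 r \<subseteq> B" using open_contains_cball by blast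
  have sub: "A \<times> cball z0 r \<subseteq> D" using AB r by auto
  have hb: "f p holomorphic_on ball z0 r" if "p \<in> A" for p
    using hol[of p] by (rule holomorphic_on_subset) (use sub that in auto)
  have "continuous_on (cball z0 r \<times> A) ((\<lambda>(p, z). f p z) \<circ> (\<lambda>(z, p). (p, z)))"
    using sub by (intro continuous_on_compose continuous_on_subset[OF cont])
      (auto intro!: continuous_intros simp: split_beta)
  then have "continuous_on (cball z0 r \<times> A) (\<lambda>(z, p). f p z)"
    by (simp add: o_def split_beta)
  from continuous_on_deriv_param[OF r(1) this] hb
  have cd: "continuous_on (ball z0 r \<times> A) (\<lambda>(z, p). deriv (f p) z)" by simp
  have "continuous_on (A \<times> ball z0 r) ((\<lambda>(z, p). deriv (f p) z) \<circ> (\<lambda>(p, z). (z, p)))"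
    by (intro continuous_on_compose continuous_on_subset[OF cd])
      (auto intro!: continuous_intros simp: split_beta)
  then have "continuous_on (A \<times> ball z0 r) (\<lambda>(p, z). blinfun_mult_right (deriv (f p) z))"
    using bounded_linear.continuous_on[OF bounded_linear_blinfun_mult_right]
    by (auto simp add: o_def split_beta)
  then have c: "continuous (at (p0, z0) within A \<times> ball z0 r) (\<lambda>(p, z). blinfun_mult_right (deriv (f p) z))"
    using AB r by (simp add: continuous_on_eq_continuous_within)
  have "((\<lambda>(p, z). f p z) has_derivative
      (\<lambda>(p, z). fx p + blinfun_mult_right (deriv (f p0) z0) z)) (at (p0, z0) within A \<times> ball z0 r)"
  proof (rule has_derivative_partialsI[OF _ _ c])
    show "((\<lambda>p. f p z0) has_derivative fx) (at p0 within A)"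
      using fx has_derivative_at_withinI by blast
    fix p z assume "p \<in> A" "z \<in> ball z0 r"
    then have "(f p has_field_derivative deriv (f p) z) (at z)"
      using hb holomorphic_derivI by blast
    then show "(f p has_derivative blinfun_apply (blinfun_mult_right (deriv (f p) z))) (at z within ball z0 r)"
      by (simp add: blinfun_mult_right.rep_eq has_field_derivative_def has_derivative_at_withinI)
  qed (use r in auto)
  moreover have "at (p0, z0) within A \<times> ball z0 r = at (p0, z0)"
    using AB r by (intro at_within_open open_Times) auto
  ultimately show ?thesis by (simp add: blinfun_mult_right.rep_eq)
qed

text \<open>The total derivative is built one variable at a time with
  \<open>has_derivative_param\<close>: the third variable is added to the second, then the first to
  this pair.\<close>

theorem osgood:
  assumes S: "open S" and cont: "continuous_on S f"
    and 1: "\<And>b c. (\<lambda>x. f (x, b, c)) holomorphic_on {x. (x, b, c) \<in> S}"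
    and 2: "\<And>a c. (\<lambda>x. f (a, x, c)) holomorphic_on {x. (a, x, c) \<in> S}"
    and 3: "\<And>a b. (\<lambda>x. f (a, b, x)) holomorphic_on {x. (a, b, x) \<in> S}"
  shows "hol f S"
proof (rule holI[OF S])
  fix z assume z: "z \<in> S"
  obtain a b c where abc: "z = (a, b, c)" by (metis prod.exhaust)
  define D2 where "D2 = {p. (a, p) \<in> S}"
  have D2: "D2 = (\<lambda>p. (a, p)) -` S" by (auto simp: D2_def)
  have "open D2" unfolding D2 by (intro open_vimage S continuous_intros)
  moreover have "continuous_on D2 (\<lambda>(x, y). f (a, x, y))"
    unfolding split_beta prod.collapse
    by (rule continuous_on_compose2[OF cont]) (auto simp: D2_def intro!: continuous_intros)
  moreover have "((\<lambda>x. f (a, x, c)) has_derivative (*) (deriv (\<lambda>x. f (a, x, c)) b)) (at b)"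
    using holomorphic_derivI[OF 2[of a c] open_slice(2)[OF S], of b] z abc by (simp add: has_field_derivative_def)
  ultimately have d2: "((\<lambda>(x, y). f (a, x, y)) has_derivative
      (\<lambda>(x, y). deriv (\<lambda>x. f (a, x, c)) b * x + deriv (\<lambda>y. f (a, b, y)) c * y)) (at (b, c))"
    using z abc 3 by (intro has_derivative_param[of D2]) (auto simp: D2_def)
  \<comment> \<open>The variable that is added has to come last, so the first coordinate is moved
    behind the pair; \<open>sw\<close> undoes this below.\<close>
  define D3 where "D3 = (\<lambda>(p, x). (x, p)) -` S"
  have "open D3" unfolding D3_def by (intro open_vimage S) (auto simp: split_beta intro!: continuous_intros)
  moreover have "continuous_on D3 (\<lambda>(p, x). f (x, p))"
    unfolding split_beta
    by (rule continuous_on_compose2[OF cont]) (auto simp: D3_def intro!: continuous_intros)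
  moreover have "((\<lambda>p. f (a, p)) has_derivative
      (\<lambda>(x, y). deriv (\<lambda>x. f (a, x, c)) b * x + deriv (\<lambda>y. f (a, b, y)) c * y)) (at (b, c))"
    using d2 by (simp only: split_beta' prod.collapse)
  ultimately have d3: "((\<lambda>(p, x). f (x, p)) has_derivative
      (\<lambda>(p, x). (\<lambda>(x, y). deriv (\<lambda>x. f (a, x, c)) b * x + deriv (\<lambda>y. f (a, b, y)) c * y) p +
         deriv (\<lambda>x. f (x, b, c)) a * x)) (at ((b, c), a))"
    using z abc 1 by (intro has_derivative_param[of D3]) (auto simp: D3_def)
  have sw: "((\<lambda>(x, p). (p, x)) has_derivative (\<lambda>(x, p). (p, x))) (at (a, b, c))"
    by (auto intro!: derivative_eq_intros simp: split_beta)
  have "((\<lambda>z. (\<lambda>(p, x). f (x, p)) ((\<lambda>(x, p). (p, x)) z)) has_derivative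
      (\<lambda>v. (\<lambda>(p, x). (\<lambda>(x, y). deriv (\<lambda>x. f (a, x, c)) b * x + deriv (\<lambda>y. f (a, b, y)) c * y) p +
         deriv (\<lambda>x. f (x, b, c)) a * x) ((\<lambda>(x, p). (p, x)) v))) (at (a, b, c))"
    by (rule has_derivative_compose[OF sw]) (use d3 in simp)
  then have "(f has_derivative (\<lambda>(x, y, w). deriv (\<lambda>x. f (a, x, c)) b * y + deriv (\<lambda>y. f (a, b, y)) c * w +
         deriv (\<lambda>x. f (x, b, c)) a * x)) (at z)"
    by (simp add: abc split_beta')
  then show "\<exists>f'. (f has_derivative f') (at z) \<and> (\<forall>w v. f' (cscale w v) = w * f' v)"
    by (intro exI conjI, assumption) (auto simp: cscale_def algebra_simps)
qed


lemma holomorphic_on_integral_param: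
  fixes f :: "complex \<Rightarrow> real \<Rightarrow> complex"
  assumes S: "open S" and cont: "continuous_on (S \<times> {0..1}) (\<lambda>(z, t). f z t)"
    and hol: "\<And>t. t \<in> {0..1} \<Longrightarrow> (\<lambda>z. f z t) holomorphic_on S"
  shows "(\<lambda>z. integral {0..1} (f z)) holomorphic_on S"
proof -
  have "\<exists>r>0. ball z r \<subseteq> S \<and> (\<lambda>z. integral {0..1} (f z)) holomorphic_on ball z r" if z: "z \<in> S" for z
  proof -
    obtain r where r: "r > 0" "cball z r \<subseteq> S" using S z open_contains_cball by blast
    have "(\<lambda>z. integral (cbox 0 1) (f z)) holomorphic_on ball z r"
    proof (rule leibniz_rule_holomorphic)
      fix w :: complex and t :: real assume w: "w \<in> ball z r" and t: "t \<in> cbox 0 1"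
      have "((\<lambda>z. f z t) has_field_derivative deriv (\<lambda>z. f z t) w) (at w)"
        using t w r by (intro holomorphic_derivI[OF hol S]) auto
      then show "((\<lambda>z. f z t) has_field_derivative deriv (\<lambda>z. f z t) w) (at w within ball z r)"
        by (rule has_field_derivative_at_within)
    next
      fix w assume w: "w \<in> ball z r"
      have "continuous_on {0..1} (\<lambda>t. (\<lambda>(z, t). f z t) (w, t))"
        using w r by (intro continuous_on_compose2[OF cont] continuous_intros) auto
      then show "f w integrable_on cbox 0 1"
        by (intro integrable_continuous) simp
    next
      show "continuous_on (ball z r \<times> cbox 0 1) (\<lambda>(w, t). deriv (\<lambda>z. f z t) w)"
        unfolding cbox_interval
      proof (rule continuous_on_deriv_param[OF r(1)])
        show "continuous_on (cball z r \<times> {0..1}) (\<lambda>(z, t). f z t)"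
          using r by (intro continuous_on_subset[OF cont]) auto
        show "(\<lambda>z. f z t) holomorphic_on ball z r" if "t \<in> {0..1}" for t
          using hol[OF that] r by (meson ball_subset_cball holomorphic_on_subset subset_trans)
      qed
    qed simp
    then show ?thesis using r ball_subset_cball by (intro exI[of _ r]) (auto simp: subset_iff)
  qed
  then have "(\<lambda>z. integral {0..1} (f z)) field_differentiable at z" if "z \<in> S" for z
    using that by (metis centre_in_ball holomorphic_on_imp_differentiable_at open_ball)
  then show ?thesis
    by (simp add: S holomorphic_on_open field_differentiable_def)
qed

lemma hol_integral:
  fixes f :: "complex3 \<Rightarrow> real \<Rightarrow> complex"
  assumes S: "open S" and cont: "continuous_on (S \<times> {0..1}) (\<lambda>(z, t). f z t)"
    and hol: "\<And>t. t \<in> {0..1} \<Longrightarrow> hol (\<lambda>z. f z t) S"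
  shows "hol (\<lambda>z. integral {0..1} (f z)) S"
proof (rule osgood[OF S])
  show "continuous_on S (\<lambda>z. integral {0..1} (f z))"
    using integral_continuous_on_param[of S 0 1 f] cont by simp
  have *: "continuous_on ({x. g x \<in> S} \<times> {0..1}) (\<lambda>(x, t). f (g x) t)"
    if "continuous_on UNIV g" for g :: "complex \<Rightarrow> complex3"
  proof -
    have "continuous_on ({x. g x \<in> S} \<times> {0..1}) (\<lambda>y. (\<lambda>(z, t). f z t) (g (fst y), snd y))"
      by (intro continuous_on_compose2[OF cont] continuous_intros continuous_on_compose2[OF that]) auto
    then show ?thesis by (simp add: split_beta)
  qed
  show "(\<lambda>x. integral {0..1} (f (x, b, c))) holomorphic_on {x. (x, b, c) \<in> S}" for b c
    by (intro holomorphic_on_integral_param open_slice S * hol_slices(1)[OF hol] continuous_intros)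
  show "(\<lambda>x. integral {0..1} (f (a, x, c))) holomorphic_on {x. (a, x, c) \<in> S}" for a c
    by (intro holomorphic_on_integral_param open_slice S * hol_slices(2)[OF hol] continuous_intros)
  show "(\<lambda>x. integral {0..1} (f (a, b, x))) holomorphic_on {x. (a, b, x) \<in> S}" for a b
    by (intro holomorphic_on_integral_param open_slice S * hol_slices(3)[OF hol] continuous_intros)
qed

text \<open>Cauchy's formula on a fixed small circle writes the partial derivative locally as an
  integral of functions that are holomorphic in all three variables.\<close>

lemma hol_deriv3:
  assumes f: "hol f S"
  shows "hol (\<lambda>(a, b, c). deriv (\<lambda>x. f (a, b, x)) c) S"
proof (rule hol_local[OF hol_open[OF f]])
  fix z assume z: "z \<in> S"
  obtain a0 b0 c0 where abc: "z = (a0, b0, c0)" by (metis prod.exhaust)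
  have S: "open S" using f hol_open by blast
  obtain A B where AB: "open A" "open B" "a0 \<in> A" "(b0, c0) \<in> B" "A \<times> B \<subseteq> S"
    using open_prod_elim[OF S z] abc by (metis mem_Sigma_iff)
  obtain B1 C where BC: "open B1" "open C" "b0 \<in> B1" "c0 \<in> C" "B1 \<times> C \<subseteq> B"
    using open_prod_elim[OF AB(2,4)] by (metis mem_Sigma_iff)
  obtain r where r: "r > 0" "cball c0 r \<subseteq> C" using BC open_contains_cball by blast
  define N where "N = A \<times> B1 \<times> ball c0 r"
  have sub: "A \<times> B1 \<times> cball c0 r \<subseteq> S" using AB BC r by blast
  have N: "open N" "z \<in> N" "N \<subseteq> S"
    using AB BC r sub by (auto simp: N_def abc intro!: open_Times)
  let ?c = "circlepath c0 r"
  define F where "F = (\<lambda>z t. f (fst z, fst (snd z), ?c t) * (?c t - c0) / (?c t - snd (snd z))\<^sup>2)"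
  have ne: "?c t - snd (snd z) \<noteq> 0" if "z \<in> N" for z t
    using circlepath_props(3)[OF r(1), of c0 t] that by (auto simp: N_def)
  have mem: "(fst z, fst (snd z), ?c t) \<in> S" if "z \<in> N" for z t
    using circlepath_props(2)[OF r(1), of c0 t] that sub by (auto simp: N_def)
  have "hol (\<lambda>z. integral {0..1} (F z)) N"
  proof (rule hol_integral[OF N(1)])
    show "continuous_on (N \<times> {0..1}) (\<lambda>(z, t). F z t)"
      unfolding F_def split_beta using ne mem
      by (intro continuous_intros continuous_on_compose2[OF circlepath_props(1)[OF r(1)]]
          continuous_on_compose2[OF hol_imp_continuous_on[OF f]]) auto
    show "hol (\<lambda>z. F z t) N" for t
      unfolding F_def using N(1) ne mem
      by (intro hol_divide hol_intros hol_compose3[OF f]) auto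
  qed
  moreover have "(\<lambda>(a, b, c). deriv (\<lambda>x. f (a, b, x)) c) y = integral {0..1} (F y)" if "y \<in> N" for y
  proof -
    obtain a b c where y: "y = (a, b, c)" by (metis prod.exhaust)
    have h: "(\<lambda>x. f (a, b, x)) holomorphic_on {x. (a, b, x) \<in> S}"
      using hol_slices(3)[OF f] .
    have sl: "cball c0 r \<subseteq> {x. (a, b, x) \<in> S}"
      using that sub by (auto simp: N_def y)
    have "deriv (\<lambda>x. f (a, b, x)) c = integral {0..1} (\<lambda>t. f (a, b, ?c t) * (?c t - c0) / (?c t - c)\<^sup>2)"
      using that holomorphic_on_subset[OF h sl] y r(1)
      by (intro deriv_eq_circle_integral)
        (auto simp: N_def intro: holomorphic_on_imp_continuous_on holomorphic_on_subset)
    then show ?thesis by (simp add: y F_def)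
  qed
  ultimately show "\<exists>N. z \<in> N \<and> hol (\<lambda>(a, b, c). deriv (\<lambda>x. f (a, b, x)) c) N"
    using N(2) hol_cong by blast
qed

lemma hol_uniform_limit:
  assumes f: "\<And>n. hol (f n) S" and lim: "uniform_limit S f g sequentially"
  shows "hol g S"
proof (rule osgood)
  show S: "open S" using f hol_open by blast
  show "continuous_on S g"
    using f hol_imp_continuous_on lim by (intro uniform_limit_theorem[OF _ lim]) auto
  have *: "(\<lambda>x. g (h x)) holomorphic_on {x. h x \<in> S}"
    if op: "open {x. h x \<in> S}" and "\<And>n. (\<lambda>x. f n (h x)) holomorphic_on {x. h x \<in> S}" for h
  proof (rule holomorphic_uniform_sequence[OF that])
    fix x assume x: "x \<in> {x. h x \<in> S}"
    obtain r where r: "r > 0" "cball x r \<subseteq> {x. h x \<in> S}"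
      using iffD1[OF open_contains_cball_eq[OF op, rule_format] x] by blast
    have "uniform_limit (cball x r) (\<lambda>n x. f n (h x)) (\<lambda>x. g (h x)) sequentially"
      using r(2) by (intro uniform_limit_compose'[OF lim]) auto
    then show "\<exists>d>0. cball x d \<subseteq> {x. h x \<in> S} \<and>
        uniform_limit (cball x d) (\<lambda>n x. f n (h x)) (\<lambda>x. g (h x)) sequentially"
      using r by blast
  qed
  show "(\<lambda>x. g (x, b, c)) holomorphic_on {x. (x, b, c) \<in> S}" for b c
    by (intro * open_slice S hol_slices(1)[OF f])
  show "(\<lambda>x. g (a, x, c)) holomorphic_on {x. (a, x, c) \<in> S}" for a c
    by (intro * open_slice S hol_slices(2)[OF f])
  show "(\<lambda>x. g (a, b, x)) holomorphic_on {x. (a, b, x) \<in> S}" for a b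
    by (intro * open_slice S hol_slices(3)[OF f])
qed

lemma hol_suminf:
  assumes S: "open S" and f: "\<And>n. hol (f n) S"
    and bound: "\<And>n z. z \<in> S \<Longrightarrow> norm (f n z) \<le> M n" and M: "summable M"
  shows "hol (\<lambda>z. \<Sum>n. f n z) S"
proof (rule hol_uniform_limit)
  show "hol (\<lambda>z. \<Sum>i<n. f i z) S" for n
    by (intro hol_sum S f)
  show "uniform_limit S (\<lambda>n z. \<Sum>i<n. f i z) (\<lambda>z. \<Sum>n. f n z) sequentially"
    using bound M by (intro Weierstrass_m_test) auto
qed

subsection \<open>Biholomorphic maps\<close>

lemma biholomorphic3I:
  assumes f: "holomorphic3 f S" and g: "holomorphic3 g T" and fS: "\<And>z. z \<in> S \<Longrightarrow> f z \<in> T \<and> g (f z) = z"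
    and gT: "\<And>z. z \<in> T \<Longrightarrow> g z \<in> S \<and> f (g z) = z"
  shows "biholomorphic3 f S T"
proof -
  have bij: "bij_betw f S T"
    by (rule bij_betw_byWitness[where f' = g]) (use fS gT in auto)
  moreover have "the_inv_into S f z = g z" if "z \<in> T" for z
    using bij gT[OF that] by (intro the_inv_into_f_eq) (auto simp: bij_betw_def)
  ultimately show ?thesis
    using f holomorphic3_cong[OF g] by (auto simp: biholomorphic3_def)
qed

lemma biholomorphic3E:
  assumes "biholomorphic3 f S T"
  obtains g where "holomorphic3 f S" "holomorphic3 g T" "\<And>z. z \<in> S \<Longrightarrow> f z \<in> T \<and> g (f z) = z"
    "\<And>z. z \<in> T \<Longrightarrow> g z \<in> S \<and> f (g z) = z"
proof -
  have b: "bij_betw f S T" using assms by (simp add: biholomorphic3_def)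
  then have i: "inj_on f S" "f ` S = T" by (auto simp: bij_betw_def)
  show thesis
  proof
    show "holomorphic3 f S" "holomorphic3 (the_inv_into S f) T"
      using assms by (auto simp: biholomorphic3_def)
    show "f z \<in> T \<and> the_inv_into S f (f z) = z" if "z \<in> S" for z
      using that i by (auto simp: the_inv_into_f_f)
    show "the_inv_into S f z \<in> S \<and> f (the_inv_into S f z) = z" if "z \<in> T" for z
      using that i by (auto simp: f_the_inv_into_f the_inv_into_into)
  qed
qed

lemma biholomorphic3_compose:
  assumes "biholomorphic3 f S T" "biholomorphic3 g T U"
  shows "biholomorphic3 (\<lambda>z. g (f z)) S U"
proof -
  obtain f' where f: "holomorphic3 f S" "holomorphic3 f' T" "\<And>z. z \<in> S \<Longrightarrow> f z \<in> T \<and> f' (f z) = z"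
    "\<And>z. z \<in> T \<Longrightarrow> f' z \<in> S \<and> f (f' z) = z" using biholomorphic3E[OF assms(1)] by metis
  obtain g' where g: "holomorphic3 g T" "holomorphic3 g' U" "\<And>z. z \<in> T \<Longrightarrow> g z \<in> U \<and> g' (g z) = z"
    "\<And>z. z \<in> U \<Longrightarrow> g' z \<in> T \<and> g (g' z) = z" using biholomorphic3E[OF assms(2)] by metis
  show ?thesis
  proof (rule biholomorphic3I)
    show "holomorphic3 (\<lambda>z. g (f z)) S"
      by (rule holomorphic3_compose[OF f(1) g(1)]) (use f(3) in blast)
    show "holomorphic3 (\<lambda>z. f' (g' z)) U"
      by (rule holomorphic3_compose[OF g(2) f(2)]) (use g(4) in blast)
  qed (use f g in auto)
qed

lemma biholomorphic3_subset:
  assumes "biholomorphic3 f S T" "open S'" "S' \<subseteq> S"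
  shows "biholomorphic3 f S' (f ` S')"
proof -
  obtain f' where f: "holomorphic3 f S" "holomorphic3 f' T" "\<And>z. z \<in> S \<Longrightarrow> f z \<in> T \<and> f' (f z) = z"
    "\<And>z. z \<in> T \<Longrightarrow> f' z \<in> S \<and> f (f' z) = z" using biholomorphic3E[OF assms(1)] by metis
  have "f ` S' = T \<inter> f' -` S'"
    using assms(3) f(3,4) by force
  moreover have "open (T \<inter> f' -` S')"
    using f(2) assms(2) holomorphic3_imp_continuous_on[OF f(2)]
    by (simp add: continuous_open_preimage holomorphic3_def)
  ultimately have "open (f ` S')" by simp
  moreover have "f ` S' \<subseteq> T" using assms(3) f(3) by blast
  ultimately show ?thesis
    by (intro biholomorphic3I[where g = f'] holomorphic3_subset[OF f(1) assms(2,3)] holomorphic3_subset[OF f(2)])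
      (use assms(3) f(3) in auto)
qed

text \<open>Injectivity makes the image open by invariance of domain, and the derivative is then
  inverted pointwise. A linear right inverse is two-sided in finite dimension, and the inverse of a
  complex-linear bijection is complex-linear.\<close>

lemma biholomorphic3_inverse_function:
  assumes f: "holomorphic3 f S" and inj: "inj_on f S"
    and inv: "\<And>z f'. z \<in> S \<Longrightarrow> (f has_derivative f') (at z) \<Longrightarrow>
      (\<And>w v. f' (cscale w v) = cscale w (f' v)) \<Longrightarrow> \<exists>g'. f' \<circ> g' = id"
  shows "biholomorphic3 f S (f ` S)"
proof -
  have S: "open S" using f by (simp add: holomorphic3_def)
  have cont: "continuous_on S f" using f holomorphic3_imp_continuous_on by blast
  have open_im: "open (f ` S)"
    using invariance_of_domain[OF cont S inj] .
  have "holomorphic3 (the_inv_into S f) (f ` S)"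
    unfolding holomorphic3_def
  proof (intro conjI ballI open_im)
    fix y assume "y \<in> f ` S"
    then obtain z where z: "z \<in> S" "y = f z" by blast
    obtain f' where f': "(f has_derivative f') (at z)" "\<And>w v. f' (cscale w v) = cscale w (f' v)"
      using f z(1) unfolding holomorphic3_def by blast
    obtain g' where g': "f' \<circ> g' = id" using inv[OF z(1) f'] by blast
    have d: "(the_inv_into S f has_derivative g') (at y)"
      unfolding z(2)
      by (rule has_derivative_inverse_strong[OF S z(1) cont _ f'(1) g']) (use inj in \<open>simp add: the_inv_into_f_f\<close>)
    have "linear f'" using f'(1) has_derivative_linear by blast
    moreover have "surj f'" using g' by (metis comp_eq_dest_lhs id_apply surjI)
    ultimately have "inj f'" using linear_surjective_imp_injective by blast
    moreover have fg: "f' (g' v) = v" for v using g' by (metis comp_apply id_apply)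
    ultimately have "g' (cscale w v) = cscale w (g' v)" for w v
      by (metis f'(2) injD)
    with d show "\<exists>g'. (the_inv_into S f has_derivative g') (at y) \<and> (\<forall>w v. g' (cscale w v) = cscale w (g' v))"
      by blast
  qed
  then show ?thesis
    using f inj by (simp add: biholomorphic3_def bij_betw_def)
qed

text \<open>A map that changes one coordinate only has a triangular derivative, so a nonzero partial
  derivative in that coordinate makes it invertible, and injectivity can be tested slice by
  slice.\<close>

lemma biholomorphic3_shear3:
  assumes f: "hol f S" and inj: "\<And>a b. inj_on (\<lambda>x. f (a, b, x)) {x. (a, b, x) \<in> S}"
    and ne: "\<And>a b c. (a, b, c) \<in> S \<Longrightarrow> deriv (\<lambda>x. f (a, b, x)) c \<noteq> 0"
  shows "biholomorphic3 (\<lambda>(a, b, c). (a, b, f (a, b, c))) S ((\<lambda>(a, b, c). (a, b, f (a, b, c))) ` S)"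
proof (rule biholomorphic3_inverse_function)
  let ?F = "\<lambda>(a, b, c). (a, b, f (a, b, c))"
  have S: "open S" using f hol_open by blast
  have "holomorphic3 (\<lambda>z. (fst z, fst (snd z), f z)) S"
    using f S by (intro holomorphic3_components hol_coords)
  then show "holomorphic3 ?F S" by (simp add: split_beta')
  show "inj_on ?F S"
    using inj by (auto simp: inj_on_def)
  fix z F' assume z: "z \<in> S" and d: "(?F has_derivative F') (at z)"
  obtain a b c where abc: "z = (a, b, c)" by (metis prod.exhaust)
  obtain f' where f': "(f has_derivative f') (at z)" "\<And>w v. f' (cscale w v) = w * f' v"
    using holE[OF f z] by metis
  have "((\<lambda>z. (fst z, fst (snd z), f z)) has_derivative (\<lambda>v. (fst v, fst (snd v), f' v))) (at z)"
    by (intro has_derivative_Pair f') (auto intro!: derivative_eq_intros)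
  then have "(?F has_derivative (\<lambda>v. (fst v, fst (snd v), f' v))) (at z)"
    by (simp add: split_beta')
  then have F': "F' = (\<lambda>v. (fst v, fst (snd v), f' v))"
    using d has_derivative_unique by blast
  have lin: "linear f'" using f'(1) has_derivative_linear by blast
  have cpx: "f' (0, 0, w) = w * f' (0, 0, 1)" for w
    using f'(2)[of w "(0, 0, 1)"] by (simp add: cscale_def)
  have "((\<lambda>x. (a, b, x)) has_derivative (\<lambda>h. (0, 0, h))) (at c)"
    by (intro has_derivative_Pair derivative_intros)
  then have "((\<lambda>x. f (a, b, x)) has_derivative (\<lambda>h. f' (0, 0, h))) (at c)"
    using has_derivative_compose[of "\<lambda>x. (a, b, x)" _ c UNIV f f'] f'(1) abc by simp
  then have "((\<lambda>x. f (a, b, x)) has_field_derivative f' (0, 0, 1)) (at c)"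
    by (subst (asm) cpx) (simp add: has_field_derivative_def mult.commute[of _ "f' (0, 0, 1)"])
  then have A: "f' (0, 0, 1) \<noteq> 0"
    using ne[of a b c] z abc by (metis DERIV_imp_deriv)
  have split: "f' (u, v, w) = f' (u, v, 0) + w * f' (0, 0, 1)" for u v w
    using linear_add[OF lin, of "(u, v, 0)" "(0, 0, w)"] cpx[of w] by simp
  show "\<exists>g'. F' \<circ> g' = id"
    using A by (intro exI[of _ "\<lambda>(u, v, w). (u, v, (w - f' (u, v, 0)) / f' (0, 0, 1))"])
      (auto simp: F' fun_eq_iff split[of _ _ "_ / _"])
qed

lemma biholomorphic3_swap: "biholomorphic3 (\<lambda>(a, b, c). (a, c, b)) S ((\<lambda>(a, b, c). (a, c, b)) ` S)" if "open S"
proof -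
  let ?s = "(\<lambda>(a, b, c). (a, c, b)) :: complex3 \<Rightarrow> complex3"
  have h: "holomorphic3 ?s T" if "open T" for T
    using holomorphic3_components[OF hol_coords(1,3,2)[OF that]] by (simp add: split_beta')
  have "biholomorphic3 ?s UNIV UNIV"
    by (rule biholomorphic3I[where g = ?s]) (auto intro: h)
  from biholomorphic3_subset[OF this that] show ?thesis by simp
qed

text \<open>Conjugates \<open>biholomorphic3_shear3\<close> by the exchange of the last two
  coordinates.\<close>

lemma biholomorphic3_shear2:
  assumes f: "hol f S" and inj: "\<And>a c. inj_on (\<lambda>x. f (a, x, c)) {x. (a, x, c) \<in> S}"
    and ne: "\<And>a b c. (a, b, c) \<in> S \<Longrightarrow> deriv (\<lambda>x. f (a, x, c)) b \<noteq> 0"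
  shows "biholomorphic3 (\<lambda>(a, b, c). (a, f (a, b, c), c)) S ((\<lambda>(a, b, c). (a, f (a, b, c), c)) ` S)"
proof -
  let ?s = "(\<lambda>(a, b, c). (a, c, b)) :: complex3 \<Rightarrow> complex3"
  let ?g = "\<lambda>(a, c, b). f (a, b, c)" and ?T = "?s ` S"
  have S: "open S" using f hol_open by blast
  have mem: "(a, c, b) \<in> ?T \<longleftrightarrow> (a, b, c) \<in> S" for a b c by force
  have T: "open ?T"
    using biholomorphic3_swap[OF S] unfolding biholomorphic3_def holomorphic3_def by blast
  have "hol (\<lambda>z. f (fst z, snd (snd z), fst (snd z))) ?T"
    by (intro hol_compose3[OF f] hol_coords T) auto
  then have g: "hol ?g ?T" by (simp add: split_beta')
  let ?F = "\<lambda>(a, b, c). (a, b, ?g (a, b, c))"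
  have "biholomorphic3 ?F ?T (?F ` ?T)"
  proof (rule biholomorphic3_shear3[OF g])
    show "inj_on (\<lambda>x. ?g (a, b, x)) {x. (a, b, x) \<in> ?T}" for a b
      using inj[of a b] by (simp only: mem split)
    show "deriv (\<lambda>x. ?g (a, b, x)) c \<noteq> 0" if "(a, b, c) \<in> ?T" for a b c
      using ne[of a c b] that by (simp only: mem split) simp
  qed
  note c1 = biholomorphic3_compose[OF biholomorphic3_swap[OF S] this]
  then have "open (?F ` ?T)" unfolding biholomorphic3_def holomorphic3_def by blast
  note c2 = biholomorphic3_compose[OF c1 biholomorphic3_swap[OF this]]
  moreover have "(\<lambda>z. ?s (?F (?s z))) = (\<lambda>(a, b, c). (a, f (a, b, c), c))"
    by (auto simp: fun_eq_iff)
  moreover have "?s ` ?F ` ?s ` S = (\<lambda>z. ?s (?F (?s z))) ` S"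
    by (simp only: image_image)
  ultimately show ?thesis by (simp only:)
qed

section \<open>One-variable estimates\<close>

text \<open>f - id is 1/4-Lipschitz on the ball. Hence \<open>f\<close> is injective there, and z
  \<mapsto> w - (f z - z) contracts the closed ball of radius 4/3 |w| into itself, since |w| plus a
  quarter of 4/3 |w| is again 4/3 |w|.\<close>

lemma near_linear:
  fixes f :: "complex \<Rightarrow> complex"
  assumes f: "f holomorphic_on ball 0 R" and f0: "f 0 = 0"
    and f': "\<And>z. z \<in> ball 0 R \<Longrightarrow> norm (deriv f z - 1) \<le> 1/4"
  shows "inj_on f (ball 0 R)"
    and "norm w < 3/4 * R \<Longrightarrow> \<exists>z. norm z \<le> 4/3 * norm w \<and> f z = w"
proof -
  have lip: "norm ((f x - x) - (f y - y)) \<le> 1/4 * norm (x - y)" if "x \<in> ball 0 R" "y \<in> ball 0 R" for x y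
  proof (rule field_differentiable_bound[of "ball 0 R" "\<lambda>z. f z - z"])
    fix z :: complex assume z: "z \<in> ball 0 R"
    then have "(f has_field_derivative deriv f z) (at z within ball 0 R)"
      using holomorphic_derivI[OF f] by blast
    then show "((\<lambda>z. f z - z) has_field_derivative (deriv f z - 1)) (at z within ball 0 R)"
      by (auto intro!: derivative_eq_intros)
    show "norm (deriv f z - 1) \<le> 1/4" using f' z .
  qed (use that in auto)
  show "inj_on f (ball 0 R)"
  proof (rule inj_onI)
    fix x y assume "x \<in> ball 0 R" "y \<in> ball 0 R" "f x = f y"
    then have "norm (x - y) \<le> 1/4 * norm (x - y)"
      using lip[of x y] by (simp add: norm_minus_commute)
    then show "x = y" using norm_ge_zero[of "x - y"] by simp
  qed
  show "\<exists>z. norm z \<le> 4/3 * norm w \<and> f z = w" if w: "norm w < 3/4 * R"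
  proof -
    let ?C = "cball 0 (4/3 * norm w) :: complex set"
    have C: "?C \<subseteq> ball 0 R" using w by auto
    have "\<exists>!z\<in>?C. w - (f z - z) = z"
    proof (rule Banach_fix[where c = "1/4"])
      show "(\<lambda>z. w - (f z - z)) ` ?C \<subseteq> ?C"
      proof clarify
        fix z :: complex assume z: "z \<in> ?C"
        have "norm (f z - z) \<le> 1/4 * norm z"
        proof -
        have "z \<in> ball 0 R" using z C by blast
        moreover have "0 < R" using w norm_ge_zero[of w] by linarith
        then have "0 \<in> ball (0::complex) R" by simp
        ultimately have "z \<in> ball 0 R" "0 \<in> ball (0::complex) R" by blast+
        from lip[OF this] show ?thesis using f0 by simp
      qed
        then have "norm (w - (f z - z)) \<le> norm w + 1/4 * norm z"
          using norm_triangle_ineq4[of w "f z - z"] by linarith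
        then show "w - (f z - z) \<in> ?C" using z by auto
      qed
      fix x y assume "x \<in> ?C" "y \<in> ?C"
      then have *: "norm ((f x - x) - (f y - y)) \<le> 1/4 * norm (x - y)"
        using C by (intro lip) auto
      show "dist (w - (f x - x)) (w - (f y - y)) \<le> 1/4 * dist x y"
      proof -
        have "(w - (f x - x)) - (w - (f y - y)) = - ((f x - x) - (f y - y))" by simp
        then have "norm ((w - (f x - x)) - (w - (f y - y))) = norm ((f x - x) - (f y - y))"
          by (simp only: norm_minus_cancel)
        then show ?thesis using * by (simp only: dist_norm)
      qed
    qed (auto simp: complete_eq_closed)
    then obtain z where "z \<in> ?C" "w - (f z - z) = z" by blast
    then show ?thesis by (intro exI[of _ z]) (auto simp: algebra_simps)
  qed
qed

text \<open>An explicit primitive along the ray from 0, with the factor z split off; it depends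
  holomorphically on parameters by \<open>hol_integral\<close>. Both \<open>sig\<close> and
  \<open>divided_difference\<close> are built on this integral.\<close>

lemma radial_primitive:
  assumes f: "f holomorphic_on ball 0 R" and z: "z \<in> ball 0 R"
    and F: "\<And>z. z \<in> ball 0 R \<Longrightarrow> (F has_field_derivative f z) (at z)"
  shows "z * integral {0..1} (\<lambda>u. f (of_real u * z)) = F z - F 0"
proof -
  have mem: "of_real u * z \<in> ball 0 R" if "u \<in> {0..1}" for u
    using that z mult_left_le_one_le[of "norm z" u] by (auto simp: norm_mult)
  have "((\<lambda>u. z * f (of_real u * z)) has_integral (F (of_real 1 * z) - F (of_real 0 * z))) {0..1}"
  proof (rule fundamental_theorem_of_calculus)
    fix u :: real assume u: "u \<in> {0..1}"
    have "((\<lambda>u. of_real u * z) has_vector_derivative z) (at u)"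
      unfolding has_vector_derivative_def
      by (auto intro!: derivative_eq_intros simp: scaleR_conv_of_real)
    then have "((\<lambda>u. F (of_real u * z)) has_vector_derivative (z * f (of_real u * z))) (at u)"
      using field_vector_diff_chain_at[of "\<lambda>u. of_real u * z" z u F "f (of_real u * z)"] F[OF mem[OF u]]
      by (simp add: o_def)
    then show "((\<lambda>u. F (of_real u * z)) has_vector_derivative (z * f (of_real u * z))) (at u within {0..1})"
      by (rule has_vector_derivative_at_within)
  qed simp
  from integral_unique[OF this] show ?thesis by simp
qed

lemma radial_primitive_deriv:
  assumes f: "f holomorphic_on ball 0 R" and z: "z \<in> ball 0 R"
  shows "((\<lambda>z. z * integral {0..1} (\<lambda>u. f (of_real u * z))) has_field_derivative f z) (at z)"
proof -
  obtain F where F: "\<And>z. z \<in> ball 0 R \<Longrightarrow> (F has_field_derivative f z) (at z within ball 0 R)"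
    using holomorphic_convex_primitive'[OF convex_ball open_ball f] by blast
  then have F: "(F has_field_derivative f z) (at z)" if "z \<in> ball 0 R" for z
    using that at_within_open[OF that] by (metis open_ball)
  have "((\<lambda>z. F z - F 0) has_field_derivative f z) (at z)"
    using F[OF z] by (auto intro!: derivative_eq_intros)
  then show ?thesis
    by (rule has_field_derivative_transform_within_open[OF _ open_ball z])
      (use radial_primitive[OF f _ F] in auto)
qed

lemma Cauchy_deriv_bound:
  assumes f: "f holomorphic_on S" "open S" "cball z R \<subseteq> S" "R > 0"
    and B: "\<And>x. x \<in> S \<Longrightarrow> norm (f x) \<le> B"
  shows "norm (deriv f z) \<le> B / R"
proof -
  have "norm ((deriv ^^ 1) f z) \<le> fact 1 * B / R ^ 1"
  proof (rule Cauchy_inequality)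
    show "f holomorphic_on ball z R"
      using f by (meson ball_subset_cball holomorphic_on_subset order_trans)
    show "continuous_on (cball z R) f"
      using f by (meson holomorphic_on_imp_continuous_on holomorphic_on_subset)
    show "norm (f x) \<le> B" if "norm (z - x) = R" for x
      using that f(3) by (intro B) (auto simp: dist_norm subset_iff)
  qed (use f in auto)
  then show ?thesis by simp
qed

lemma poly_norm_bound:
  fixes p :: "complex poly"
  assumes "degree p \<le> n"
  obtains A where "A \<ge> 0" "\<And>x. norm (poly p x) \<le> A * (1 + norm x) ^ n"
proof
  let ?A = "\<Sum>i\<le>degree p. norm (coeff p i)"
  show "?A \<ge> 0" by (intro sum_nonneg) auto
  show "norm (poly p x) \<le> ?A * (1 + norm x) ^ n" for x
    unfolding poly_altdef sum_distrib_right
  proof (intro sum_norm_le)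
    fix i assume "i \<in> {..degree p}"
    then have "norm x ^ i \<le> (1 + norm x) ^ i" "(1 + norm x) ^ i \<le> (1 + norm x) ^ n"
      using assms by (auto intro!: power_mono power_increasing)
    then show "norm (coeff p i * x ^ i) \<le> norm (coeff p i) * (1 + norm x) ^ n"
      by (auto simp: norm_mult norm_power intro!: mult_left_mono)
  qed
qed

lemma hol_chain:
  assumes f: "hol f S" and mem: "(a x, b x, c x) \<in> S"
    and d: "(a has_field_derivative a') (at x)" "(b has_field_derivative b') (at x)" "(c has_field_derivative c') (at x)"
  shows "((\<lambda>x. f (a x, b x, c x)) has_field_derivative
    (deriv (\<lambda>y. f (y, b x, c x)) (a x) * a' + deriv (\<lambda>y. f (a x, y, c x)) (b x) * b'
      + deriv (\<lambda>y. f (a x, b x, y)) (c x) * c')) (at x)"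
proof -
  obtain f' where f': "(f has_derivative f') (at (a x, b x, c x))" "\<And>w v. f' (cscale w v) = w * f' v"
    using holE[OF f mem] by metis
  have gen: "((\<lambda>x. f (p x, q x, s x)) has_field_derivative f' (p', q', s')) (at y)"
    if fz: "(f has_derivative f') (at (p y, q y, s y))" and d: "(p has_field_derivative p') (at y)"
      "(q has_field_derivative q') (at y)" "(s has_field_derivative s') (at y)"
    for p q s :: "complex \<Rightarrow> complex" and p' q' s' y
  proof -
    have "((\<lambda>x. (p x, q x, s x)) has_derivative (\<lambda>h. (p' * h, q' * h, s' * h))) (at y)"
      using d by (intro has_derivative_Pair) (auto simp: has_field_derivative_def)
    from has_derivative_compose[OF this, of f f'] fz
    have "((\<lambda>x. f (p x, q x, s x)) has_derivative (\<lambda>h. f' (p' * h, q' * h, s' * h))) (at y)" by simp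
    moreover have "f' (p' * h, q' * h, s' * h) = f' (p', q', s') * h" for h
      using f'(2)[of h "(p', q', s')"] by (simp add: cscale_def mult.commute)
    ultimately show ?thesis by (simp add: has_field_derivative_def)
  qed
  have lin: "linear f'" using f'(1) has_derivative_linear by blast
  have p1: "deriv (\<lambda>y. f (y, b x, c x)) (a x) = f' (1, 0, 0)"
    using gen[of "\<lambda>y. y" "a x" "\<lambda>_. b x" "\<lambda>_. c x"] f'(1) by (intro DERIV_imp_deriv) auto
  have p2: "deriv (\<lambda>y. f (a x, y, c x)) (b x) = f' (0, 1, 0)"
    using gen[of "\<lambda>_. a x" "b x" "\<lambda>y. y" "\<lambda>_. c x"] f'(1) by (intro DERIV_imp_deriv) auto
  have p3: "deriv (\<lambda>y. f (a x, b x, y)) (c x) = f' (0, 0, 1)"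
    using gen[of "\<lambda>_. a x" "c x" "\<lambda>_. b x" "\<lambda>y. y"] f'(1) by (intro DERIV_imp_deriv) auto
  have "f' (a', b', c') = f' (cscale a' (1, 0, 0) + cscale b' (0, 1, 0) + cscale c' (0, 0, 1))"
    by (simp add: cscale_def)
  also have "\<dots> = a' * f' (1, 0, 0) + b' * f' (0, 1, 0) + c' * f' (0, 0, 1)"
    by (simp only: linear_add[OF lin] f'(2))
  finally show ?thesis
    using gen[OF f'(1) d] p1 p2 p3 by (simp add: mult.commute)
qed


section \<open>The Henon map near infinity\<close>

text \<open>Under k = x/y and v = 1/(\<alpha>y), the conditions |x| < |y|, |y| > R and |y| >
  |\<lambda>|^m become |k| < 1, |v| < 1/(|\<alpha>| R) and |v| |\<lambda>|^m < 1/|\<alpha>|. The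
  points v = 0 at infinity are included, so that functions can be expanded there.\<close>

definition region :: "nat \<Rightarrow> real \<Rightarrow> real \<Rightarrow> complex3 set" where
  "region m K r = {(l, k, v). norm k < K \<and> norm v < r \<and> norm v * norm l ^ m < K}"

text \<open>This is the quotient of \<open>p\<^sub>\<lambda>(y) - \<delta>x\<close> by its leading term \<open>c\<^sub>d y\<^sup>d\<close> in terms of \<open>k = x/y\<close> and
  \<open>v = 1/(\<alpha>y)\<close>, where \<open>b\<^sub>j = \<alpha>\<^sup>d\<^sup>-\<^sup>j c\<^sub>j / c\<^sub>d\<close>.\<close>

definition henon_u :: "nat \<Rightarrow> complex \<Rightarrow> (nat \<Rightarrow> complex poly) \<Rightarrow> complex3 \<Rightarrow> complex" where
  "henon_u d \<delta> b = (\<lambda>(l, k, v). 1 + (\<Sum>j<d. poly (b j) l * v ^ (d - j)) - \<delta> * k * v ^ (d - 1))"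

lemma mem_region: "(l, k, v) \<in> region m K r \<longleftrightarrow> norm k < K \<and> norm v < r \<and> norm v * norm l ^ m < K"
  by (simp add: region_def)

lemma open_region: "open (region m K r)"
proof -
  have "region m K r = {z. norm (fst (snd z)) < K} \<inter> {z. norm (snd (snd z)) < r} \<inter>
      {z. norm (snd (snd z)) * norm (fst z) ^ m < K}"
    by (auto simp: region_def)
  then show ?thesis
    by (auto intro!: open_Int open_Collect_less continuous_intros)
qed

lemma region_mono: "K \<le> K' \<Longrightarrow> r \<le> r' \<Longrightarrow> region m K r \<subseteq> region m K' r'"
  by (auto simp: region_def)

lemma region_shrink:
  assumes "(l, k, v) \<in> region m K r" "norm k' < K" "norm v' \<le> norm v"
  shows "(l, k', v') \<in> region m K r"
proof -
  have "norm v' * norm l ^ m \<le> norm v * norm l ^ m"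
    using assms by (intro mult_right_mono) auto
  then show ?thesis using assms by (auto simp: mem_region)
qed

text \<open>All degrees are below \<open>m\<close>, so each term of the sum is at most a multiple of
  |v| (1 + |l|)^(m-1). For |l| \<le> L this is small because |v| < r; for larger |l| it is at most a
  constant times |v| |l|^m / |l|, which is below a constant times K / L whatever l is.\<close>

lemma henon_u_near_1:
  fixes b :: "nat \<Rightarrow> complex poly"
  assumes d: "d \<ge> 2" and deg: "\<And>j. j < d \<Longrightarrow> degree (b j) < m" and K: "K > 0" and e: "e > 0"
  shows "\<exists>r0>0. \<forall>r\<le>r0. \<forall>z\<in>region m K r. norm (henon_u d \<delta> b z - 1) \<le> e"
proof -
  have "\<forall>j. \<exists>A\<ge>0. j < d \<longrightarrow> (\<forall>x. norm (poly (b j) x) \<le> A * (1 + norm x) ^ (m - 1))"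
  proof
    fix j
    show "\<exists>A\<ge>0. j < d \<longrightarrow> (\<forall>x. norm (poly (b j) x) \<le> A * (1 + norm x) ^ (m - 1))"
    proof (cases "j < d")
      case True
      then have "degree (b j) \<le> m - 1" using deg[of j] by simp
      then show ?thesis using poly_norm_bound by metis
    qed auto
  qed
  then obtain A where A: "\<And>j. A j \<ge> 0"
    "\<And>j x. j < d \<Longrightarrow> norm (poly (b j) x) \<le> A j * (1 + norm x) ^ (m - 1)" by metis
  define S where "S = (\<Sum>j<d. A j) + 1"
  have S: "S > 0" using A sum_nonneg[of "{..<d}" A] by (simp add: S_def add_nonneg_pos)
  have m: "m \<ge> 1" using deg[of 0] d by simp
  \<comment> \<open>Beyond \<open>L\<close> the inequality 1 + |l| \<le> 2 |l| costs the factor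
    2^(m-1); \<open>L\<close> is chosen to leave e / (2 S), so the sum takes half of
    \<open>e\<close>. The other half is for the term with \<delta>.\<close>
  define L where "L = max 1 (2 ^ (m - 1) * K * (2 * S) / e)"
  have L: "L \<ge> 1" "2 ^ (m - 1) * K / L \<le> e / (2 * S)"
  proof -
    have "2 ^ (m - 1) * K * (2 * S) / e \<le> L" by (simp add: L_def)
    then have "2 ^ (m - 1) * K * (2 * S) \<le> L * e" using e by (simp add: divide_le_eq)
    moreover show "L \<ge> 1" by (simp add: L_def)
    ultimately show "2 ^ (m - 1) * K / L \<le> e / (2 * S)"
      using S by (simp add: divide_le_eq le_divide_eq field_simps)
  qed
  define r0 where "r0 = min 1 (min (e / (2 * S) / (1 + L) ^ (m - 1)) (e / (2 * (norm \<delta> * K + 1))))"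
  have pos: "norm \<delta> * K + 1 > 0" using K by (simp add: add_nonneg_pos)
  have r0: "r0 > 0" using e S L pos by (simp add: r0_def)
  moreover have "norm (henon_u d \<delta> b z - 1) \<le> e" if r: "r \<le> r0" and z: "z \<in> region m K r" for r z
  proof -
    obtain l k v where lkv: "z = (l, k, v)" by (metis prod.exhaust)
    have z': "norm k < K" "norm v < r" "norm v * norm l ^ m < K"
      using z by (auto simp: lkv mem_region)
    have v1: "norm v \<le> 1" using z' r by (simp add: r0_def)
    have key: "norm v * (1 + norm l) ^ (m - 1) \<le> e / (2 * S)"
    proof (cases "norm l \<le> L")
      case True
      have "norm v * (1 + norm l) ^ (m - 1) \<le> (e / (2 * S) / (1 + L) ^ (m - 1)) * (1 + L) ^ (m - 1)"
        using True z' r e S L by (intro mult_mono power_mono) (auto simp: r0_def)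
      then show ?thesis using L by simp
    next
      case False
      then have l: "norm l > L" by simp
      have "(1 + norm l) ^ (m - 1) \<le> (2 * norm l) ^ (m - 1)"
        using l L by (intro power_mono) auto
      then have "norm v * (1 + norm l) ^ (m - 1) \<le> norm v * (2 * norm l) ^ (m - 1)"
        by (intro mult_left_mono) auto
      also have "\<dots> = 2 ^ (m - 1) * (norm v * norm l ^ (m - 1))"
        by (simp add: power_mult_distrib)
      also have "norm v * norm l ^ (m - 1) = (norm v * norm l ^ m) / norm l"
      proof -
        have "norm l ^ m = norm l ^ (m - 1) * norm l"
          using m by (metis Suc_diff_1 less_le_trans power_Suc2 zero_less_one)
        moreover have "norm l > 0" using l L by linarith
        ultimately show ?thesis by (simp only: nonzero_mult_div_cancel_right mult.assoc[symmetric])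
      qed
      also have "2 ^ (m - 1) * \<dots> \<le> 2 ^ (m - 1) * (K / L)"
        using z' l L K by (intro mult_left_mono frac_le) auto
      finally show ?thesis using L(2) by simp
    qed
    have vpow: "norm (v ^ n) \<le> norm v" if "n \<ge> 1" for n
      using power_decreasing[OF that norm_ge_zero v1] by (simp add: norm_power)
    have "norm (\<Sum>j<d. poly (b j) l * v ^ (d - j)) \<le> (\<Sum>j<d. A j * (norm v * (1 + norm l) ^ (m - 1)))"
    proof (rule sum_norm_le)
      fix j assume j: "j \<in> {..<d}"
      have "norm (poly (b j) l * v ^ (d - j)) \<le> (A j * (1 + norm l) ^ (m - 1)) * norm v"
        unfolding norm_mult using j A vpow[of "d - j"] by (intro mult_mono) auto
      then show "norm (poly (b j) l * v ^ (d - j)) \<le> A j * (norm v * (1 + norm l) ^ (m - 1))"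
        by (simp add: mult_ac)
    qed
    also have "\<dots> = (\<Sum>j<d. A j) * (norm v * (1 + norm l) ^ (m - 1))"
      by (simp add: sum_distrib_right)
    also have "\<dots> \<le> S * (e / (2 * S))"
      using A(1) key S by (intro mult_mono) (auto simp: S_def sum_nonneg)
    also have "\<dots> = e / 2" using S by simp
    finally have 1: "norm (\<Sum>j<d. poly (b j) l * v ^ (d - j)) \<le> e / 2" .
    have "norm (\<delta> * k * v ^ (d - 1)) \<le> (norm \<delta> * K) * (e / (2 * (norm \<delta> * K + 1)))"
    proof -
      have "norm (v ^ (d - 1)) \<le> norm v" using d by (intro vpow) simp
      also have "\<dots> \<le> e / (2 * (norm \<delta> * K + 1))" using z'(2) r by (simp add: r0_def)
      finally show ?thesis
        unfolding norm_mult using z' K by (intro mult_mono) auto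
    qed
    also have "\<dots> \<le> e / 2"
      using pos e K by (simp add: field_simps)
    finally have 2: "norm (\<delta> * k * v ^ (d - 1)) \<le> e / 2" .
    have "henon_u d \<delta> b z - 1 = (\<Sum>j<d. poly (b j) l * v ^ (d - j)) - \<delta> * k * v ^ (d - 1)"
      by (simp add: henon_u_def lkv)
    then show ?thesis
      using norm_triangle_le_diff[OF order_trans[OF add_mono[OF 1 2]]] by simp
  qed
  ultimately show ?thesis by blast
qed

section \<open>The Boettcher coordinate near infinity and its inverse in the fibres\<close>

locale henon_normal =
  fixes d m :: nat and c \<delta> :: complex and b :: "nat \<Rightarrow> complex poly" and K r :: real
  assumes d: "d \<ge> 2" and c: "norm c > 1" and \<delta>: "\<delta> \<noteq> 0" and m: "m \<ge> 1"
    and r_pos: "r > 0" and r_K: "8 * r < K" and r_c: "8 * r * norm c ^ m \<le> 1"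
    and u_near_1: "\<And>z. z \<in> region m (4 * K) (4 * r) \<Longrightarrow> norm (henon_u d \<delta> b z - 1) \<le> 1/100"
begin

text \<open>Each factor 2 pays for one loss: u is controlled and \<open>gg\<close> defined on
  \<open>R4\<close>, Cauchy's estimate then controls the derivative of \<open>ff\<close> on
  \<open>R2\<close>, and each w with (l, k, w) \<in> \<open>R1\<close> is a value of
  \<open>ff\<close> on \<open>R2\<close>. The bound 8 r < K keeps the new k, which is at most 8 r on
  \<open>R4\<close>, inside; 8 r |c|^m \<le> 1 compensates the growth of |l|^m under l \<mapsto> c
  l; 1/100 is small enough to end with a density \<open>GG\<close> within 1/4 of 1.\<close>

abbreviation "R4 \<equiv> region m (4 * K) (4 * r)"
abbreviation "R2 \<equiv> region m (2 * K) (2 * r)"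
abbreviation "R1 \<equiv> region m K r"
abbreviation "uu \<equiv> henon_u d \<delta> b"

lemma K_pos: "K > 0" using r_pos r_K by simp

lemma r_small: "8 * r \<le> 1"
proof -
  have "8 * r * 1 \<le> 8 * r * norm c ^ m"
    using c r_pos by (intro mult_left_mono one_le_power) auto
  then show ?thesis using r_c by simp
qed

lemma region_sub: "R1 \<subseteq> R2" "R2 \<subseteq> R4" "R1 \<subseteq> R4"
  by (rule region_mono; use K_pos r_pos in simp)+

lemma norm_u: "z \<in> R4 \<Longrightarrow> norm (uu z) \<ge> 1/2"
  using u_near_1[of z] norm_triangle_ineq2[of 1 "1 - uu z"] by (simp add: norm_minus_commute)

lemma u_nz: "z \<in> R4 \<Longrightarrow> uu z \<noteq> 0"
  using norm_u[of z] by auto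

lemma hol_u: "hol uu R4"
proof -
  have "hol (\<lambda>z. 1 + (\<Sum>j<d. poly (b j) (fst z) * snd (snd z) ^ (d - j)) - \<delta> * fst (snd z) * snd (snd z) ^ (d - 1)) R4"
    by (intro hol_intros open_region)
  then show ?thesis by (simp add: henon_u_def split_beta')
qed

text \<open>The new quotient x/y is y / y1 with y1 = cd y^d u, which equals v^(d-1) / u because
  \<alpha>^(d-1) = cd; the new v is v times y / y1, as in \<open>HH\<close>.\<close>

definition kk :: "complex3 \<Rightarrow> complex" where
  "kk = (\<lambda>(l, k, v). v ^ (d - 1) / uu (l, k, v))"

definition HH :: "complex3 \<Rightarrow> complex3" where
  "HH = (\<lambda>(l, k, v). (c * l, kk (l, k, v), v * kk (l, k, v)))"

lemma hol_kk: "hol kk R4"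
proof -
  have "hol (\<lambda>z. snd (snd z) ^ (d - 1) / uu z) R4"
    by (intro hol_divide hol_intros open_region hol_u u_nz)
  then show ?thesis by (simp add: kk_def split_beta')
qed

lemma kk_bound:
  assumes "(l, k, v) \<in> R4"
  shows "norm (kk (l, k, v)) \<le> 2 * norm v" "norm (kk (l, k, v)) \<le> 8 * r"
proof -
  have v: "norm v < 4 * r" using assms by (simp add: mem_region)
  have "norm v ^ (d - 1) \<le> norm v ^ 1"
    using d v r_small by (intro power_decreasing) auto
  then have "norm v ^ (d - 1) / norm (uu (l, k, v)) \<le> norm v / (1/2)"
    using norm_u[OF assms] by (intro frac_le) auto
  then show "norm (kk (l, k, v)) \<le> 2 * norm v"
    by (simp add: kk_def norm_divide norm_power)
  then show "norm (kk (l, k, v)) \<le> 8 * r" using v by simp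
qed

text \<open>The factor |c|^m gained by |l|^m is absorbed by the factor \<open>kk\<close> of the new
  v, which is at most 8 r. The radii are left variable because invariance is used for
  \<open>R4\<close> and for \<open>R2\<close>.\<close>

lemma HH_region:
  assumes "z \<in> region m K' r'" "K \<le> K'" "K' \<le> 4 * K" "r' \<le> 4 * r"
  shows "HH z \<in> region m K' r'"
proof -
  obtain l k v where z: "z = (l, k, v)" by (metis prod.exhaust)
  have z4: "(l, k, v) \<in> R4" using region_mono[OF assms(3,4)] assms(1) z by blast
  have zz: "norm v < r'" "norm v * norm l ^ m < K'" using assms(1) z by (auto simp: mem_region)
  have kb: "norm (kk (l, k, v)) \<le> 8 * r" using kk_bound(2)[OF z4] .
  have v1: "norm (v * kk (l, k, v)) \<le> norm v * (8 * r)"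
    unfolding norm_mult using kb by (intro mult_left_mono) auto
  also have "\<dots> \<le> norm v * 1" using r_small by (intro mult_left_mono) auto
  finally have "norm (v * kk (l, k, v)) < r'" using zz by simp
  moreover have "norm (v * kk (l, k, v)) * norm (c * l) ^ m \<le> (norm v * (8 * r)) * norm (c * l) ^ m"
    using v1 by (intro mult_right_mono) auto
  then have "norm (v * kk (l, k, v)) * norm (c * l) ^ m \<le> (norm v * norm l ^ m) * (8 * r * norm c ^ m)"
    by (simp add: norm_mult power_mult_distrib mult_ac)
  then have "norm (v * kk (l, k, v)) * norm (c * l) ^ m \<le> norm v * norm l ^ m"
    using mult_left_mono[OF r_c, of "norm v * norm l ^ m"] by simp
  ultimately show ?thesis
    using kb r_K assms(2) zz by (simp add: z HH_def mem_region)
qed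

lemma holomorphic3_HH: "holomorphic3 HH R4"
proof -
  have "holomorphic3 (\<lambda>z. (c * fst z, kk z, snd (snd z) * kk z)) R4"
    by (intro holomorphic3_components hol_intros hol_kk open_region)
  then show ?thesis by (simp add: HH_def split_beta')
qed

lemma HH_R4: "z \<in> R4 \<Longrightarrow> HH z \<in> R4"
  using K_pos by (intro HH_region) auto

lemma HH_iter:
  "z \<in> R4 \<Longrightarrow> (HH ^^ n) z \<in> R4" "holomorphic3 (HH ^^ n) R4"
proof -
  show it: "z \<in> R4 \<Longrightarrow> (HH ^^ n) z \<in> R4" for z n
    by (induction n) (auto intro: HH_R4)
  show "holomorphic3 (HH ^^ n) R4"
  proof (induction n)
    case 0
    have "holomorphic3 (\<lambda>z. (fst z, fst (snd z), snd (snd z))) R4"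
      by (intro holomorphic3_components hol_coords open_region)
    then show ?case by (simp add: id_def)
  next
    case (Suc n)
    have "holomorphic3 (\<lambda>z. HH ((HH ^^ n) z)) R4"
      by (rule holomorphic3_compose[OF Suc holomorphic3_HH]) (use it in blast)
    then show ?case by (simp add: o_def)
  qed
qed

lemma norm_Ln_u: "z \<in> R4 \<Longrightarrow> norm (Ln (uu z)) \<le> 1/50"
  using norm_Ln_le[of "uu z - 1"] u_near_1[of z] by simp

lemma hol_Ln_u: "hol (\<lambda>z. Ln (uu z)) R4"
proof (rule hol_compose_holomorphic[OF hol_u, of Ln "{z. Re z > 0}"])
  show "Ln holomorphic_on {z. 0 < Re z}"
    by (intro holomorphic_intros) (auto simp: complex_nonpos_Reals_iff)
  show "open {z. 0 < Re z}" by (rule open_halfspace_Re_gt)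
  have "Re (uu z) > 0" if "z \<in> R4" for z
    using u_near_1[OF that] abs_Re_le_cmod[of "uu z - 1"] by simp
  then show "uu ` R4 \<subseteq> {z. 0 < Re z}" by auto
qed

text \<open>Formally, \<open>exp (gg)\<close> is the limit of \<open>v v\<^sub>n\<^sup>-\<^sup>1\<^sup>/\<^sup>D\<close> with \<open>D = d\<^sup>n\<close>, where \<open>v\<^sub>n\<close> is the last coordinate of the
  \<open>n\<close>-th iterate; hence \<open>ff = v exp (-gg)\<close> below is the Boettcher coordinate, and \<open>vv\<close> inverts it in
  each fibre.\<close>

definition gg :: "complex3 \<Rightarrow> complex" where
  "gg z = (\<Sum>n. Ln (uu ((HH ^^ n) z)) / of_nat d ^ (n + 1))"

lemma gg_term_bound:
  assumes "z \<in> R4"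
  shows "norm (Ln (uu ((HH ^^ n) z)) / of_nat d ^ (n + 1)) \<le> 1/100 * (1/2) ^ n"
proof -
  have "norm (Ln (uu ((HH ^^ n) z))) \<le> 1/50" using norm_Ln_u HH_iter(1)[OF assms] by blast
  moreover have "(2::real) ^ (n + 1) \<le> real d ^ (n + 1)" using d by (intro power_mono) auto
  ultimately have "norm (Ln (uu ((HH ^^ n) z))) / real d ^ (n + 1) \<le> (1/50) / 2 ^ (n + 1)"
    by (intro frac_le) auto
  moreover have "norm ((of_nat d :: complex) ^ (n + 1)) = real d ^ (n + 1)"
    by (simp only: norm_power norm_of_nat)
  moreover have "(1/50) / 2 ^ (n + 1) = 1/100 * (1/2::real) ^ n"
    by (simp add: power_divide)
  ultimately show ?thesis by (simp only: norm_divide)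
qed

lemma gg_summable: "z \<in> R4 \<Longrightarrow> summable (\<lambda>n. Ln (uu ((HH ^^ n) z)) / of_nat d ^ (n + 1))"
  by (rule summable_comparison_test'[of "\<lambda>n. 1/100 * (1/2) ^ n"])
    (use gg_term_bound in \<open>auto intro!: summable_mult summable_geometric\<close>)

lemma hol_gg: "hol gg R4"
  unfolding gg_def
proof (rule hol_suminf[OF open_region])
  show "hol (\<lambda>z. Ln (uu ((HH ^^ n) z)) / of_nat d ^ (n + 1)) R4" for n
    using d HH_iter by (intro hol_divide hol_compose[OF hol_Ln_u] hol_intros open_region) auto
  show "summable (\<lambda>n. 1/100 * (1/2) ^ n :: real)" by (intro summable_mult summable_geometric) auto
qed (rule gg_term_bound)

lemma norm_gg: "z \<in> R4 \<Longrightarrow> norm (gg z) \<le> 1/50"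
proof -
  assume z: "z \<in> R4"
  have "summable (\<lambda>n. 1/100 * (1/2) ^ n :: real)" by (intro summable_mult summable_geometric) auto
  then have "norm (gg z) \<le> (\<Sum>n. 1/100 * (1/2) ^ n)"
    unfolding gg_def by (intro norm_suminf_le gg_term_bound z)
  also have "\<dots> = 1/50" by (subst suminf_mult) (auto simp: suminf_geometric summable_geometric)
  finally show ?thesis .
qed

text \<open>Splitting off the first term of the series leaves the series at HH z divided by
  d.\<close>

lemma gg_HH:
  assumes "z \<in> R4"
  shows "of_nat d * gg z = Ln (uu z) + gg (HH z)"
proof -
  let ?t = "\<lambda>z n. Ln (uu ((HH ^^ n) z)) / of_nat d ^ (n + 1)"
  have "gg z = ?t z 0 + (\<Sum>n. ?t z (Suc n))"
    unfolding gg_def using suminf_split_head[OF gg_summable[OF assms]] by simp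
  also have "(\<Sum>n. ?t z (Suc n)) = (\<Sum>n. ?t (HH z) n / of_nat d)"
    by (simp add: funpow_swap1 mult.commute)
  also have "\<dots> = gg (HH z) / of_nat d"
    unfolding gg_def by (rule suminf_divide[OF gg_summable[OF HH_R4[OF assms]]])
  finally show ?thesis using d by (simp add: field_simps)
qed

lemma at_zero:
  assumes "norm k < 4 * K"
  shows "(l, k, 0) \<in> R4" "uu (l, k, 0) = 1" "kk (l, k, 0) = 0" "gg (l, k, 0) = 0"
proof -
  have u1: "uu (l, k, 0) = 1" for l k
    using d by (auto simp: henon_u_def power_0_left)
  show "(l, k, 0) \<in> R4" "uu (l, k, 0) = 1" using assms K_pos r_pos u1 by (auto simp: mem_region)
  have k0: "kk (l, k, 0) = 0" for l k using d by (simp add: kk_def)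
  show "kk (l, k, 0) = 0" by (rule k0)
  have "\<exists>l' k'. (HH ^^ n) (l, k, 0) = (l', k', 0)" for n
    by (induction n) (auto simp: HH_def k0)
  then have "uu ((HH ^^ n) (l, k, 0)) = 1" for n
    by (metis u1)
  then show "gg (l, k, 0) = 0" by (simp add: gg_def)
qed

definition ff :: "complex3 \<Rightarrow> complex" where
  "ff z = snd (snd z) * exp (- gg z)"

lemma hol_ff: "hol ff R4"
  unfolding ff_def by (intro hol_intros hol_gg open_region)

lemma ff_HH:
  assumes "z \<in> R4"
  shows "ff (HH z) = ff z ^ d"
proof -
  obtain l k v where z: "z = (l, k, v)" by (metis prod.exhaust)
  have "exp (- gg z) ^ d = exp (- (of_nat d * gg z))"
    by (simp add: exp_of_nat_mult[symmetric])
  also have "\<dots> = exp (- gg (HH z)) / exp (Ln (uu z))"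
    by (simp add: gg_HH[OF assms] exp_diff exp_minus field_simps exp_add)
  finally have "exp (- gg z) ^ d = exp (- gg (HH z)) / uu z"
    using u_nz[OF assms] by simp
  moreover have "snd (snd (HH z)) = v ^ d / uu z"
    using d by (simp add: z HH_def kk_def power_eq_if)
  ultimately show ?thesis by (simp add: ff_def power_mult_distrib z)
qed

lemma norm_exp_gg:
  assumes "z \<in> R4"
  shows "norm (exp (- gg z) - 1) \<le> 3/100"
  using norm_exp_bounds(2)[of "- gg z"] norm_gg[OF assms] by simp

lemma norm_ff:
  assumes "(l, k, v) \<in> R4"
  shows "norm (ff (l, k, v)) \<le> 2 * norm v"
proof -
  have "norm (exp (- gg (l, k, v))) \<le> 2"
    using norm_exp_gg[OF assms] norm_triangle_sub[of "exp (- gg (l, k, v))" 1] by simp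
  then have "norm v * norm (exp (- gg (l, k, v))) \<le> norm v * 2"
    by (intro mult_left_mono) auto
  then show ?thesis by (simp add: ff_def norm_mult)
qed

text \<open>The derivative is e^-g (1 - v g'). Cauchy's estimate for g' is taken on the disc of
  radius |v| around v, which stays in \<open>R4\<close>; its bound (1/50) / |v| is exactly
  compensated by the factor v, with no loss as l grows.\<close>

lemma ff_deriv:
  assumes "(l, k, v) \<in> R2"
  shows "norm (deriv (\<lambda>v. ff (l, k, v)) v - 1) \<le> 1/10"
proof -
  have z4: "(l, k, v) \<in> R4" using assms region_sub by blast
  have g: "(\<lambda>v. gg (l, k, v)) holomorphic_on {v. (l, k, v) \<in> R4}" "open {v. (l, k, v) \<in> R4}"
    using hol_slices(3)[OF hol_gg] open_slice(3)[OF open_region] by auto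
  let ?g' = "deriv (\<lambda>v. gg (l, k, v)) v" and ?E = "exp (- gg (l, k, v))"
  have "norm (v * ?g') \<le> 1/50"
  proof (cases "v = 0")
    case False
    have "norm ?g' \<le> (1/50) / norm v"
    proof (rule Cauchy_deriv_bound[OF g])
      show "cball v (norm v) \<subseteq> {v. (l, k, v) \<in> R4}"
      proof
        fix x assume "x \<in> cball v (norm v)"
        then have "norm x \<le> 2 * norm v"
          using norm_triangle_sub[of x v] by (simp add: dist_norm norm_minus_commute)
        moreover from this have "norm x * norm l ^ m \<le> (2 * norm v) * norm l ^ m"
          by (intro mult_right_mono) auto
        ultimately show "x \<in> {v. (l, k, v) \<in> R4}"
          using assms K_pos by (auto simp: mem_region)
      qed
    qed (use False norm_gg in auto)
    then show ?thesis using False by (simp add: norm_mult field_simps)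
  qed auto
  moreover have "((\<lambda>v. ff (l, k, v)) has_field_derivative ?E * (1 - v * ?g')) (at v)"
  proof -
    have "((\<lambda>v. gg (l, k, v)) has_field_derivative ?g') (at v)"
      using holomorphic_derivI[OF g] z4 by blast
    then show ?thesis
      unfolding ff_def by (auto intro!: derivative_eq_intros simp: algebra_simps)
  qed
  then have "deriv (\<lambda>v. ff (l, k, v)) v = ?E * (1 - v * ?g')" by (rule DERIV_imp_deriv)
  then have "deriv (\<lambda>v. ff (l, k, v)) v - 1 = (?E - 1) - ?E * (v * ?g')"
    by (simp add: algebra_simps)
  then have "norm (deriv (\<lambda>v. ff (l, k, v)) v - 1) \<le> norm (?E - 1) + norm ?E * norm (v * ?g')"
    using norm_triangle_ineq4[of "?E - 1" "?E * (v * ?g')"] by (simp only: norm_mult)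
  moreover have "norm ?E \<le> 2"
    using norm_exp_gg[OF z4] norm_triangle_sub[of ?E 1] by simp
  ultimately show ?thesis
    using norm_exp_gg[OF z4] mult_mono[of "norm ?E" 2 "norm (v * ?g')" "1/50"] by simp
qed

text \<open>The radius of the v-discs in the regions (\<open>mem_region_rho\<close>). At l = 0 the
  quotient would be 0 by the convention for division by zero, hence the separate case.\<close>

definition rho :: "complex \<Rightarrow> real" where
  "rho l = (if l = 0 then r else min r (K / norm l ^ m))"

lemma rho_pos: "rho l > 0"
  using r_pos K_pos by (simp add: rho_def)

lemma mem_region_rho:
  assumes "s > 0"
  shows "(l, k, v) \<in> region m (s * K) (s * r) \<longleftrightarrow> norm k < s * K \<and> norm v < s * rho l"
proof (cases "l = 0")
  case True
  then show ?thesis using assms K_pos m by (auto simp add: mem_region rho_def power_0_left)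
next
  case False
  then have "norm v * norm l ^ m < s * K \<longleftrightarrow> norm v < s * (K / norm l ^ m)"
    by (simp add: field_simps)
  moreover have "norm v < s * min r (K / norm l ^ m) \<longleftrightarrow> norm v < s * r \<and> norm v < s * (K / norm l ^ m)"
  proof -
    have "norm v < s * t \<longleftrightarrow> norm v / s < t" for t
      using assms by (simp add: pos_divide_less_eq mult.commute)
    then show ?thesis by (simp only: min_less_iff_conj)
  qed
  ultimately show ?thesis using False by (auto simp: mem_region rho_def)
qed

lemma slice_R2: "norm k < 2 * K \<Longrightarrow> {v. (l, k, v) \<in> R2} = ball 0 (2 * rho l)"
  by (auto simp: mem_region_rho)

lemma mem_R1: "(l, k, v) \<in> R1 \<longleftrightarrow> norm k < K \<and> norm v < rho l"
  using mem_region_rho[of 1 l k v] by simp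

lemma ff_slice:
  assumes "norm k < 2 * K"
  shows "inj_on (\<lambda>v. ff (l, k, v)) (ball 0 (2 * rho l))"
    and "norm w < 3/2 * rho l \<Longrightarrow> \<exists>v. norm v \<le> 4/3 * norm w \<and> ff (l, k, v) = w"
proof -
  have 1: "(\<lambda>v. ff (l, k, v)) holomorphic_on ball 0 (2 * rho l)"
    using hol_slices(3)[OF hol_subset[OF hol_ff open_region region_sub(2)], of l k] slice_R2[OF assms] by simp
  have 2: "ff (l, k, 0) = 0" by (simp add: ff_def)
  have 3: "norm (deriv (\<lambda>v. ff (l, k, v)) v - 1) \<le> 1/4" if "v \<in> ball 0 (2 * rho l)" for v
  proof -
    have "(l, k, v) \<in> R2" using that slice_R2[OF assms, of l] by blast
    from ff_deriv[OF this] show ?thesis by linarith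
  qed
  show "inj_on (\<lambda>v. ff (l, k, v)) (ball 0 (2 * rho l))"
    by (rule near_linear(1)[OF 1 2 3])
  show "norm w < 3/2 * rho l \<Longrightarrow> \<exists>v. norm v \<le> 4/3 * norm w \<and> ff (l, k, v) = w"
    using near_linear(2)[OF 1 2 3, of w] by simp
qed

lemma biholomorphic3_ff:
  "biholomorphic3 (\<lambda>(l, k, v). (l, k, ff (l, k, v))) R2 ((\<lambda>(l, k, v). (l, k, ff (l, k, v))) ` R2)"
proof (rule biholomorphic3_shear3)
  show "hol ff R2" using hol_subset[OF hol_ff open_region region_sub(2)] .
  show "inj_on (\<lambda>x. ff (l, k, x)) {x. (l, k, x) \<in> R2}" for l k
  proof (cases "norm k < 2 * K")
    case True
    then show ?thesis using ff_slice(1) slice_R2 by simp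
  qed (auto simp: mem_region)
  show "deriv (\<lambda>x. ff (l, k, x)) v \<noteq> 0" if "(l, k, v) \<in> R2" for l k v
    using ff_deriv[OF that] by auto
qed

definition vv :: "complex3 \<Rightarrow> complex" where
  "vv = (\<lambda>(l, k, w). THE v. (l, k, v) \<in> R2 \<and> ff (l, k, v) = w)"

lemma vv_eq:
  assumes "(l, k, v) \<in> R2"
  shows "vv (l, k, ff (l, k, v)) = v"
proof -
  have k: "norm k < 2 * K" using assms by (simp add: mem_region)
  show ?thesis
    unfolding vv_def prod.case
  proof (rule the_equality)
    show "v' = v" if "(l, k, v') \<in> R2 \<and> ff (l, k, v') = ff (l, k, v)" for v'
      using ff_slice(1)[OF k, of l] that assms slice_R2[OF k, of l] by (auto simp: inj_on_def)
  qed (use assms in auto)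
qed

lemma vv_props:
  assumes "(l, k, w) \<in> R1"
  shows "(l, k, vv (l, k, w)) \<in> R2" "ff (l, k, vv (l, k, w)) = w" "norm (vv (l, k, w)) \<le> 4/3 * norm w"
proof -
  have k: "norm k < 2 * K" and w: "norm w < rho l" using assms K_pos by (auto simp: mem_R1)
  then obtain v where v: "norm v \<le> 4/3 * norm w" "ff (l, k, v) = w"
    using ff_slice(2)[OF k, of w l] rho_pos[of l] by auto
  then have "norm v < 2 * rho l" using w rho_pos[of l] norm_ge_zero[of w] by linarith
  then have "(l, k, v) \<in> R2" using k by (simp add: mem_region_rho)
  then show "(l, k, vv (l, k, w)) \<in> R2" "ff (l, k, vv (l, k, w)) = w" "norm (vv (l, k, w)) \<le> 4/3 * norm w"
    using vv_eq[of l k v] v by auto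
qed

text \<open>\<open>vv\<close> is the last component of the inverse of the shear by
  \<open>ff\<close>, restricted to \<open>R1\<close>, which lies in the image of \<open>R2\<close>
  by \<open>vv_props\<close>.\<close>

lemma hol_vv: "hol vv R1"
proof -
  let ?F = "\<lambda>(l, k, v). (l, k, ff (l, k, v))"
  obtain G where G: "holomorphic3 G (?F ` R2)" "\<And>z. z \<in> R2 \<Longrightarrow> G (?F z) = z"
    by (rule biholomorphic3E[OF biholomorphic3_ff]) blast
  have *: "z \<in> ?F ` R2 \<and> vv z = snd (snd (G z))" if "z \<in> R1" for z
  proof -
    obtain l k w where z: "z = (l, k, w)" by (metis prod.exhaust)
    have F: "?F (l, k, vv z) = z" "(l, k, vv z) \<in> R2"
      using vv_props[of l k w] that z by auto
    then have "G z = (l, k, vv z)" using G(2)[OF F(2)] by simp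
    moreover have "z \<in> ?F ` R2" using F(1)[symmetric] F(2) by (rule image_eqI)
    ultimately show ?thesis by simp
  qed
  have "hol (\<lambda>z. snd (snd (G z))) R1"
    by (rule hol_compose[OF hol_coords(3)[OF open_UNIV] holomorphic3_subset[OF G(1) open_region]])
      (use * in auto)
  then show ?thesis by (rule hol_cong) (use * in blast)
qed

end

section \<open>The second coordinate on the level curves of the Boettcher coordinate\<close>

lemma norm_integral_unit_le:
  fixes f :: "real \<Rightarrow> complex"
  assumes "continuous_on {0..1} f" "\<And>u. u \<in> {0..1} \<Longrightarrow> norm (f u) \<le> B"
  shows "norm (integral {0..1} f) \<le> B"
proof -
  have "norm (integral {0..1} f) \<le> integral {0..1} (\<lambda>u::real. B)"
    using assms by (intro integral_norm_bound_integral integrable_continuous_real) auto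
  then show ?thesis by simp
qed

text \<open>The algebra of \<open>sig_step_deriv\<close>: W = w^(d-1), D = d, \<open>E\<close> and
  \<open>E1\<close> are e^(-3g) before and after one step, and -fk/fv is the slope of v along a
  level curve. \<open>X\<close> is the Jacobian identity; the left side becomes the derivative of
  \<open>sig\<close> along the image of the curve.\<close>

lemma level_curve_identity:
  fixes E E1 v K W w D Kk Kv fk fv Fv \<delta> :: complex
  assumes "E1 * (v * K) ^ 3 = (W * w) ^ 3" "E * v ^ 3 = w ^ 3"
    and X: "D * W * (Kk * fv - Kv * fk) = \<delta> * K ^ 3 * Fv"
    and nz: "D \<noteq> 0" "W \<noteq> 0" "v \<noteq> 0" "K \<noteq> 0" "fv \<noteq> 0" "Fv \<noteq> 0"
  shows "E1 / Fv * (Kk + Kv * (- fk / fv)) = \<delta> / D * W\<^sup>2 * (E / fv)"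
proof -
  have E1: "E1 = W ^ 3 * w ^ 3 / (v ^ 3 * K ^ 3)" and E: "E = w ^ 3 / v ^ 3"
    using assms(1,2) nz by (simp_all add: field_simps power_mult_distrib)
  have "Kk + Kv * (- fk / fv) = (Kk * fv - Kv * fk) / fv"
    using nz by (simp add: field_simps)
  also have "Kk * fv - Kv * fk = \<delta> * K ^ 3 * Fv / (D * W)"
    using X nz by (simp add: field_simps)
  finally have eq: "Kk + Kv * (- fk / fv) = \<delta> * K ^ 3 * Fv / (D * W) / fv" .
  show ?thesis
    unfolding eq E1 E using nz by (simp add: field_simps power2_eq_square power3_eq_cube)
qed

context henon_normal
begin

definition dff :: "complex3 \<Rightarrow> complex" where
  "dff = (\<lambda>(l, k, v). deriv (\<lambda>v. ff (l, k, v)) v)"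

lemma hol_dff: "hol dff R4"
  unfolding dff_def by (rule hol_deriv3[OF hol_ff])

lemma dff_near_1: "z \<in> R2 \<Longrightarrow> norm (dff z - 1) \<le> 1/10"
  using ff_deriv by (auto simp: dff_def split: prod.splits)

lemma norm_dff: "z \<in> R2 \<Longrightarrow> norm (dff z) \<ge> 9/10"
  using dff_near_1[of z] norm_triangle_ineq2[of 1 "1 - dff z"] by (simp add: norm_minus_commute)

lemma dff_nz: "z \<in> R2 \<Longrightarrow> dff z \<noteq> 0"
  using norm_dff[of z] by auto

text \<open>The density of \<open>w\<^sup>2 ds\<close> with respect to \<open>dk\<close> on the level curve \<open>ff = w\<close>, so that \<open>sig\<close> below is \<open>w\<^sup>2 s\<close>,
  where \<open>s\<close> is normalized to vanish at \<open>x = 0\<close>.\<close>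

definition GG :: "complex3 \<Rightarrow> complex" where
  "GG = (\<lambda>(l, k, w). exp (- 3 * gg (l, k, vv (l, k, w))) / dff (l, k, vv (l, k, w)))"

lemma hol_GG: "hol GG R1"
proof -
  have mem: "(fst z, fst (snd z), vv z) \<in> R2" if "z \<in> R1" for z
    using vv_props(1)[of "fst z" "fst (snd z)" "snd (snd z)"] that by simp
  have "hol (\<lambda>z. exp (- 3 * gg (fst z, fst (snd z), vv z)) / dff (fst z, fst (snd z), vv z)) R1"
    using mem region_sub dff_nz
    by (intro hol_divide hol_intros open_region hol_compose3[OF hol_gg] hol_compose3[OF hol_dff] hol_vv) auto
  then show ?thesis by (simp add: GG_def split_beta')
qed

lemma GG_near_1: "z \<in> R1 \<Longrightarrow> norm (GG z - 1) \<le> 1/4"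
proof -
  assume "z \<in> R1"
  obtain l k w where z: "z = (l, k, w)" by (metis prod.exhaust)
  let ?z = "(l, k, vv (l, k, w))"
  have R2: "?z \<in> R2" and R4: "?z \<in> R4" using vv_props(1)[of l k w] \<open>z \<in> R1\<close> z region_sub by auto
  have g: "norm (- 3 * gg ?z) \<le> 3/50" using norm_gg[OF R4] by (simp add: norm_mult)
  then have e: "norm (exp (- 3 * gg ?z) - 1) \<le> 9/100"
    using norm_exp_bounds(2)[of "- 3 * gg ?z"] by simp
  have "GG z - 1 = ((exp (- 3 * gg ?z) - 1) - (dff ?z - 1)) / dff ?z"
    using dff_nz[OF R2] by (simp add: z GG_def field_simps)
  also have "norm \<dots> \<le> (9/100 + 1/10) / (9/10)"
    unfolding norm_divide using e dff_near_1[OF R2] norm_dff[OF R2]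
    by (intro frac_le norm_triangle_le_diff) auto
  finally show ?thesis by simp
qed

lemma norm_GG: "z \<in> R1 \<Longrightarrow> norm (GG z) \<le> 5/4"
  using GG_near_1[of z] norm_triangle_sub[of "GG z" 1] by simp

lemma scaled_k_in_R1:
  assumes "z \<in> R1" "u \<in> {0..1::real}"
  shows "(fst z, of_real u * fst (snd z), snd (snd z)) \<in> R1"
proof -
  have "norm (of_real u * fst (snd z)) \<le> norm (fst (snd z))"
    using assms(2) by (auto simp: norm_mult intro!: mult_left_le_one_le)
  then show ?thesis using assms(1) by (auto simp: region_def)
qed

text \<open>The average of \<open>GG\<close> over the segment from 0 to k, that is,
  \<open>sig\<close> / k without the division. Keeping the factor k apart lets \<open>hh\<close>
  make sense at w = 0, where the new k vanishes.\<close>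

definition sh :: "complex3 \<Rightarrow> complex" where
  "sh z = integral {0..1} (\<lambda>u::real. GG (fst z, of_real u * fst (snd z), snd (snd z)))"

lemma hol_sh: "hol sh R1"
  unfolding sh_def
proof (rule hol_integral[OF open_region])
  show "continuous_on (R1 \<times> {0..1}) (\<lambda>(z, u). GG (fst z, of_real u * fst (snd z), snd (snd z)))"
    unfolding split_beta
    by (intro continuous_on_compose2[OF hol_imp_continuous_on[OF hol_GG]] continuous_intros)
      (use scaled_k_in_R1 in auto)
  show "hol (\<lambda>z. GG (fst z, of_real u * fst (snd z), snd (snd z))) R1" if "u \<in> {0..1}" for u
    using scaled_k_in_R1 that by (intro hol_compose3[OF hol_GG] hol_intros open_region) auto
qed

lemma norm_sh:
  assumes "z \<in> R1"
  shows "norm (sh z) \<le> 5/4"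
  unfolding sh_def
proof (rule norm_integral_unit_le)
  show "continuous_on {0..1} (\<lambda>u. GG (fst z, of_real u * fst (snd z), snd (snd z)))"
    by (intro continuous_on_compose2[OF hol_imp_continuous_on[OF hol_GG]] continuous_intros)
      (use scaled_k_in_R1[OF assms] in auto)
qed (use scaled_k_in_R1[OF assms] norm_GG in auto)

definition sig :: "complex3 \<Rightarrow> complex" where
  "sig z = fst (snd z) * sh z"

lemma hol_sig: "hol sig R1"
  unfolding sig_def by (intro hol_intros hol_sh open_region)

lemma slice_R1: "norm w < rho l \<Longrightarrow> {k. (l, k, w) \<in> R1} = ball 0 K"
  by (auto simp: mem_R1)

lemma sig_deriv:
  assumes "(l, k, w) \<in> R1"
  shows "((\<lambda>k. sig (l, k, w)) has_field_derivative GG (l, k, w)) (at k)"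
proof -
  have w: "norm w < rho l" and k: "k \<in> ball 0 K" using assms by (auto simp: mem_R1)
  have "(\<lambda>k. GG (l, k, w)) holomorphic_on ball 0 K"
    using hol_slices(2)[OF hol_GG, of l w] slice_R1[OF w] by simp
  from radial_primitive_deriv[OF this k] show ?thesis
    by (simp add: sig_def sh_def)
qed

lemma sig_slice:
  assumes "norm w < rho l"
  shows "inj_on (\<lambda>k. sig (l, k, w)) (ball 0 K)"
    and "norm s < 3/4 * K \<Longrightarrow> \<exists>k. norm k \<le> 4/3 * norm s \<and> sig (l, k, w) = s"
proof -
  have 1: "(\<lambda>k. sig (l, k, w)) holomorphic_on ball 0 K"
    using hol_slices(2)[OF hol_sig, of l w] slice_R1[OF assms] by simp
  have 2: "sig (l, 0, w) = 0" by (simp add: sig_def)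
  have 3: "norm (deriv (\<lambda>k. sig (l, k, w)) k - 1) \<le> 1/4" if "k \<in> ball 0 K" for k
  proof -
    have "(l, k, w) \<in> R1" using that slice_R1[OF assms] by blast
    then show ?thesis using DERIV_imp_deriv[OF sig_deriv] GG_near_1 by metis
  qed
  show "inj_on (\<lambda>k. sig (l, k, w)) (ball 0 K)"
    by (rule near_linear(1)[OF 1 2 3])
  show "norm s < 3/4 * K \<Longrightarrow> \<exists>k. norm k \<le> 4/3 * norm s \<and> sig (l, k, w) = s"
    by (rule near_linear(2)[OF 1 2 3])
qed

lemma power_d_in_R1:
  assumes "(l, k, w) \<in> R1" "norm k' < K"
  shows "(c * l, k', w ^ d) \<in> R1"
proof -
  have w: "norm w < r" "norm w * norm l ^ m < K" using assms by (auto simp: mem_region)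
  have "norm w ^ d \<le> norm w ^ 2"
    using d w r_small by (intro power_decreasing) auto
  also have "\<dots> \<le> norm w * r"
    using w by (auto simp: power2_eq_square intro!: mult_left_mono)
  finally have wd: "norm (w ^ d) \<le> norm w * r" by (simp add: norm_power)
  also have "\<dots> \<le> norm w * 1" using r_small r_pos by (intro mult_left_mono) auto
  finally have "norm (w ^ d) < r" using w by simp
  moreover have "norm (w ^ d) * norm (c * l) ^ m \<le> (norm w * r) * norm (c * l) ^ m"
    using wd by (intro mult_right_mono) auto
  then have "norm (w ^ d) * norm (c * l) ^ m \<le> (norm w * norm l ^ m) * (r * norm c ^ m)"
    by (simp add: norm_mult power_mult_distrib mult_ac)
  moreover have "r * norm c ^ m \<le> 1"
    using r_c r_pos mult_nonneg_nonneg[of r "norm c ^ m"] by simp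
  then have "(norm w * norm l ^ m) * (r * norm c ^ m) \<le> norm w * norm l ^ m"
    using mult_left_mono[of "r * norm c ^ m" 1 "norm w * norm l ^ m"] by simp
  ultimately show ?thesis using w assms(2) by (simp add: mem_region)
qed

text \<open>\<open>HH\<close> maps the level curve ff = w over l into the level curve ff = w^d over
  c l, and uniqueness of \<open>vv\<close> on \<open>R2\<close> identifies the third coordinate of
  the image.\<close>

lemma level_step:
  assumes "(l, k, w) \<in> R1"
  defines "k1 \<equiv> kk (l, k, vv (l, k, w))"
  shows "(c * l, k1, w ^ d) \<in> R1" "vv (c * l, k1, w ^ d) = vv (l, k, w) * k1" "norm k1 < K"
proof -
  let ?z = "(l, k, vv (l, k, w))"
  have R2: "?z \<in> R2" and R4: "?z \<in> R4" using vv_props(1)[OF assms(1)] region_sub by auto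
  have H: "HH ?z = (c * l, k1, vv (l, k, w) * k1)"
    by (simp add: HH_def k1_def)
  have "HH ?z \<in> R2" using K_pos r_pos by (intro HH_region[OF R2]) auto
  moreover have "ff (HH ?z) = w ^ d" using ff_HH[OF R4] vv_props(2)[OF assms(1)] by simp
  ultimately show "vv (c * l, k1, w ^ d) = vv (l, k, w) * k1"
    using vv_eq H by metis
  show k1: "norm k1 < K" using kk_bound(2)[OF R4] r_K by (simp add: k1_def)
  show "(c * l, k1, w ^ d) \<in> R1" by (rule power_d_in_R1[OF assms(1) k1])
qed

text \<open>The form \<open>ds \<and> dt\<close> is a multiple of \<open>t dx \<and> dy\<close>, so that \<open>s \<circ> H - (\<delta>/d) s\<close> is constant
  on the level curves of \<open>t\<close> in each fibre; this is the infinitesimal version of that claim.\<close>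

lemma sig_step_deriv:
  assumes R1: "(l, k, w) \<in> R1" and w: "w \<noteq> 0"
  shows "((\<lambda>k. sig (c * l, kk (l, k, vv (l, k, w)), w ^ d)) has_field_derivative
      \<delta> / of_nat d * w ^ (2 * d - 2) * GG (l, k, w)) (at k)"
proof -
  define v where "v = vv (l, k, w)"
  define k1 where "k1 = kk (l, k, v)"
  have R2: "(l, k, v) \<in> R2" and R4: "(l, k, v) \<in> R4"
    using vv_props(1)[OF R1] region_sub by (auto simp: v_def)
  have step: "(c * l, k1, w ^ d) \<in> R1" "vv (c * l, k1, w ^ d) = v * k1"
    using level_step[OF R1] by (simp_all add: v_def k1_def)
  have R2': "(c * l, k1, v * k1) \<in> R2" using vv_props(1)[OF step(1)] step(2) by simp
  then have R4': "(c * l, k1, v * k1) \<in> R4" using region_sub by auto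
  have fz: "ff (l, k, v) = w" and fz': "ff (c * l, k1, v * k1) = w ^ d"
    using vv_props(2)[OF R1] vv_props(2)[OF step(1)] step(2) by (simp_all add: v_def)
  define fk where "fk = deriv (\<lambda>x. ff (l, x, v)) k"
  define fv where "fv = deriv (\<lambda>x. ff (l, k, x)) v"
  define Kk where "Kk = deriv (\<lambda>x. kk (l, x, v)) k"
  define Kv where "Kv = deriv (\<lambda>x. kk (l, k, x)) v"
  define Fk where "Fk = deriv (\<lambda>x. ff (c * l, x, v * k1)) k1"
  define Fv where "Fv = deriv (\<lambda>x. ff (c * l, k1, x)) (v * k1)"
  define V' where "V' = deriv (\<lambda>x. vv (l, x, w)) k"
  have fv: "fv = dff (l, k, v)" and Fv: "Fv = dff (c * l, k1, v * k1)"
    by (simp_all add: fv_def Fv_def dff_def)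
  have nz: "fv \<noteq> 0" "Fv \<noteq> 0" using dff_nz[OF R2] dff_nz[OF R2'] by (simp_all add: fv Fv)
  have dV: "((\<lambda>x. vv (l, x, w)) has_field_derivative V') (at k)"
    unfolding V'_def using holomorphic_derivI[OF hol_slices(2)[OF hol_vv, of l w] open_slice(2)[OF open_region]] R1 by blast
  have dKk: "((\<lambda>x. kk (l, x, v)) has_field_derivative Kk) (at k)"
    unfolding Kk_def using holomorphic_derivI[OF hol_slices(2)[OF hol_kk, of l v] open_slice(2)[OF open_region]] R4 by blast
  have dKv: "((\<lambda>x. kk (l, k, x)) has_field_derivative Kv) (at v)"
    unfolding Kv_def using holomorphic_derivI[OF hol_slices(3)[OF hol_kk, of l k] open_slice(3)[OF open_region]] R4 by blast
  have dfk: "((\<lambda>x. ff (l, x, v)) has_field_derivative fk) (at k)"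
    unfolding fk_def using holomorphic_derivI[OF hol_slices(2)[OF hol_ff, of l v] open_slice(2)[OF open_region]] R4 by blast
  have dfv: "((\<lambda>x. ff (l, k, x)) has_field_derivative fv) (at v)"
    unfolding fv_def using holomorphic_derivI[OF hol_slices(3)[OF hol_ff, of l k] open_slice(3)[OF open_region]] R4 by blast
  have "((\<lambda>x. kk (l, x, vv (l, x, w))) has_field_derivative Kk * 1 + Kv * V') (at k)"
    using hol_chain[OF hol_kk, of "\<lambda>_. l" k "\<lambda>x. x" "\<lambda>x. vv (l, x, w)" 0 1 V'] R4 dV
    by (simp add: v_def[symmetric] Kk_def Kv_def)
  then have dk1: "((\<lambda>x. kk (l, x, vv (l, x, w))) has_field_derivative Kk + Kv * V') (at k)" by simp
  \<comment> \<open>Implicit differentiation of ff (l, x, vv (l, x, w)) = w.\<close>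
  have V': "V' = - fk / fv"
  proof -
    have "((\<lambda>x. ff (l, x, vv (l, x, w))) has_field_derivative fk + fv * V') (at k)"
      using hol_chain[OF hol_ff, of "\<lambda>_. l" k "\<lambda>x. x" "\<lambda>x. vv (l, x, w)" 0 1 V'] R4 dV
      by (simp add: v_def[symmetric] fk_def fv_def)
    moreover have "((\<lambda>x. ff (l, x, vv (l, x, w))) has_field_derivative 0) (at k)"
      by (rule has_field_derivative_transform_within_open[OF DERIV_const[of w] open_slice(2)[OF open_region, of l w]])
        (use R1 vv_props(2) in auto)
    ultimately have "fk + fv * V' = 0" using DERIV_unique by blast
    then have "fv * V' = - fk" by (simp add: eq_neg_iff_add_eq_0 add.commute)
    then show ?thesis using nz by (simp add: field_simps)
  qed
  define D where "D = of_nat d * w ^ (d - 1)"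
  \<comment> \<open>The partial derivatives of ff \<circ> HH = ff^d, in k here and in v in
    \<open>eq2\<close>; \<open>D\<close> is the derivative of the d-th power at w.\<close>
  have eq1: "Fk * Kk + Fv * (v * Kk) = D * fk"
  proof -
    have "((\<lambda>x. ff (c * l, kk (l, x, v), v * kk (l, x, v))) has_field_derivative Fk * Kk + Fv * (v * Kk)) (at k)"
      using hol_chain[OF hol_ff, of "\<lambda>_. c * l" k "\<lambda>x. kk (l, x, v)" "\<lambda>x. v * kk (l, x, v)" 0 Kk "v * Kk"]
        R4' dKk DERIV_cmult[OF dKk, of v]
      by (simp add: k1_def[symmetric] Fk_def Fv_def)
    then have "((\<lambda>x. ff (l, x, v) ^ d) has_field_derivative Fk * Kk + Fv * (v * Kk)) (at k)"
      by (rule has_field_derivative_transform_within_open[OF _ open_slice(2)[OF open_region, of l v]])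
        (use R4 ff_HH in \<open>auto simp: HH_def\<close>)
    moreover have "((\<lambda>x. ff (l, x, v) ^ d) has_field_derivative D * fk) (at k)"
      using DERIV_power[OF dfk, of d] by (simp add: D_def fz mult_ac)
    ultimately show ?thesis using DERIV_unique by blast
  qed
  have eq2: "Fk * Kv + Fv * (k1 + v * Kv) = D * fv"
  proof -
    have "((\<lambda>x. x * kk (l, k, x)) has_field_derivative k1 + v * Kv) (at v)"
      using DERIV_mult[OF DERIV_ident dKv] by (simp add: k1_def mult_ac add_ac)
    then have "((\<lambda>x. ff (c * l, kk (l, k, x), x * kk (l, k, x))) has_field_derivative
        Fk * Kv + Fv * (k1 + v * Kv)) (at v)"
      using hol_chain[OF hol_ff, of "\<lambda>_. c * l" v "\<lambda>x. kk (l, k, x)" "\<lambda>x. x * kk (l, k, x)" 0 Kv "k1 + v * Kv"]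
        R4' dKv
      by (simp add: k1_def[symmetric] Fk_def Fv_def)
    then have "((\<lambda>x. ff (l, k, x) ^ d) has_field_derivative Fk * Kv + Fv * (k1 + v * Kv)) (at v)"
      by (rule has_field_derivative_transform_within_open[OF _ open_slice(3)[OF open_region, of l k]])
        (use R4 ff_HH in \<open>auto simp: HH_def\<close>)
    moreover have "((\<lambda>x. ff (l, k, x) ^ d) has_field_derivative D * fv) (at v)"
      using DERIV_power[OF dfv, of d] by (simp add: D_def fz mult_ac)
    ultimately show ?thesis using DERIV_unique by blast
  qed
  \<comment> \<open>u depends on k only through the linear term -\<delta> k v^(d-1); this is where
    \<delta>, the Jacobian of H in a fibre, enters.\<close>
  have Kk: "Kk = \<delta> * k1\<^sup>2"
  proof -
    have u: "uu (l, k, v) \<noteq> 0" using u_nz[OF R4] .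
    have "((\<lambda>x. uu (l, x, v)) has_field_derivative (- \<delta> * v ^ (d - 1))) (at k)"
      unfolding henon_u_def by (auto intro!: derivative_eq_intros)
    then have "((\<lambda>x. v ^ (d - 1) / uu (l, x, v)) has_field_derivative
        (\<delta> * (v ^ (d - 1) / uu (l, k, v))\<^sup>2)) (at k)"
      using u by (auto intro!: derivative_eq_intros simp: power2_eq_square)
    then have "((\<lambda>x. kk (l, x, v)) has_field_derivative \<delta> * k1\<^sup>2) (at k)"
      by (simp add: kk_def k1_def)
    then show ?thesis using dKk DERIV_unique by blast
  qed
  \<comment> \<open>As in Cramer's rule, \<open>Fk\<close> cancels between \<open>eq1\<close> and
    \<open>eq2\<close>, leaving Fv times the Jacobian determinant of (k, v) \<mapsto> (k1, v k1),
    which is Kk k1 = \<delta> k1^3.\<close>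
  have X: "of_nat d * w ^ (d - 1) * (Kk * fv - Kv * fk) = \<delta> * k1 ^ 3 * Fv"
  proof -
    have "D * (Kk * fv - Kv * fk) = Kk * (D * fv) - Kv * (D * fk)"
      by (simp add: algebra_simps)
    also have "\<dots> = Kk * k1 * Fv"
      by (simp add: eq1[symmetric] eq2[symmetric] algebra_simps)
    finally show ?thesis
      by (simp add: D_def Kk power2_eq_square power3_eq_cube mult_ac)
  qed
  have wd: "w ^ (d - 1) * w = w ^ d" using d by (simp add: power_Suc2[symmetric] del: power_Suc)
  let ?E1 = "exp (- 3 * gg (c * l, k1, v * k1))" and ?E = "exp (- 3 * gg (l, k, v))"
  have cube: "exp (- 3 * x) = exp (- x) ^ 3" for x :: complex
    by (simp add: exp_of_nat_mult[symmetric])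
  have E1: "?E1 * (v * k1) ^ 3 = (w ^ (d - 1) * w) ^ 3"
    unfolding cube wd fz'[symmetric] ff_def by (simp add: power_mult_distrib mult_ac)
  have E: "?E * v ^ 3 = w ^ 3"
    unfolding cube fz[symmetric] ff_def by (simp add: power_mult_distrib mult_ac)
  have "v \<noteq> 0" "k1 \<noteq> 0" using fz' w by (auto simp: ff_def)
  then have "?E1 / Fv * (Kk + Kv * (- fk / fv)) = \<delta> / of_nat d * (w ^ (d - 1))\<^sup>2 * (?E / fv)"
    using d w nz by (intro level_curve_identity[OF E1 E X]) auto
  then have "GG (c * l, k1, w ^ d) * (Kk + Kv * V') = \<delta> / of_nat d * w ^ (2 * d - 2) * GG (l, k, w)"
  proof -
    have "GG (c * l, k1, w ^ d) = ?E1 / Fv" "GG (l, k, w) = ?E / fv"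
      by (simp_all add: GG_def step(2) Fv fv v_def)
    moreover have "(w ^ (d - 1))\<^sup>2 = w ^ (2 * d - 2)"
    proof -
      have "(d - 1) * 2 = 2 * d - 2" by simp
      then show ?thesis by (metis power_mult)
    qed
    moreover assume "?E1 / Fv * (Kk + Kv * (- fk / fv)) = \<delta> / of_nat d * (w ^ (d - 1))\<^sup>2 * (?E / fv)"
    ultimately show ?thesis by (simp only: V')
  qed
  then show ?thesis
    using DERIV_chain2[OF sig_deriv[OF step(1)[unfolded k1_def v_def]] dk1] by (simp add: k1_def v_def)
qed

text \<open>\<open>hh / w\<^sup>d\<^sup>+\<^sup>1\<close> is the value of \<open>s \<circ> H - (\<delta>/d) s\<close> on the level curve \<open>ff = w\<close>, computed at \<open>x = 0\<close>.\<close>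

definition hh :: "complex3 \<Rightarrow> complex" where
  "hh = (\<lambda>(l, k, w). exp (of_nat (d - 1) * gg (l, 0, vv (l, 0, w))) / uu (l, 0, vv (l, 0, w)) *
     sh (c * l, kk (l, 0, vv (l, 0, w)), w ^ d))"

text \<open>By \<open>sig_step_deriv\<close> the difference of the two \<open>sig\<close> terms has
  derivative 0 in k, so on the disc |k| < K it may be evaluated at k = 0. There \<open>sig\<close>
  vanishes, and v = w e^g turns the new k into w^(d-1) times a factor that is absorbed in
  \<open>hh\<close>.\<close>

lemma sig_step:
  assumes R1: "(l, k, w) \<in> R1" and w: "w \<noteq> 0"
  shows "sig (c * l, kk (l, k, vv (l, k, w)), w ^ d) =
    \<delta> / of_nat d * w ^ (2 * d - 2) * sig (l, k, w) + w ^ (d - 1) * hh (l, k, w)"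
proof -
  let ?\<phi> = "\<lambda>k. sig (c * l, kk (l, k, vv (l, k, w)), w ^ d) - \<delta> / of_nat d * w ^ (2 * d - 2) * sig (l, k, w)"
  have rw: "norm w < rho l" and k: "k \<in> ball 0 K" using R1 by (auto simp: mem_R1)
  have "(?\<phi> has_field_derivative 0) (at x within ball 0 K)" if "x \<in> ball 0 K" for x
  proof -
    have x: "(l, x, w) \<in> R1" using that rw by (simp add: mem_R1)
    from DERIV_diff[OF sig_step_deriv[OF x w] DERIV_cmult[OF sig_deriv[OF x], of "\<delta> / of_nat d * w ^ (2 * d - 2)"]]
    have "(?\<phi> has_field_derivative 0) (at x)" by simp
    then show ?thesis by (rule has_field_derivative_at_within)
  qed
  then obtain a where a: "\<And>x. x \<in> ball 0 K \<Longrightarrow> ?\<phi> x = a"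
    using has_field_derivative_zero_constant[OF convex_ball, of 0 K ?\<phi>] by blast
  have "?\<phi> k = ?\<phi> 0" using a[OF k] a[of 0] K_pos by simp
  also have "?\<phi> 0 = w ^ (d - 1) * hh (l, k, w)"
  proof -
    let ?v = "vv (l, 0, w)"
    have R: "(l, 0, w) \<in> R1" using rw K_pos by (simp add: mem_R1)
    have "?v * exp (- gg (l, 0, ?v)) = w" using vv_props(2)[OF R] by (simp add: ff_def)
    then have "?v = w * exp (gg (l, 0, ?v))" by (simp add: exp_minus field_simps)
    then have "?v ^ (d - 1) = w ^ (d - 1) * exp (of_nat (d - 1) * gg (l, 0, ?v))"
      by (metis exp_of_nat_mult power_mult_distrib)
    then show ?thesis
      by (simp add: sig_def hh_def kk_def)
  qed
  finally show ?thesis by (simp add: algebra_simps)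
qed

lemma R1_zero_k: "(l, k, w) \<in> R1 \<Longrightarrow> (l, 0, w) \<in> R1"
  using K_pos by (simp add: mem_R1)

lemma hol_hh: "hol hh R1"
proof -
  have R1: "(fst z, 0, snd (snd z)) \<in> R1" if "z \<in> R1" for z
    using R1_zero_k[of "fst z" "fst (snd z)"] that by simp
  let ?v = "\<lambda>z. vv (fst z, 0, snd (snd z))"
  have mem: "(fst z, 0, ?v z) \<in> R4" if "z \<in> R1" for z
    using vv_props(1)[OF R1[OF that]] region_sub by auto
  have mem1: "(c * fst z, kk (fst z, 0, ?v z), snd (snd z) ^ d) \<in> R1" if "z \<in> R1" for z
    using level_step(1)[OF R1[OF that]] .
  have hv: "hol ?v R1"
    using R1 by (intro hol_compose3[OF hol_vv] hol_intros open_region) auto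
  have "hol (\<lambda>z. exp (of_nat (d - 1) * gg (fst z, 0, ?v z)) / uu (fst z, 0, ?v z) *
     sh (c * fst z, kk (fst z, 0, ?v z), snd (snd z) ^ d)) R1"
    by (intro hol_divide hol_intros open_region hol_compose3[OF hol_gg] hol_compose3[OF hol_u]
        hol_compose3[OF hol_sh] hol_compose3[OF hol_kk] hv mem mem1 u_nz)
  then show ?thesis by (simp add: hh_def split_beta')
qed

lemma norm_hh:
  assumes "z \<in> R1"
  shows "norm (hh z) \<le> 3 * exp (real d)"
proof -
  obtain l k w where z: "z = (l, k, w)" by (metis prod.exhaust)
  have R1: "(l, 0, w) \<in> R1" using assms R1_zero_k z by auto
  let ?z = "(l, 0, vv (l, 0, w))"
  have R4: "?z \<in> R4" using vv_props(1)[OF R1] region_sub by auto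
  have "norm (of_nat (d - 1) * gg ?z) \<le> real d * 1"
    unfolding norm_mult using norm_gg[OF R4] by (intro mult_mono) auto
  then have e: "norm (exp (of_nat (d - 1) * gg ?z)) \<le> exp (real d)"
    by (intro order_trans[OF norm_exp]) simp
  have s: "norm (sh (c * l, kk ?z, w ^ d)) \<le> 5/4" using norm_sh level_step(1)[OF R1] by blast
  have "norm (hh z) \<le> exp (real d) / (1/2) * (5/4)"
    unfolding z hh_def prod.case norm_mult norm_divide
    using e s norm_u[OF R4] by (intro mult_mono frac_le) auto
  also have "\<dots> \<le> 3 * exp (real d)" by simp
  finally show ?thesis .
qed

text \<open>This value becomes the leading coefficient of every \<open>QQ l\<close>, so that the
  degree is d + 1 for all l.\<close>

lemma hh_0: "hh (l, k, 0) = 1"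
proof -
  have R: "(l, 0, 0) \<in> R1" for l using K_pos r_pos m by (simp add: mem_region)
  have v: "vv (l, 0, 0) = 0" for l using vv_props(3)[OF R, of l] by simp
  have K4: "norm (0::complex) < 4 * K" using K_pos by simp
  have dff: "dff (l, 0, 0) = 1" for l
  proof -
    have "(\<lambda>v. gg (l, 0, v)) holomorphic_on {v. (l, 0, v) \<in> R4}" "open {v. (l, 0, v) \<in> R4}"
      using hol_slices(3)[OF hol_gg] open_slice(3)[OF open_region] by auto
    then obtain g' where "((\<lambda>v. gg (l, 0, v)) has_field_derivative g') (at 0)"
      using holomorphic_derivI at_zero(1)[OF K4] by blast
    then have "((\<lambda>v. ff (l, 0, v)) has_field_derivative 1) (at 0)"
      unfolding ff_def using at_zero(4)[OF K4] by (auto intro!: derivative_eq_intros)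
    then show ?thesis by (simp add: dff_def DERIV_imp_deriv)
  qed
  have "GG (l, 0, 0) = 1" for l
    by (simp add: GG_def v dff at_zero(4)[OF K4])
  then show ?thesis
    using d by (simp add: hh_def v at_zero[OF K4] sh_def power_0_left)
qed

end

section \<open>Laurent expansion on the level curves: the polynomial Q and the removal of the
  negative powers of t\<close>

text \<open>From n + d^n \<le> d^(n+1), each term is at most \<beta> \<omega>^n times the previous
  one, and this factor is eventually below 1/2.\<close>

lemma summable_superexponential:
  fixes \<beta> \<omega> :: real
  assumes "0 \<le> \<beta>" "0 \<le> \<omega>" "\<omega> < 1" "d \<ge> (2::nat)"
  shows "summable (\<lambda>n. \<beta> ^ n * \<omega> ^ (d ^ n))"
proof -
  have "(\<lambda>n. \<beta> * \<omega> ^ n) \<longlonglongrightarrow> \<beta> * 0"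
    using assms by (intro tendsto_mult tendsto_const LIMSEQ_power_zero) auto
  then have "eventually (\<lambda>n. \<beta> * \<omega> ^ n < 1/2) sequentially"
    using order_tendstoD(2)[of "\<lambda>n. \<beta> * \<omega> ^ n" 0 sequentially "1/2"] by simp
  then obtain N where N: "\<And>n. n \<ge> N \<Longrightarrow> \<beta> * \<omega> ^ n < 1/2"
    by (auto simp: eventually_sequentially)
  show ?thesis
  proof (rule summable_ratio_test[of "1/2" N])
    fix n assume n: "n \<ge> N"
    have "n + d ^ n \<le> d ^ Suc n"
    proof -
      have "n < d ^ n" using assms(4) by (metis less_exp less_le_trans power_mono zero_le)
      moreover have "2 * d ^ n \<le> d * d ^ n" using assms(4) by (intro mult_right_mono) auto
      moreover have "d ^ Suc n = d * d ^ n" by simp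
      ultimately show ?thesis by linarith
    qed
    then have "\<omega> ^ (d ^ Suc n) \<le> \<omega> ^ (n + d ^ n)"
      using assms by (intro power_decreasing) auto
    then have "\<beta> ^ Suc n * \<omega> ^ (d ^ Suc n) \<le> \<beta> ^ Suc n * \<omega> ^ (n + d ^ n)"
      using assms by (intro mult_left_mono) auto
    also have "\<dots> = (\<beta> * \<omega> ^ n) * (\<beta> ^ n * \<omega> ^ (d ^ n))"
      by (simp add: power_add)
    also have "\<dots> \<le> 1/2 * (\<beta> ^ n * \<omega> ^ (d ^ n))"
      using N[OF n] assms by (intro mult_right_mono) auto
    finally show "norm (\<beta> ^ Suc n * \<omega> ^ (d ^ Suc n)) \<le> 1/2 * norm (\<beta> ^ n * \<omega> ^ (d ^ n))"
      using assms by simp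
  qed simp
qed

text \<open>The affine map a \<mapsto> a/2 + \<eta>/4 has the fixed point \<eta>/2, to which the
  upper bound converges geometrically.\<close>

lemma contraction_eventually_small:
  fixes a :: "nat \<Rightarrow> real"
  assumes step: "\<And>n. n \<ge> N \<Longrightarrow> a (Suc n) \<le> 1/2 * a n + \<eta> / 4" and \<eta>: "\<eta> > 0"
  shows "\<exists>n\<ge>N. a n < \<eta>"
proof -
  have bound: "a (N + i) \<le> \<eta> / 2 + (1/2) ^ i * \<bar>a N\<bar>" for i
  proof (induction i)
    case 0
    then show ?case using \<eta> by simp
  next
    case (Suc i)
    then show ?case using step[of "N + i"] by simp
  qed
  have "(\<lambda>i. (1/2) ^ i * \<bar>a N\<bar>) \<longlonglongrightarrow> 0 * \<bar>a N\<bar>"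
    by (intro tendsto_mult tendsto_const LIMSEQ_power_zero) auto
  then have "eventually (\<lambda>i. (1/2) ^ i * \<bar>a N\<bar> < \<eta> / 2) sequentially"
    using \<eta> by (intro order_tendstoD(2)) auto
  then obtain i where "(1/2) ^ i * \<bar>a N\<bar> < \<eta> / 2"
    by (auto simp: eventually_sequentially)
  then show ?thesis using bound[of i] by (intro exI[of _ "N + i"]) auto
qed

text \<open>The quotient (h(w) - h(0)) / w as the integral of h'(u w) over u, so that w = 0 needs no
  separate treatment and holomorphy follows from \<open>hol_integral\<close>.\<close>

definition divided_difference :: "(complex3 \<Rightarrow> complex) \<Rightarrow> complex3 \<Rightarrow> complex" where
  "divided_difference h z = integral {0..1} (\<lambda>u::real.
     (\<lambda>(l, k, w). deriv (\<lambda>x. h (l, k, x)) w) (fst z, fst (snd z), of_real u * snd (snd z)))"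

context henon_normal
begin

lemma scaled_w_in_R1:
  assumes "z \<in> R1" "u \<in> {0..1::real}"
  shows "(fst z, fst (snd z), of_real u * snd (snd z)) \<in> R1"
proof (rule region_shrink)
  show z: "(fst z, fst (snd z), snd (snd z)) \<in> R1" using assms by simp
  show "norm (fst (snd z)) < K" using z unfolding mem_region by blast
  show "norm (of_real u * snd (snd z)) \<le> norm (snd (snd z))"
    using assms(2) by (auto simp: norm_mult intro!: mult_left_le_one_le)
qed

lemma hol_divided_difference:
  assumes "hol h R1"
  shows "hol (divided_difference h) R1"
  unfolding divided_difference_def
proof (rule hol_integral[OF open_region])
  let ?D = "\<lambda>(l, k, w). deriv (\<lambda>x. h (l, k, x)) w"
  have D: "hol ?D R1" using hol_deriv3[OF assms] .
  show "continuous_on (R1 \<times> {0..1}) (\<lambda>(z, u). ?D (fst z, fst (snd z), of_real u * snd (snd z)))"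
    unfolding split_beta[of _ "_ :: complex3 \<times> real"]
    by (intro continuous_on_compose2[OF hol_imp_continuous_on[OF D]] continuous_intros)
      (use scaled_w_in_R1 in auto)
  show "hol (\<lambda>z. ?D (fst z, fst (snd z), of_real u * snd (snd z))) R1" if "u \<in> {0..1}" for u
    using scaled_w_in_R1 that by (intro hol_compose3[OF D] hol_intros open_region) auto
qed

lemma divided_difference_slice:
  assumes "hol h R1" "norm k < K"
  shows "(\<lambda>x. h (l, k, x)) holomorphic_on ball 0 (rho l)"
proof -
  have "{x. (l, k, x) \<in> R1} = ball 0 (rho l)" using assms(2) by (auto simp: mem_R1)
  then show ?thesis using hol_slices(3)[OF assms(1), of l k] by simp
qed

lemma divided_difference_eq:
  assumes h: "hol h R1" and z: "(l, k, w) \<in> R1"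
  shows "h (l, k, w) = h (l, k, 0) + w * divided_difference h (l, k, w)"
proof -
  have k: "norm k < K" and w: "w \<in> ball 0 (rho l)" using z by (auto simp: mem_R1)
  have s: "(\<lambda>x. h (l, k, x)) holomorphic_on ball 0 (rho l)"
    by (rule divided_difference_slice[OF h k])
  have "w * integral {0..1} (\<lambda>u. deriv (\<lambda>x. h (l, k, x)) (of_real u * w)) = h (l, k, w) - h (l, k, 0)"
    using holomorphic_derivI[OF s open_ball]
    by (intro radial_primitive[OF holomorphic_deriv[OF s open_ball] w]) blast
  then show ?thesis by (simp add: divided_difference_def)
qed

text \<open>For |w| < rho/2 Cauchy's estimate applies on discs of radius rho/2 around the points u
  w; for larger |w| the quotient itself is at most 2 M / (rho/2), the source of the 4. The bound
  \<open>M\<close> belongs to one fibre l, and 1 / rho l is kept explicit because the estimate is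
  later used along l, c l, c^2 l and so on.\<close>

lemma norm_divided_difference:
  assumes h: "hol h R1" and B: "\<And>k w. (l, k, w) \<in> R1 \<Longrightarrow> norm (h (l, k, w)) \<le> M" and z: "(l, k, w) \<in> R1"
  shows "norm (divided_difference h (l, k, w)) \<le> 4 / rho l * M"
proof -
  have k: "norm k < K" and w: "norm w < rho l" using z by (auto simp: mem_R1)
  have s: "(\<lambda>x. h (l, k, x)) holomorphic_on ball 0 (rho l)"
    by (rule divided_difference_slice[OF h k])
  have B': "norm (h (l, k, x)) \<le> M" if "x \<in> ball 0 (rho l)" for x
    using that k by (intro B) (simp add: mem_R1)
  have M: "M \<ge> 0" using B[OF z] norm_ge_zero order_trans by blast
  show ?thesis
  proof (cases "norm w < rho l / 2")
    case True
    have "norm (divided_difference h (l, k, w)) \<le> M / (rho l / 2)"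
      unfolding divided_difference_def fst_conv snd_conv prod.case
    proof (rule norm_integral_unit_le)
      fix u :: real assume u: "u \<in> {0..1}"
      have uw: "norm (of_real u * w) \<le> norm w"
        using u by (auto simp: norm_mult intro!: mult_left_le_one_le)
      show "norm (deriv (\<lambda>x. h (l, k, x)) (of_real u * w)) \<le> M / (rho l / 2)"
      proof (rule Cauchy_deriv_bound[OF s open_ball _ _ B'])
        show "cball (of_real u * w) (rho l / 2) \<subseteq> ball 0 (rho l)"
        proof
          fix x assume "x \<in> cball (of_real u * w) (rho l / 2)"
          then have "norm (x - of_real u * w) \<le> rho l / 2" by (simp add: dist_norm norm_minus_commute)
          then show "x \<in> ball 0 (rho l)"
            using norm_triangle_sub[of x "of_real u * w"] uw True by simp
        qed
      qed (use rho_pos[of l] in auto)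
    next
      have "deriv (\<lambda>x. h (l, k, x)) holomorphic_on ball 0 (rho l)"
        using s by (intro holomorphic_deriv) auto
      then have "continuous_on (ball 0 (rho l)) (deriv (\<lambda>x. h (l, k, x)))"
        by (rule holomorphic_on_imp_continuous_on)
      then show "continuous_on {0..1} (\<lambda>u. deriv (\<lambda>x. h (l, k, x)) (of_real u * w))"
      proof (rule continuous_on_compose2)
        show "(\<lambda>u. of_real u * w) ` {0..1} \<subseteq> ball 0 (rho l)"
        proof clarify
          fix u :: real assume "u \<in> {0..1}"
          then have "norm (of_real u * w) \<le> norm w"
            by (auto simp: norm_mult intro!: mult_left_le_one_le)
          then show "of_real u * w \<in> ball 0 (rho l)" using w by simp
        qed
      qed (intro continuous_intros)
    qed
    also have "\<dots> \<le> 4 / rho l * M" using M rho_pos[of l] by (simp add: field_simps)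
    finally show ?thesis .
  next
    case False
    then have w0: "norm w > 0" "w \<noteq> 0" using rho_pos[of l] by auto
    have "w * divided_difference h (l, k, w) = h (l, k, w) - h (l, k, 0)"
      using divided_difference_eq[OF h z] by simp
    then have "norm w * norm (divided_difference h (l, k, w)) \<le> 2 * M"
      using norm_triangle_ineq4[of "h (l, k, w)" "h (l, k, 0)"] B'[of w] B'[of 0] w rho_pos[of l]
      by (simp add: norm_mult[symmetric])
    then have "norm (divided_difference h (l, k, w)) \<le> 2 * M / norm w"
      using w0 by (simp add: field_simps)
    also have "\<dots> \<le> 2 * M / (rho l / 2)"
      using False M rho_pos[of l] w0 by (intro divide_left_mono mult_pos_pos) auto
    finally show ?thesis by simp
  qed
qed

text \<open>At w = 0 this is the n-th Taylor coefficient of \<open>hh\<close> in w; in general it is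
  the n-th Taylor remainder divided by w^n (\<open>hh_expansion\<close>).\<close>

definition Hn :: "nat \<Rightarrow> complex3 \<Rightarrow> complex" where
  "Hn n = (divided_difference ^^ n) hh"

lemma hol_Hn: "hol (Hn n) R1"
  unfolding Hn_def by (induction n) (auto intro: hol_hh hol_divided_difference)

lemma norm_Hn:
  assumes "(l, k, w) \<in> R1"
  shows "norm (Hn n (l, k, w)) \<le> (4 / rho l) ^ n * (3 * exp (real d))"
  using assms
proof (induction n arbitrary: k w)
  case 0
  then show ?case using norm_hh by (simp add: Hn_def)
next
  case (Suc n)
  then show ?case
    using norm_divided_difference[OF hol_Hn[of n], of l "(4 / rho l) ^ n * (3 * exp (real d))"]
    by (simp add: Hn_def mult_ac)
qed

lemma Hn_0: "Hn 0 (l, k, 0) = 1"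
  by (simp add: Hn_def hh_0)

lemma zero_in_R1: "(l, 0, 0) \<in> R1"
  using K_pos r_pos m by (simp add: mem_region)

lemma hh_expansion:
  assumes "(l, k, w) \<in> R1"
  shows "hh (l, k, w) = (\<Sum>i<n. Hn i (l, 0, 0) * w ^ i) + w ^ n * Hn n (l, 0, w)"
proof (induction n)
  case 0
  show ?case by (simp add: Hn_def hh_def)
next
  case (Suc n)
  have "Hn n (l, 0, w) = Hn n (l, 0, 0) + w * Hn (Suc n) (l, 0, w)"
    using divided_difference_eq[OF hol_Hn R1_zero_k[OF assms]] by (simp add: Hn_def)
  then show ?case using Suc by (simp add: algebra_simps)
qed

text \<open>The part of \<open>hh\<close> / w^(d+1) with nonnegative powers of t = 1/w. Running up
  to d + 1 puts the constant term into the polynomial, so that the rest, w times \<open>Hn\<close>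
  (d + 2), has a factor w; this factor yields the decay in the series \<open>g2\<close>.\<close>

definition QQ :: "complex \<Rightarrow> complex poly" where
  "QQ l = (\<Sum>i\<le>d + 1. monom (Hn i (l, 0, 0)) (d + 1 - i))"

lemma poly_QQ: "poly (QQ l) t = (\<Sum>i\<le>d + 1. Hn i (l, 0, 0) * t ^ (d + 1 - i))"
  by (simp add: QQ_def poly_sum poly_monom)

lemma degree_QQ: "degree (QQ l) = d + 1"
proof (rule antisym)
  show "degree (QQ l) \<le> d + 1"
    unfolding QQ_def by (intro degree_sum_le) (auto intro: order_trans[OF degree_monom_le])
  have "coeff (QQ l) (d + 1) = (\<Sum>i\<le>d + 1. if i = 0 then Hn 0 (l, 0, 0) else 0)"
    unfolding QQ_def coeff_sum by (intro sum.cong) auto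
  also have "\<dots> = 1" by (simp add: Hn_0)
  finally show "d + 1 \<le> degree (QQ l)" by (intro le_degree) simp
qed

lemma hol_QQ: "hol (\<lambda>(l, s, t). poly (QQ l) t) UNIV"
proof -
  have "hol (\<lambda>z. \<Sum>i\<le>d + 1. Hn i (fst z, 0, 0) * snd (snd z) ^ (d + 1 - i)) UNIV"
    using zero_in_R1 by (intro hol_intros hol_compose3[OF hol_Hn] open_UNIV) auto
  then show ?thesis by (simp add: poly_QQ split_beta')
qed

lemma hh_QQ:
  assumes "(l, k, w) \<in> R1" "w \<noteq> 0"
  shows "hh (l, k, w) / w ^ (d + 1) = poly (QQ l) (1 / w) + w * Hn (d + 2) (l, 0, w)"
proof -
  have "hh (l, k, w) = (\<Sum>i\<le>d + 1. Hn i (l, 0, 0) * w ^ i) + w ^ (d + 2) * Hn (d + 2) (l, 0, w)"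
    using hh_expansion[OF assms(1), of "d + 2"] by (simp add: lessThan_Suc_atMost)
  then have "hh (l, k, w) / w ^ (d + 1) =
      (\<Sum>i\<le>d + 1. Hn i (l, 0, 0) * w ^ i / w ^ (d + 1)) + w * Hn (d + 2) (l, 0, w)"
    using assms(2) by (simp add: add_divide_distrib sum_divide_distrib)
  also have "(\<Sum>i\<le>d + 1. Hn i (l, 0, 0) * w ^ i / w ^ (d + 1)) = poly (QQ l) (1 / w)"
    unfolding poly_QQ
  proof (rule sum.cong)
    fix i assume "i \<in> {..d + 1}"
    then have "w ^ (d + 1) = w ^ i * w ^ (d + 1 - i)" by (simp add: power_add[symmetric])
    then show "Hn i (l, 0, 0) * w ^ i / w ^ (d + 1) = Hn i (l, 0, 0) * (1 / w) ^ (d + 1 - i)"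
      using assms(2) by (simp add: power_one_over field_simps)
  qed simp
  finally show ?thesis .
qed

lemma iterate_in_R1:
  assumes "(l, k, w) \<in> R1"
  shows "(c ^ n * l, 0, w ^ (d ^ n)) \<in> R1"
proof (induction n)
  case 0
  then show ?case using R1_zero_k[OF assms] by simp
next
  case (Suc n)
  have "(c * (c ^ n * l), 0, (w ^ (d ^ n)) ^ d) \<in> R1"
    using power_d_in_R1[OF Suc, of 0] K_pos by simp
  then show ?case by (simp add: power_mult[symmetric] mult.assoc mult.commute[of _ d])
qed

text \<open>The n-th term from solving g = (d/\<delta>) (\<psi> + g \<circ> F) by iteration, where
  \<psi> = w Hn (d + 2) (l, 0, w) is the negative part and F sends (l, w) to (c l, w^d).\<close>

definition gterm :: "nat \<Rightarrow> complex3 \<Rightarrow> complex" where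
  "gterm n = (\<lambda>(l, k, w). (of_nat d / \<delta>) ^ (n + 1) * (w ^ (d ^ n) * Hn (d + 2) (c ^ n * l, 0, w ^ (d ^ n))))"

lemma hol_gterm: "hol (gterm n) R1"
proof -
  have "hol (\<lambda>z. (of_nat d / \<delta>) ^ (n + 1) *
      (snd (snd z) ^ (d ^ n) * Hn (d + 2) (c ^ n * fst z, 0, snd (snd z) ^ (d ^ n)))) R1"
    using iterate_in_R1 by (intro hol_intros open_region hol_compose3[OF hol_Hn]) (auto simp: split_paired_all)
  then show ?thesis by (simp add: gterm_def split_beta')
qed

lemma inverse_rho: "1 / rho l \<le> 1 / r + norm l ^ m / K"
  using r_pos K_pos by (auto simp: rho_def min_def)

text \<open>1 / rho (c^n l) grows at most like |c|^(n m), so the bound of \<open>norm_Hn\<close>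
  with exponent d + 2 grows exponentially in n; |w| \<le> 1/8 supplies the factor (1/8)^(d^n), which
  wins.\<close>

lemma norm_gterm:
  assumes z: "(l, k, w) \<in> R1" and L: "norm l \<le> L"
  shows "norm (gterm n (l, k, w)) \<le> norm (of_nat d / \<delta>) * (4 * (1 / r + L ^ m / K)) ^ (d + 2) * (3 * exp (real d)) *
    ((norm (of_nat d / \<delta>) * norm c ^ (m * (d + 2))) ^ n * (1/8) ^ (d ^ n))"
proof -
  let ?q = "norm (of_nat d / \<delta>)" and ?C = "4 * (1 / r + L ^ m / K)"
  have w: "norm w \<le> 1/8" using z r_small by (simp add: mem_region)
  have c1: "1 \<le> norm c ^ (n * m)" using c by (simp add: one_le_power)
  have L0: "0 \<le> L" using L norm_ge_zero order_trans by blast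
  have "1 / rho (c ^ n * l) \<le> 1 / r + norm (c ^ n * l) ^ m / K"
    by (rule inverse_rho)
  also have "norm (c ^ n * l) ^ m = norm c ^ (n * m) * norm l ^ m"
    by (simp add: norm_mult norm_power power_mult_distrib power_mult)
  also have "1 / r + norm c ^ (n * m) * norm l ^ m / K \<le> norm c ^ (n * m) * (1 / r) + norm c ^ (n * m) * (L ^ m / K)"
  proof (rule add_mono)
    show "1 / r \<le> norm c ^ (n * m) * (1 / r)"
      using mult_right_mono[OF c1, of "1 / r"] r_pos by simp
    have "norm l ^ m \<le> L ^ m" using L by (intro power_mono) auto
    then have "norm c ^ (n * m) * norm l ^ m \<le> norm c ^ (n * m) * L ^ m"
      by (intro mult_left_mono) auto
    then show "norm c ^ (n * m) * norm l ^ m / K \<le> norm c ^ (n * m) * (L ^ m / K)"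
      using K_pos by (simp add: divide_right_mono)
  qed
  finally have "4 * (1 / rho (c ^ n * l)) \<le> 4 * (norm c ^ (n * m) * (1 / r) + norm c ^ (n * m) * (L ^ m / K))"
    by (intro mult_left_mono) auto
  then have "4 / rho (c ^ n * l) \<le> norm c ^ (n * m) * ?C"
    by (simp add: algebra_simps)
  then have "(4 / rho (c ^ n * l)) ^ (d + 2) \<le> (norm c ^ (n * m) * ?C) ^ (d + 2)"
    using rho_pos[of "c ^ n * l"] by (intro power_mono) auto
  also have "\<dots> = (norm c ^ (m * (d + 2))) ^ n * ?C ^ (d + 2)"
  proof -
    have "n * m * (d + 2) = m * (d + 2) * n" by (simp only: mult_ac)
    then show ?thesis by (simp only: power_mult_distrib power_mult[symmetric])
  qed
  finally have "(4 / rho (c ^ n * l)) ^ (d + 2) \<le> (norm c ^ (m * (d + 2))) ^ n * ?C ^ (d + 2)" .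
  then have H: "norm (Hn (d + 2) (c ^ n * l, 0, w ^ (d ^ n))) \<le>
      (norm c ^ (m * (d + 2))) ^ n * ?C ^ (d + 2) * (3 * exp (real d))"
    by (intro order_trans[OF norm_Hn[OF iterate_in_R1[OF z]]] mult_right_mono) auto
  have "norm w ^ (d ^ n) \<le> (1/8) ^ (d ^ n)" using w by (intro power_mono) auto
  then have "norm (gterm n (l, k, w)) \<le> ?q ^ (n + 1) * ((1/8) ^ (d ^ n) *
      ((norm c ^ (m * (d + 2))) ^ n * ?C ^ (d + 2) * (3 * exp (real d))))"
    unfolding gterm_def prod.case norm_mult norm_power using H
    by (intro mult_mono mult_left_mono) auto
  also have "\<dots> = ?q * ?C ^ (d + 2) * (3 * exp (real d)) * ((?q * norm c ^ (m * (d + 2))) ^ n * (1/8) ^ (d ^ n))"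
    by (simp add: power_mult_distrib mult_ac)
  finally show ?thesis .
qed

lemma gterm_bound_summable:
  "summable (\<lambda>n. A * ((norm (of_nat d / \<delta>) * norm c ^ (m * (d + 2))) ^ n * (1/8 :: real) ^ (d ^ n)))"
  using d by (intro summable_mult summable_superexponential) auto

text \<open>The correction of \<open>s\<close> that cancels the terms of negative degree in \<open>t = 1/w\<close>.\<close>

definition g2 :: "complex3 \<Rightarrow> complex" where
  "g2 z = (\<Sum>n. gterm n z)"

lemma gterm_summable: "(l, k, w) \<in> R1 \<Longrightarrow> summable (\<lambda>n. gterm n (l, k, w))"
  by (rule summable_comparison_test'[OF gterm_bound_summable norm_gterm[OF _ order_refl]])

lemma hol_g2: "hol g2 R1"
proof (rule hol_local[OF open_region])
  fix z assume z: "z \<in> R1"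
  \<comment> \<open>The bound of the terms depends on |l|, so uniform summability holds near each
    point only, where |l| < L.\<close>
  define L where "L = norm (fst z) + 1"
  let ?N = "R1 \<inter> {z. norm (fst z) < L}"
  have N: "open ?N" by (intro open_Int open_region open_Collect_less continuous_intros)
  have "hol g2 ?N"
    unfolding g2_def
  proof (rule hol_suminf[OF N])
    show "hol (gterm n) ?N" for n by (rule hol_subset[OF hol_gterm N]) auto
    show "norm (gterm n y) \<le> norm (of_nat d / \<delta>) * (4 * (1 / r + L ^ m / K)) ^ (d + 2) * (3 * exp (real d)) *
      ((norm (of_nat d / \<delta>) * norm c ^ (m * (d + 2))) ^ n * (1/8) ^ (d ^ n))" if "y \<in> ?N" for n y
      using norm_gterm[of "fst y" "fst (snd y)" "snd (snd y)" L n] that by simp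
  qed (rule gterm_bound_summable)
  then show "\<exists>N. z \<in> N \<and> hol g2 N"
    using z by (intro exI[of _ ?N]) (auto simp: L_def)
qed

lemma g2_step:
  assumes z: "(l, k, w) \<in> R1"
  shows "g2 (c * l, k', w ^ d) = \<delta> / of_nat d * g2 (l, k, w) - w * Hn (d + 2) (l, 0, w)"
proof -
  let ?q = "of_nat d / \<delta>"
  have q: "?q \<noteq> 0" using d \<delta> by simp
  have gS: "gterm (Suc n) (l, k, w) = ?q * gterm n (c * l, k', w ^ d)" for n
    by (simp add: gterm_def power_mult[symmetric] mult_ac)
  have "g2 (l, k, w) = gterm 0 (l, k, w) + (\<Sum>n. gterm (Suc n) (l, k, w))"
    unfolding g2_def using suminf_split_head[OF gterm_summable[OF z]] by simp
  also have "gterm 0 (l, k, w) = ?q * (w * Hn (d + 2) (l, 0, w))"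
    by (simp add: gterm_def)
  also have "(\<Sum>n. gterm (Suc n) (l, k, w)) = (\<Sum>n. ?q * gterm n (c * l, k', w ^ d))"
    by (simp only: gS)
  also have "(\<Sum>n. ?q * gterm n (c * l, k', w ^ d)) = ?q * g2 (c * l, k', w ^ d)"
  proof -
    have "summable (\<lambda>n. ?q * gterm n (c * l, k', w ^ d))"
      unfolding gS[symmetric]
      using gterm_summable[OF z] summable_Suc_iff[of "\<lambda>n. gterm n (l, k, w)"] by simp
    then have "summable (\<lambda>n. gterm n (c * l, k', w ^ d))" using q summable_cmult_iff by blast
    then show ?thesis unfolding g2_def by (rule suminf_mult)
  qed
  finally have *: "g2 (l, k, w) = ?q * (w * Hn (d + 2) (l, 0, w)) + ?q * g2 (c * l, k', w ^ d)" .
  have "\<delta> / of_nat d * g2 (l, k, w) = (\<delta> / of_nat d * ?q) * (w * Hn (d + 2) (l, 0, w) + g2 (c * l, k', w ^ d))"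
    unfolding * by (simp only: distrib_left mult.assoc)
  also have "\<delta> / of_nat d * ?q = 1" using d \<delta> by simp
  finally show ?thesis by simp
qed

definition ss :: "complex3 \<Rightarrow> complex" where
  "ss z = sig z / snd (snd z) ^ 2 + g2 z"

lemma g2_indep: "g2 (l, k, w) = g2 (l, k', w)"
  by (simp add: g2_def gterm_def)

lemma square_power_d: "(w ^ d)\<^sup>2 = w ^ (2 * d - 2) * w\<^sup>2" "(w ^ d)\<^sup>2 = w ^ (d - 1) * w ^ (d + 1)"
  for w :: complex
proof -
  have "d * 2 = (2 * d - 2) + 2" "d * 2 = (d - 1) + (d + 1)" using d by simp_all
  then show "(w ^ d)\<^sup>2 = w ^ (2 * d - 2) * w\<^sup>2" "(w ^ d)\<^sup>2 = w ^ (d - 1) * w ^ (d + 1)"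
    by (metis power_add power_mult)+
qed

text \<open>Dividing \<open>sig_step\<close> by w^(2d) gives \<delta>/d times the uncorrected s plus
  \<open>hh\<close> / w^(d+1), and the negative part of the latter cancels against
  \<open>g2_step\<close>.\<close>

lemma ss_step:
  assumes R1: "(l, k, w) \<in> R1" and w: "w \<noteq> 0"
  shows "ss (c * l, kk (l, k, vv (l, k, w)), w ^ d) = \<delta> / of_nat d * ss (l, k, w) + poly (QQ l) (1 / w)"
proof -
  let ?k = "kk (l, k, vv (l, k, w))"
  note p = square_power_d[of w]
  have "sig (c * l, ?k, w ^ d) / (w ^ d)\<^sup>2 =
      \<delta> / of_nat d * w ^ (2 * d - 2) * sig (l, k, w) / (w ^ d)\<^sup>2 + w ^ (d - 1) * hh (l, k, w) / (w ^ d)\<^sup>2"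
    by (simp only: sig_step[OF R1 w] add_divide_distrib)
  also have "\<delta> / of_nat d * w ^ (2 * d - 2) * sig (l, k, w) / (w ^ d)\<^sup>2 = \<delta> / of_nat d * (sig (l, k, w) / w\<^sup>2)"
    unfolding p(1) using w by simp
  also have "w ^ (d - 1) * hh (l, k, w) / (w ^ d)\<^sup>2 = hh (l, k, w) / w ^ (d + 1)"
    unfolding p(2) using w by simp
  finally show ?thesis
    unfolding ss_def snd_conv g2_step[OF R1] hh_QQ[OF R1 w] by (simp add: algebra_simps)
qed

text \<open>Although s may grow along an orbit, \<sigma> = w^2 (s - g2) obeys a recurrence with
  coefficients of order w^(2d-2) and w^(d-1), so it becomes small, and sig (l, k, w) = \<sigma> can
  be solved with a small k. The number \<open>e\<close> is arbitrary so that the point reached can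
  be placed in \<open>V_plus\<close> for every large R.\<close>

lemma absorption:
  assumes t: "norm t > 1" and e: "e > 0"
  shows "\<exists>n k w. norm k < e \<and> w \<noteq> 0 \<and> norm w < e \<and> norm w * norm (c ^ n * l) ^ m < e \<and> (c ^ n * l, k, w) \<in> R1 \<and>
    (model_map d c \<delta> QQ ^^ n) (l, s, t) = (c ^ n * l, ss (c ^ n * l, k, w), 1 / w)"
proof -
  define F where "F = model_map d c \<delta> QQ"
  define sn where "sn n = fst (snd ((F ^^ n) (l, s, t)))" for n
  define w where "w n = (1 / t) ^ (d ^ n)" for n
  have t0: "t \<noteq> 0" using t by auto
  have w0: "w n \<noteq> 0" for n using t0 by (simp add: w_def)
  have wS: "w (Suc n) = w n ^ d" for n by (simp add: w_def power_mult[symmetric] mult.commute)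
  have F: "(F ^^ n) (l, s, t) = (c ^ n * l, sn n, 1 / w n)" for n
  proof (induction n)
    case 0
    then show ?case by (simp add: sn_def w_def)
  next
    case (Suc n)
    have *: "(F ^^ Suc n) (l, s, t) = (c * (c ^ n * l), \<delta> / of_nat d * sn n + poly (QQ (c ^ n * l)) (1 / w n), (1 / w n) ^ d)"
      by (simp add: Suc, simp add: F_def model_map_def)
    then have "sn (Suc n) = \<delta> / of_nat d * sn n + poly (QQ (c ^ n * l)) (1 / w n)"
      unfolding sn_def[of "Suc n"] by simp
    then show ?case unfolding * by (simp add: wS power_one_over mult.assoc)
  qed
  have snS: "sn (Suc n) = \<delta> / of_nat d * sn n + poly (QQ (c ^ n * l)) (1 / w n)" for n
  proof -
    have "(F ^^ Suc n) (l, s, t) = F (c ^ n * l, sn n, 1 / w n)" by (simp add: F)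
    then show ?thesis unfolding sn_def[of "Suc n"] by (simp add: F_def model_map_def)
  qed
  have om: "norm (1 / t) < 1" using t by (simp add: norm_divide divide_less_eq)
  have lim: "(\<lambda>n. A * (\<beta> ^ n * norm (w n))) \<longlonglongrightarrow> 0" if "\<beta> \<ge> 0" for A \<beta> :: real
  proof -
    have "summable (\<lambda>n. \<beta> ^ n * norm (1 / t) ^ (d ^ n))"
      using that om d by (intro summable_superexponential) auto
    then show ?thesis
      using tendsto_mult[OF tendsto_const summable_LIMSEQ_zero, of _ A] by (simp add: w_def norm_power)
  qed
  \<comment> \<open>The solution will have |k| \<le> 4/3 |\<sigma>| with |\<sigma>| < \<eta>; half
    of the minimum keeps this below e and below K.\<close>
  define \<eta> where "\<eta> = min e K / 2"
  have \<eta>: "\<eta> > 0" "\<eta> \<le> e / 2" "\<eta> \<le> K / 2" using e K_pos by (simp_all add: \<eta>_def)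
  \<comment> \<open>Smallness of w for five purposes: the target size e, the region, powers that
    decrease, a factor of at most 1/2 before \<sigma>, and a contribution of at most \<eta>/4 from
    \<open>hh\<close>.\<close>
  define \<mu> where "\<mu> = min (min e r) (min 1 (min (1 / (2 * (norm (\<delta> / of_nat d) + 1))) (\<eta> / 4 / (3 * exp (real d)))))"
  have dp: "norm (\<delta> / of_nat d) + 1 > 0" by (simp add: add_nonneg_pos)
  have \<mu>: "\<mu> > 0" using e r_pos \<eta> dp by (simp add: \<mu>_def)
  have ev1: "eventually (\<lambda>n. norm (w n) < \<mu>) sequentially"
    using order_tendstoD(2)[OF lim[of 1 1] \<mu>] by simp
  have ev2: "eventually (\<lambda>n. norm l ^ m * ((norm c ^ m) ^ n * norm (w n)) < min e K) sequentially"
    using e K_pos by (intro order_tendstoD(2)[OF lim]) auto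
  obtain N where N: "\<And>n. n \<ge> N \<Longrightarrow> norm (w n) < \<mu>"
    "\<And>n. n \<ge> N \<Longrightarrow> norm l ^ m * ((norm c ^ m) ^ n * norm (w n)) < min e K"
    using eventually_conj[OF ev1 ev2] unfolding eventually_sequentially by blast
  have R: "norm (w n) * norm (c ^ n * l) ^ m < min e K" if "n \<ge> N" for n
  proof -
    have "norm (c ^ n * l) ^ m = (norm c ^ m) ^ n * norm l ^ m"
      by (simp add: norm_mult norm_power power_mult_distrib power_mult[symmetric] mult.commute)
    then show ?thesis using N(2)[OF that] by (simp add: mult_ac)
  qed
  have R1: "(c ^ n * l, k, w n) \<in> R1" if "n \<ge> N" "norm k < K" for n k
    using R[OF that(1)] N(1)[OF that(1)] that(2) by (simp add: mem_region \<mu>_def)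
  define \<sigma> where "\<sigma> n = (sn n - g2 (c ^ n * l, 0, w n)) * w n ^ 2" for n
  have \<sigma>S: "\<sigma> (Suc n) = \<delta> / of_nat d * w n ^ (2 * d - 2) * \<sigma> n + w n ^ (d - 1) * hh (c ^ n * l, 0, w n)"
    if "n \<ge> N" for n
  proof -
    let ?l = "c ^ n * l" and ?w = "w n"
    have Z: "(?l, 0, ?w) \<in> R1" using R1[OF that, of 0] K_pos by simp
    note p = square_power_d[of ?w]
    have "sn (Suc n) - g2 (c ^ Suc n * l, 0, w (Suc n)) =
        \<delta> / of_nat d * (sn n - g2 (?l, 0, ?w)) + hh (?l, 0, ?w) / ?w ^ (d + 1)"
      unfolding snS hh_QQ[OF Z w0] wS using g2_step[OF Z, of 0] by (simp add: algebra_simps)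
    then have "\<sigma> (Suc n) = (\<delta> / of_nat d * (sn n - g2 (?l, 0, ?w)) + hh (?l, 0, ?w) / ?w ^ (d + 1)) * (?w ^ d)\<^sup>2"
      by (simp add: \<sigma>_def wS)
    also have "\<dots> = \<delta> / of_nat d * (sn n - g2 (?l, 0, ?w)) * (?w ^ d)\<^sup>2 + hh (?l, 0, ?w) / ?w ^ (d + 1) * (?w ^ d)\<^sup>2"
      by (rule distrib_right)
    also have "\<delta> / of_nat d * (sn n - g2 (?l, 0, ?w)) * (?w ^ d)\<^sup>2 = \<delta> / of_nat d * ?w ^ (2 * d - 2) * \<sigma> n"
      unfolding p(1) \<sigma>_def by simp
    also have "hh (?l, 0, ?w) / ?w ^ (d + 1) * (?w ^ d)\<^sup>2 = ?w ^ (d - 1) * hh (?l, 0, ?w)"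
      unfolding p(2) using w0[of n] by simp
    finally show ?thesis .
  qed
  have "\<exists>n\<ge>N. norm (\<sigma> n) < \<eta>"
  proof (rule contraction_eventually_small[OF _ \<eta>(1)])
    fix n assume n: "n \<ge> N"
    have w1: "norm (w n) \<le> \<mu>" "norm (w n) \<le> 1" using N(1)[OF n] by (auto simp: \<mu>_def)
    have pw: "norm (w n ^ j) \<le> \<mu>" if "j \<ge> 1" for j
      using power_decreasing[OF that norm_ge_zero w1(2)] w1(1) by (simp add: norm_power)
    have j: "2 * d - 2 \<ge> 1" "d - 1 \<ge> 1" using d by simp_all
    have "norm (\<delta> / of_nat d * w n ^ (2 * d - 2)) \<le> norm (\<delta> / of_nat d) * \<mu>"
      unfolding norm_mult using pw[OF j(1)] by (intro mult_left_mono) auto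
    also have "\<dots> \<le> norm (\<delta> / of_nat d) * (1 / (2 * (norm (\<delta> / of_nat d) + 1)))"
      by (intro mult_left_mono) (auto simp: \<mu>_def)
    also have "\<dots> \<le> 1/2" using dp by (simp add: field_simps)
    finally have 1: "norm (\<delta> / of_nat d * w n ^ (2 * d - 2)) \<le> 1/2" .
    have "norm (w n ^ (d - 1) * hh (c ^ n * l, 0, w n)) \<le> (\<eta> / 4 / (3 * exp (real d))) * (3 * exp (real d))"
      unfolding norm_mult
    proof (intro mult_mono)
      have "norm (w n ^ (d - 1)) \<le> \<mu>" by (rule pw[OF j(2)])
      also have "\<mu> \<le> \<eta> / 4 / (3 * exp (real d))" by (simp add: \<mu>_def)
      finally show "norm (w n ^ (d - 1)) \<le> \<eta> / 4 / (3 * exp (real d))" .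
      show "norm (hh (c ^ n * l, 0, w n)) \<le> 3 * exp (real d)"
        using norm_hh R1[OF n, of 0] K_pos by simp
    qed (use \<eta> in auto)
    then have 2: "norm (w n ^ (d - 1) * hh (c ^ n * l, 0, w n)) \<le> \<eta> / 4" by simp
    have "norm (\<delta> / of_nat d * w n ^ (2 * d - 2) * \<sigma> n) \<le> 1/2 * norm (\<sigma> n)"
      unfolding norm_mult[of _ "\<sigma> n"] using 1 by (intro mult_right_mono) auto
    then show "norm (\<sigma> (Suc n)) \<le> 1/2 * norm (\<sigma> n) + \<eta> / 4"
      unfolding \<sigma>S[OF n] using 2 by (intro norm_triangle_le add_mono)
  qed
  then obtain n where n: "n \<ge> N" "norm (\<sigma> n) < \<eta>" by blast
  have "(c ^ n * l, 0, w n) \<in> R1" using R1[OF n(1), of 0] K_pos by simp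
  then have "norm (w n) < rho (c ^ n * l)" by (simp add: mem_R1)
  then obtain k where k: "norm k \<le> 4/3 * norm (\<sigma> n)" "sig (c ^ n * l, k, w n) = \<sigma> n"
    using sig_slice(2)[of "w n" "c ^ n * l" "\<sigma> n"] n(2) \<eta>(3) K_pos by auto
  have "norm k < e" "norm k < K" using k(1) n(2) \<eta> by auto
  moreover have "ss (c ^ n * l, k, w n) = sn n"
    using w0[of n] g2_indep[of "c ^ n * l" k "w n" 0] by (simp add: ss_def k(2) \<sigma>_def)
  moreover have "norm (w n) < e" using N(1)[OF n(1)] by (simp add: \<mu>_def)
  ultimately show ?thesis
    using R[OF n(1)] R1[OF n(1)] F[of n] w0[of n]
    by (intro exI[of _ n] exI[of _ k] exI[of _ "w n"]) (simp add: F_def)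
qed

end

section \<open>The chart (l, k, v) \<mapsto> (l, s, t) near infinity\<close>

lemma biholomorphic3_compose_image:
  assumes f: "biholomorphic3 f S (f ` S)" and g: "biholomorphic3 g T (g ` T)" and sub: "f ` S \<subseteq> T"
  shows "biholomorphic3 (\<lambda>z. g (f z)) S ((\<lambda>z. g (f z)) ` S)"
proof -
  have "open (f ` S)" using f unfolding biholomorphic3_def holomorphic3_def by blast
  from biholomorphic3_compose[OF f biholomorphic3_subset[OF g this sub]]
  show ?thesis by (simp only: image_image)
qed

context henon_normal
begin

text \<open>Half the size of \<open>R1\<close>, since |ff| may be twice |v| and (l, k, ff) has to
  land in \<open>R1\<close>; the points v = 0 are removed because t = 1/ff.\<close>

definition core :: "complex3 set" where
  "core = {(l, k, v) \<in> region m (K / 2) (r / 2). v \<noteq> 0}"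

lemma core_sub: "core \<subseteq> R2" "core \<subseteq> R4"
  using region_mono[of "K / 2" "2 * K" "r / 2" "2 * r" m] region_sub K_pos r_pos by (auto simp: core_def)

lemma open_core: "open core"
proof -
  have "core = region m (K / 2) (r / 2) \<inter> {z. snd (snd z) \<noteq> 0}" by (auto simp: core_def)
  then show ?thesis by (auto intro!: open_Int open_region open_Collect_neq continuous_intros)
qed

lemma ff_core:
  assumes "(l, k, v) \<in> core"
  shows "(l, k, ff (l, k, v)) \<in> R1" "ff (l, k, v) \<noteq> 0"
proof -
  have v: "norm k < K / 2" "norm v < r / 2" "norm v * norm l ^ m < K / 2" "v \<noteq> 0"
    using assms by (auto simp: core_def mem_region)
  have f: "norm (ff (l, k, v)) \<le> 2 * norm v" using norm_ff assms core_sub by blast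
  then have "norm (ff (l, k, v)) * norm l ^ m \<le> (2 * norm v) * norm l ^ m"
    by (intro mult_right_mono) auto
  then show "(l, k, ff (l, k, v)) \<in> R1" using f v K_pos by (auto simp: mem_region)
  show "ff (l, k, v) \<noteq> 0" using v by (simp add: ff_def)
qed

definition Psi0 :: "complex3 \<Rightarrow> complex3" where
  "Psi0 = (\<lambda>(l, k, v). (l, ss (l, k, ff (l, k, v)), 1 / ff (l, k, v)))"

lemma ss_deriv:
  assumes "(l, k, w) \<in> R1"
  shows "((\<lambda>k. ss (l, k, w)) has_field_derivative GG (l, k, w) / w\<^sup>2) (at k)"
proof -
  have "((\<lambda>k. sig (l, k, w) / w\<^sup>2 + g2 (l, 0, w)) has_field_derivative GG (l, k, w) / w\<^sup>2 + 0) (at k)"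
    by (intro DERIV_add DERIV_cdivide sig_deriv assms DERIV_const)
  moreover have "(\<lambda>k. ss (l, k, w)) = (\<lambda>k. sig (l, k, w) / w\<^sup>2 + g2 (l, 0, w))"
    using g2_indep by (auto simp: ss_def)
  ultimately show ?thesis by simp
qed

text \<open>A composition of maps that alter one coordinate each: the shear v \<mapsto> w, the shear
  k \<mapsto> s with derivative \<open>GG\<close> / w^2, and the inversion w \<mapsto> 1/w.\<close>

lemma biholomorphic3_Psi0: "biholomorphic3 Psi0 core (Psi0 ` core)"
proof -
  let ?S2 = "{(l, k, w) \<in> R1. w \<noteq> 0}" and ?S3 = "{(l, s, w :: complex). w \<noteq> 0} :: complex3 set"
  have S2: "open ?S2"
  proof -
    have "?S2 = R1 \<inter> {z. snd (snd z) \<noteq> 0}" by auto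
    then show ?thesis by (auto intro!: open_Int open_region open_Collect_neq continuous_intros)
  qed
  have S3: "open ?S3"
  proof -
    have "?S3 = {z. snd (snd z) \<noteq> 0}" by auto
    then show ?thesis by (auto intro!: open_Collect_neq continuous_intros)
  qed
  let ?f1 = "(\<lambda>(l, k, v). (l, k, ff (l, k, v))) :: complex3 \<Rightarrow> complex3"
  let ?f2 = "(\<lambda>(l, k, w). (l, ss (l, k, w), w)) :: complex3 \<Rightarrow> complex3"
  let ?f3 = "(\<lambda>(l, s, w). (l, s, 1 / w)) :: complex3 \<Rightarrow> complex3"
  have b1: "biholomorphic3 ?f1 core (?f1 ` core)"
    by (rule biholomorphic3_subset[OF biholomorphic3_ff open_core core_sub(1)])
  have b2: "biholomorphic3 ?f2 ?S2 (?f2 ` ?S2)"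
  proof (rule biholomorphic3_shear2)
    have "hol (\<lambda>z. sig z / snd (snd z) ^ 2 + g2 z) ?S2"
      by (intro hol_add hol_divide hol_power hol_coords S2 hol_subset[OF hol_sig S2] hol_subset[OF hol_g2 S2]) auto
    then show "hol ss ?S2" by (simp add: ss_def[abs_def])
    show "inj_on (\<lambda>x. ss (l, x, w)) {x. (l, x, w) \<in> ?S2}" for l w
    proof (rule inj_onI)
      fix x y assume xy: "x \<in> {x. (l, x, w) \<in> ?S2}" "y \<in> {x. (l, x, w) \<in> ?S2}" "ss (l, x, w) = ss (l, y, w)"
      then have "sig (l, x, w) = sig (l, y, w)" using g2_indep[of l x w y] by (simp add: ss_def)
      then show "x = y" using sig_slice(1)[of w l] xy(1,2) by (auto simp: mem_R1 inj_on_def)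
    qed
    fix l k w assume z: "(l, k, w) \<in> ?S2"
    then have "deriv (\<lambda>x. ss (l, x, w)) k = GG (l, k, w) / w\<^sup>2"
      by (intro DERIV_imp_deriv ss_deriv) auto
    moreover have "GG (l, k, w) \<noteq> 0" using GG_near_1[of "(l, k, w)"] z by auto
    ultimately show "deriv (\<lambda>x. ss (l, x, w)) k \<noteq> 0" using z by simp
  qed
  have b3: "biholomorphic3 ?f3 ?S3 (?f3 ` ?S3)"
  proof -
    have "holomorphic3 (\<lambda>z. (fst z, fst (snd z), 1 / snd (snd z))) ?S3"
      by (intro holomorphic3_components hol_divide hol_coords hol_const S3) auto
    then have h: "holomorphic3 ?f3 ?S3" by (simp add: split_beta')
    have b: "biholomorphic3 ?f3 ?S3 ?S3" by (rule biholomorphic3I[OF h h]) auto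
    from biholomorphic3_subset[OF this S3 order_refl] show ?thesis .
  qed
  have "biholomorphic3 (\<lambda>z. ?f2 (?f1 z)) core ((\<lambda>z. ?f2 (?f1 z)) ` core)"
    using ff_core by (intro biholomorphic3_compose_image[OF b1 b2]) auto
  then have "biholomorphic3 (\<lambda>z. ?f3 (?f2 (?f1 z))) core ((\<lambda>z. ?f3 (?f2 (?f1 z))) ` core)"
    by (rule biholomorphic3_compose_image[OF _ b3]) (use ff_core in auto)
  moreover have "(\<lambda>z. ?f3 (?f2 (?f1 z))) = Psi0" by (auto simp: Psi0_def)
  ultimately show ?thesis by (simp only:)
qed

lemma Psi0_HH:
  assumes "z \<in> core"
  shows "Psi0 (HH z) = model_map d c \<delta> QQ (Psi0 z)"
proof -
  obtain l k v where z: "z = (l, k, v)" by (metis prod.exhaust)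
  have R: "(l, k, ff z) \<in> R1" "ff z \<noteq> 0" using ff_core assms z by auto
  have v: "vv (l, k, ff z) = v" using vv_eq core_sub assms z by blast
  have H: "HH z = (c * l, kk (l, k, v), v * kk (l, k, v))" by (simp add: HH_def z)
  have f: "ff (HH z) = ff z ^ d" using ff_HH core_sub assms by blast
  have "Psi0 (HH z) = (c * l, ss (c * l, kk (l, k, v), ff (HH z)), 1 / ff (HH z))"
    unfolding H Psi0_def by simp
  also have "\<dots> = (c * l, \<delta> / of_nat d * ss (l, k, ff z) + poly (QQ l) (1 / ff z), (1 / ff z) ^ d)"
    unfolding f using ss_step[OF R] by (simp add: v power_one_over)
  also have "\<dots> = model_map d c \<delta> QQ (Psi0 z)"
    by (simp add: model_map_def Psi0_def z)
  finally show ?thesis .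
qed

lemma Psi0_model: "z \<in> core \<Longrightarrow> Psi0 z \<in> model_space"
proof -
  assume z: "z \<in> core"
  obtain l k v where lkv: "z = (l, k, v)" by (metis prod.exhaust)
  have "norm (ff z) < r" "ff z \<noteq> 0" using ff_core[of l k v] z lkv by (auto simp: mem_region)
  then have "norm (ff z) < 1" "norm (ff z) > 0" using r_small r_pos by auto
  then have "1 < 1 / norm (ff z)" by (simp add: less_divide_eq)
  then show ?thesis by (simp add: Psi0_def lkv model_space_def norm_divide)
qed

end

section \<open>The chart for the Henon map in its original coordinates\<close>

lemma mem_V_plus:
  "(l, x, y) \<in> V_plus d C R \<longleftrightarrow> R < norm y \<and> norm x < norm y \<and> norm l ^ (d_tilde d C + 1) < norm y"
  by (simp add: V_plus_def)

text \<open>Supplies, with m = d_tilde + 1, the strict degree bound of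
  \<open>henon_u_near_1\<close>.\<close>

lemma degree_lt_d_tilde:
  assumes "j \<le> d"
  shows "degree (C j) < d_tilde d C + 1"
proof -
  have "degree (C j) + j \<le> d_tilde d C"
    unfolding d_tilde_def using assms by (intro Max_ge) auto
  then show ?thesis by simp
qed

lemma henon_normal_form:
  fixes cd c \<delta> \<alpha> :: complex and C :: "nat \<Rightarrow> complex poly"
  assumes d: "d \<ge> 2" and cd: "cd \<noteq> 0" and C: "C d = [:cd:]" and \<alpha>: "\<alpha> ^ (d - 1) = cd" and y: "y \<noteq> 0"
  defines "b \<equiv> \<lambda>j. smult (\<alpha> ^ (d - j) / cd) (C j)"
  shows "(\<Sum>j\<le>d. poly (C j) l * y ^ j) - \<delta> * x = cd * y ^ d * henon_u d \<delta> b (l, x / y, 1 / (\<alpha> * y))"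
proof -
  have \<alpha>0: "\<alpha> \<noteq> 0" using \<alpha> cd d by (auto simp: power_0_left)
  have 1: "poly (C j) l * y ^ j = cd * y ^ d * (poly (b j) l * (1 / (\<alpha> * y)) ^ (d - j))" if "j < d" for j
  proof -
    have "y ^ d = y ^ j * y ^ (d - j)" using that by (simp add: power_add[symmetric])
    then show ?thesis
      using cd \<alpha>0 y by (simp add: b_def power_one_over power_mult_distrib field_simps)
  qed
  have 2: "\<delta> * x = cd * y ^ d * (\<delta> * (x / y) * (1 / (\<alpha> * y)) ^ (d - 1))"
  proof -
    have "y ^ d = y * y ^ (d - 1)" using d by (simp add: power_eq_if)
    then show ?thesis
      using cd \<alpha>0 y \<alpha> by (simp add: power_one_over power_mult_distrib field_simps)
  qed
  have "(\<Sum>j\<le>d. poly (C j) l * y ^ j) = cd * y ^ d + (\<Sum>j<d. poly (C j) l * y ^ j)"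
    by (simp add: lessThan_Suc_atMost[symmetric] C)
  also have "(\<Sum>j<d. poly (C j) l * y ^ j) = cd * y ^ d * (\<Sum>j<d. poly (b j) l * (1 / (\<alpha> * y)) ^ (d - j))"
    unfolding sum_distrib_left using 1 by (intro sum.cong) auto
  finally show ?thesis
    unfolding henon_u_def prod.case using 2 by (simp only: algebra_simps mult_1_left mult_1_right)
qed

text \<open>The third coordinate of the chart \<open>\<Psi>\<close> is an extension of the Boettcher coordinate. That it is
  \<open>y\<close> times the exponential of a single-valued function is what makes the circle \<open>(\<lambda>, e\<^sup>i\<^sup>\<theta>x, e\<^sup>i\<^sup>\<theta>y)\<close> a
  generator of the fundamental group of the model.\<close>

definition henon_chart :: "nat \<Rightarrow> complex \<Rightarrow> complex \<Rightarrow> (nat \<Rightarrow> complex poly) \<Rightarrow> real \<Rightarrow>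
    (complex3 \<Rightarrow> complex3) \<Rightarrow> complex \<Rightarrow> (complex3 \<Rightarrow> complex) \<Rightarrow> (complex \<Rightarrow> complex poly) \<Rightarrow> bool" where
  "henon_chart d c \<delta> C R \<Psi> \<alpha> g Q \<longleftrightarrow> \<alpha> \<noteq> 0 \<and>
    biholomorphic3 \<Psi> (V_plus d C R) (\<Psi> ` V_plus d C R) \<and> \<Psi> ` V_plus d C R \<subseteq> model_space \<and>
    continuous_on (V_plus d C R) g \<and>
    (\<forall>l x y. (l, x, y) \<in> V_plus d C R \<longrightarrow>
      fst (\<Psi> (l, x, y)) = l \<and> snd (snd (\<Psi> (l, x, y))) = \<alpha> * y * exp (g (l, x, y))) \<and>
    (\<forall>z\<in>V_plus d C R. henon_map d c \<delta> C z \<in> V_plus d C R \<and>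
      \<Psi> (henon_map d c \<delta> C z) = model_map d c \<delta> Q (\<Psi> z)) \<and>
    (\<forall>z\<in>model_space. \<exists>n. (model_map d c \<delta> Q ^^ n) z \<in> \<Psi> ` V_plus d C R) \<and>
    (\<forall>l. degree (Q l) = d + 1) \<and> hol (\<lambda>(l, s, t). poly (Q l) t) UNIV"

theorem henon_semiconjugacy:
  fixes d :: nat and c \<delta> cd :: complex and C :: "nat \<Rightarrow> complex poly"
  assumes d: "d \<ge> 2" and c: "norm c > 1" and \<delta>: "\<delta> \<noteq> 0" and cd: "cd \<noteq> 0" and C: "C d = [:cd:]"
  shows "\<exists>R0>0. \<forall>R\<ge>R0. \<exists>\<Psi> \<alpha> g Q. henon_chart d c \<delta> C R \<Psi> \<alpha> g Q"
proof -
  define m where "m = d_tilde d C + 1"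
  define \<alpha> where "\<alpha> = exp (Ln cd / of_nat (d - 1))"
  have \<alpha>: "\<alpha> ^ (d - 1) = cd" "\<alpha> \<noteq> 0"
    using d cd by (simp_all add: \<alpha>_def exp_of_nat_mult[symmetric] del: of_nat_diff)
  define b where "b = (\<lambda>j. smult (\<alpha> ^ (d - j) / cd) (C j))"
  \<comment> \<open>On \<open>V_plus\<close>, |k| < 1 and |v| |l|^m < 1/|\<alpha>|; both have to
    stay below K/2, the bound in \<open>core\<close>.\<close>
  define K where "K = 2 * max 1 (1 / norm \<alpha>)"
  have K: "K \<ge> 2" "K / 2 \<ge> 1 / norm \<alpha>" by (simp_all add: K_def)
  have deg: "degree (b j) < m" if "j < d" for j
    using degree_lt_d_tilde[of j d C] that \<alpha>(2) cd by (simp add: b_def m_def)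
  have "\<exists>r0>0. \<forall>r\<le>r0. \<forall>z\<in>region m (4 * K) r. norm (henon_u d \<delta> b z - 1) \<le> 1/100"
    by (rule henon_u_near_1[OF d]) (use deg K in auto)
  then obtain r1 where r1: "r1 > 0" "\<And>r z. r \<le> r1 \<Longrightarrow> z \<in> region m (4 * K) r \<Longrightarrow> norm (henon_u d \<delta> b z - 1) \<le> 1/100"
    by blast
  \<comment> \<open>r1 / 4 because u must be controlled on the region of size 4 r, K / 16 for 8 r <
    K, and the last bound to absorb |c|^m.\<close>
  define r where "r = min (r1 / 4) (min (K / 16) (1 / (8 * norm c ^ m)))"
  have cm: "norm c ^ m \<ge> 1" using c by (simp add: one_le_power)
  then have cm: "norm c ^ m \<ge> 1" "norm c ^ m > 0" by linarith+
  have r: "r > 0" "r \<le> r1 / 4" "8 * r < K" "r * (8 * norm c ^ m) \<le> 1"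
  proof -
    show "r > 0" using r1 K cm(2) by (simp add: r_def)
    show "r \<le> r1 / 4" by (simp add: r_def)
    have "r \<le> K / 16" by (simp add: r_def)
    then show "8 * r < K" using K by simp
    have "r \<le> 1 / (8 * norm c ^ m)" by (simp add: r_def)
    then show "r * (8 * norm c ^ m) \<le> 1" using cm(2) by (simp add: le_divide_eq)
  qed
  interpret henon_normal d m c \<delta> b K r
    by unfold_locales (use d c \<delta> r r1 in \<open>auto simp: m_def mult_ac\<close>)
  \<comment> \<open>|y| > 2 / (|\<alpha>| r) means |v| < r/2, the size of
    \<open>core\<close>.\<close>
  define R0 where "R0 = max 1 (2 / (norm \<alpha> * r))"
  have R0: "R0 > 0" by (simp add: R0_def)
  moreover have "\<exists>\<Psi> \<alpha> g Q. henon_chart d c \<delta> C R \<Psi> \<alpha> g Q" if R: "R \<ge> R0" for R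
  proof -
    let ?V = "V_plus d C R" and ?H = "henon_map d c \<delta> C"
    define co where "co = (\<lambda>(l, x, y). (l, x / y, 1 / (\<alpha> * y)) :: complex3)"
    have R1': "R \<ge> 1" and Rr: "2 / (norm \<alpha> * r) \<le> R" using R by (simp_all add: R0_def)
    have V_open: "open ?V"
    proof -
      have "?V = {z. R < norm (snd (snd z))} \<inter> {z. norm (fst (snd z)) < norm (snd (snd z))} \<inter>
          {z. norm (fst z) ^ (d_tilde d C + 1) < norm (snd (snd z))}"
        by (auto simp: V_plus_def)
      then show ?thesis
        by (simp only:) (intro open_Int open_Collect_less continuous_intros)
    qed
    have y0: "y \<noteq> 0" "norm y > 1" if "(l, x, y) \<in> ?V" for l x y
      using that R1' by (auto simp: mem_V_plus)
    have co_core: "co (l, x, y) \<in> core" if z: "(l, x, y) \<in> ?V" for l x y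
    proof -
      have V: "R < norm y" "norm x < norm y" "norm l ^ m < norm y"
        using z by (auto simp: mem_V_plus m_def)
      have a: "norm \<alpha> > 0" using \<alpha> by simp
      have "2 / (norm \<alpha> * r) < norm y" using V Rr by simp
      then have "1 / (norm \<alpha> * norm y) < r / 2"
        using y0[OF z] a r(1) by (simp add: field_simps)
      moreover have "norm x / norm y < 1" using V y0[OF z] by (simp add: divide_less_eq)
      then have "norm x / norm y < K / 2" using K by linarith
      moreover have "1 / (norm \<alpha> * norm y) * norm l ^ m < K / 2"
      proof -
        have "1 / (norm \<alpha> * norm y) * norm l ^ m < 1 / (norm \<alpha> * norm y) * norm y"
          using V y0[OF z] a by (intro mult_strict_left_mono) auto
        also have "\<dots> = 1 / norm \<alpha>" using y0[OF z] by simp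
        finally show ?thesis using K(2) by (rule less_le_trans)
      qed
      ultimately show ?thesis
        using y0[OF z] \<alpha>(2) by (simp add: core_def co_def mem_region norm_divide norm_mult)
    qed
    have co_core': "co z \<in> core" if "z \<in> ?V" for z
      using that co_core by (cases z) auto
    have H_co: "?H z \<in> ?V \<and> co (?H z) = HH (co z)" if z: "z \<in> ?V" for z
    proof -
      obtain l x y where lxy: "z = (l, x, y)" by (metis prod.exhaust)
      have zV: "(l, x, y) \<in> ?V" using z lxy by simp
      define u where "u = uu (co z)"
      have R4: "co z \<in> R4" using co_core[OF zV] core_sub lxy by blast
      have u: "u \<noteq> 0" using u_nz[OF R4] by (simp add: u_def)
      define y1 where "y1 = cd * y ^ d * u"
      have H: "?H z = (c * l, y, y1)"
        using henon_normal_form[where C = C and d = d and y = y and l = l and x = x and \<delta> = \<delta>, OF d cd C \<alpha>(1) y0(1)[OF zV]]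
        by (simp add: henon_map_def lxy y1_def u_def co_def b_def)
      have y: "y \<noteq> 0" using y0[OF zV] by simp
      then have y1: "y1 \<noteq> 0" using u cd by (simp add: y1_def)
      have yd: "y ^ d = y * y ^ (d - 1)" using d by (simp add: power_eq_if)
      have kk: "kk (co z) = y / y1"
        using u cd y \<alpha>
        by (simp add: kk_def co_def lxy y1_def u_def yd power_one_over power_mult_distrib field_simps)
      have "norm (kk (co z)) \<le> 2 * norm (1 / (\<alpha> * y))"
        using kk_bound(1)[of l "x / y" "1 / (\<alpha> * y)"] R4 by (simp add: co_def lxy)
      moreover have "norm (1 / (\<alpha> * y)) < r / 2"
        using co_core[OF zV] by (simp add: co_def core_def mem_region)
      ultimately have "norm (kk (co z)) < r" by simp
      then have "norm y < r * norm y1" using y1 by (simp add: kk norm_divide divide_less_eq)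
      \<comment> \<open>|y| < r |y1| and r \<le> 1 / (8 |c|^m). The new point has x-coordinate y and
        parameter c l, and this one inequality gives both conditions on them.\<close>
      then have A: "norm y * (8 * norm c ^ m) < norm y1"
      proof -
        have "norm y * (8 * norm c ^ m) < (r * norm y1) * (8 * norm c ^ m)"
          using \<open>norm y < r * norm y1\<close> cm(2) by (intro mult_strict_right_mono) auto
        also have "\<dots> = norm y1 * (r * (8 * norm c ^ m))" by simp
        also have "\<dots> \<le> norm y1 * 1" using r(4) by (intro mult_left_mono) auto
        finally show ?thesis by simp
      qed
      have "norm y * 1 \<le> norm y * (8 * norm c ^ m)" "norm y * norm c ^ m \<le> norm y * (8 * norm c ^ m)"
        using cm by (intro mult_left_mono; simp)+
      then have B: "norm y < norm y1" "norm y * norm c ^ m < norm y1" using A by linarith+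
      have "norm (c * l) ^ m = norm l ^ m * norm c ^ m" by (simp add: norm_mult power_mult_distrib)
      also have "\<dots> \<le> norm y * norm c ^ m"
        using zV cm by (intro mult_right_mono) (auto simp: mem_V_plus m_def)
      finally have "?H z \<in> ?V"
        using B zV unfolding H mem_V_plus m_def[symmetric] by auto
      moreover have "1 / (\<alpha> * y1) = 1 / (\<alpha> * y) * (y / y1)" using y by simp
      then have "co (?H z) = HH (co z)"
        using kk unfolding H by (simp add: co_def HH_def lxy)
      ultimately show ?thesis by blast
    qed
    define \<Psi> where "\<Psi> z = Psi0 (co z)" for z
    have co_bi: "biholomorphic3 co ?V (co ` ?V)"
    proof -
      let ?S = "{z. snd (snd z) \<noteq> 0} :: complex3 set"
      have S: "open ?S" by (intro open_Collect_neq continuous_intros)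
      have "holomorphic3 (\<lambda>z. (fst z, fst (snd z) / snd (snd z), 1 / (\<alpha> * snd (snd z)))) ?S"
        using \<alpha>(2) by (intro holomorphic3_components hol_divide hol_mult hol_coords hol_const S) auto
      then have 1: "holomorphic3 co ?S" by (simp add: co_def split_beta')
      let ?co' = "\<lambda>(l, k, v). (l, k / (\<alpha> * v), 1 / (\<alpha> * v)) :: complex3"
      have "holomorphic3 (\<lambda>z. (fst z, fst (snd z) / (\<alpha> * snd (snd z)), 1 / (\<alpha> * snd (snd z)))) ?S"
        using \<alpha>(2) by (intro holomorphic3_components hol_divide hol_mult hol_coords hol_const S) auto
      then have 2: "holomorphic3 ?co' ?S" by (simp add: split_beta')
      have "biholomorphic3 co ?S ?S"
        by (rule biholomorphic3I[OF 1 2]) (use \<alpha>(2) in \<open>auto simp: co_def\<close>)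
      from biholomorphic3_subset[OF this V_open] show ?thesis using y0 by force
    qed
    have \<Psi>_bi: "biholomorphic3 \<Psi> ?V (\<Psi> ` ?V)"
      unfolding \<Psi>_def using co_core
      by (intro biholomorphic3_compose_image[OF co_bi biholomorphic3_Psi0]) auto
    have \<Psi>_model: "\<Psi> ` ?V \<subseteq> model_space"
      unfolding \<Psi>_def using co_core' Psi0_model by blast
    have cont: "continuous_on ?V (\<lambda>z. gg (co z))"
    proof (rule continuous_on_compose2[OF hol_imp_continuous_on[OF hol_gg]])
      show "continuous_on ?V co"
        using co_bi holomorphic3_imp_continuous_on by (auto simp: biholomorphic3_def)
      show "co ` ?V \<subseteq> R4" using co_core core_sub by auto
    qed
    have comps: "fst (\<Psi> (l, x, y)) = l \<and> snd (snd (\<Psi> (l, x, y))) = \<alpha> * y * exp (gg (co (l, x, y)))"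
      if "(l, x, y) \<in> ?V" for l x y
      using \<alpha>(2) y0[OF that] by (simp add: \<Psi>_def Psi0_def co_def ff_def exp_minus field_simps)
    have step: "?H z \<in> ?V \<and> \<Psi> (?H z) = model_map d c \<delta> QQ (\<Psi> z)" if "z \<in> ?V" for z
      using H_co[OF that] Psi0_HH[OF co_core'[OF that]] by (simp add: \<Psi>_def)
    have absorb: "\<exists>n. (model_map d c \<delta> QQ ^^ n) z \<in> \<Psi> ` ?V" if z: "z \<in> model_space" for z
    proof -
      obtain l s t where lst: "z = (l, s, t)" by (metis prod.exhaust)
      have t: "norm t > 1" using z by (simp add: lst model_space_def)
      have a: "norm \<alpha> > 0" using \<alpha> by simp
      \<comment> \<open>1/2 gives |k y| < |y|. The other bound yields |v| \<le> 4/3 |w| < 1 /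
        (|\<alpha>| R), hence |y| > R; likewise |l|^m < |y|, using R \<ge> 1.\<close>
      define e where "e = min (1/2) (3/4 * (1 / (norm \<alpha> * R)))"
      have e: "e > 0" using a R1' by (simp add: e_def)
      obtain n k w where n: "norm k < e" "w \<noteq> 0" "norm w < e" "norm w * norm (c ^ n * l) ^ m < e"
        "(c ^ n * l, k, w) \<in> R1"
        "(model_map d c \<delta> QQ ^^ n) (l, s, t) = (c ^ n * l, ss (c ^ n * l, k, w), 1 / w)"
        using absorption[OF t e, of l s] by blast
      define l' where "l' = c ^ n * l"
      define v where "v = vv (l', k, w)"
      have fv: "ff (l', k, v) = w" "norm v \<le> 4/3 * norm w"
        using vv_props[OF n(5)] by (simp_all add: v_def l'_def)
      then have v0: "v \<noteq> 0" using n(2) by (auto simp: ff_def)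
      define y where "y = 1 / (\<alpha> * v)"
      have yv: "norm y * (norm \<alpha> * norm v) = 1" using v0 \<alpha>(2) by (simp add: y_def norm_divide norm_mult)
      have ey: "4/3 * e * norm \<alpha> * R \<le> 1"
      proof -
        have "e \<le> 3/4 * (1 / (norm \<alpha> * R))" by (simp add: e_def)
        then show ?thesis using a R1' by (simp add: field_simps)
      qed
      have y_pos: "norm y > 0" using v0 \<alpha>(2) by (simp add: y_def)
      have "(l', k * y, y) \<in> ?V"
        unfolding mem_V_plus m_def[symmetric]
      proof (intro conjI)
        have "norm v < 4/3 * e" using fv n(3) by linarith
        then have "norm v * norm \<alpha> * R < 4/3 * e * norm \<alpha> * R"
          using a R1' by (intro mult_strict_right_mono) auto
        then have "norm v * norm \<alpha> * R < 1" using ey by simp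
        then have "norm v * norm \<alpha> * R < norm v * norm \<alpha> * norm y" using yv by (simp add: mult_ac)
        then show "R < norm y" using v0 a by simp
        have "norm k < 1" using n(1) by (simp add: e_def)
        then show "norm (k * y) < norm y" using y_pos by (simp add: norm_mult)
        have "norm v * norm l' ^ m \<le> 4/3 * norm w * norm l' ^ m"
          using fv by (intro mult_right_mono) auto
        also have "\<dots> < 4/3 * e" using n(4) by (simp add: l'_def)
        finally have "(norm v * norm l' ^ m) * norm \<alpha> < 4/3 * e * norm \<alpha>"
          using a by (intro mult_strict_right_mono)
        also have "\<dots> \<le> 4/3 * e * norm \<alpha> * R"
          using mult_left_mono[OF R1', of "4/3 * e * norm \<alpha>"] e a by simp
        finally have "norm v * norm \<alpha> * norm l' ^ m < 1" using ey by (simp add: mult_ac)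
        then have "norm v * norm \<alpha> * norm l' ^ m < norm v * norm \<alpha> * norm y" using yv by (simp add: mult_ac)
        then show "norm l' ^ m < norm y" using v0 a by simp
      qed
      moreover have "co (l', k * y, y) = (l', k, v)"
        using v0 \<alpha>(2) by (simp add: co_def y_def)
      then have "\<Psi> (l', k * y, y) = (l', ss (l', k, w), 1 / w)"
        by (simp add: \<Psi>_def Psi0_def fv)
      ultimately show ?thesis
        using n(6) unfolding lst l'_def by (metis image_eqI)
    qed
    show ?thesis
      unfolding henon_chart_def
      using \<alpha>(2) \<Psi>_bi \<Psi>_model cont comps step absorb degree_QQ hol_QQ
      by (intro exI[of _ \<Psi>] exI[of _ \<alpha>] exI[of _ "\<lambda>z. gg (co z)"] exI[of _ QQ]) blast
  qed
  ultimately show ?thesis by blast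
qed

section \<open>The covering of the escaping region\<close>

lemma biholomorphic3_inverse:
  assumes "holomorphic3 f S" "holomorphic3 g T" "\<And>z. z \<in> S \<Longrightarrow> f z \<in> T \<and> g (f z) = z"
    "\<And>z. z \<in> T \<Longrightarrow> g z \<in> S \<and> f (g z) = z"
  shows "biholomorphic3 g T S"
  by (rule biholomorphic3I[OF assms(2,1)]) (use assms in auto)

lemma biholomorphic3_cong:
  assumes "biholomorphic3 f S T" "\<And>z. z \<in> S \<Longrightarrow> g z = f z"
  shows "biholomorphic3 g S T"
proof -
  obtain h where h: "holomorphic3 f S" "holomorphic3 h T" "\<And>z. z \<in> S \<Longrightarrow> f z \<in> T \<and> h (f z) = z"
    "\<And>z. z \<in> T \<Longrightarrow> h z \<in> S \<and> f (h z) = z" using biholomorphic3E[OF assms(1)] by metis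
  show ?thesis
    by (rule biholomorphic3I[OF holomorphic3_cong[OF h(1)] h(2)]) (use assms h in auto)
qed

lemma biholomorphic3_funpow:
  assumes "biholomorphic3 f UNIV UNIV"
  shows "biholomorphic3 (f ^^ n) UNIV UNIV"
proof (induction n)
  case 0
  have "holomorphic3 (\<lambda>z. (fst z, fst (snd z), snd (snd z))) UNIV"
    by (intro holomorphic3_components hol_coords open_UNIV)
  then show ?case by (intro biholomorphic3I[where g = "\<lambda>z. z"]) (auto simp: id_def)
next
  case (Suc n)
  from biholomorphic3_compose[OF Suc assms] show ?case by (simp add: o_def)
qed

lemma local_biholomorphic_open_map:
  assumes "\<And>z. z \<in> S \<Longrightarrow> \<exists>W. z \<in> W \<and> W \<subseteq> S \<and> biholomorphic3 f W (f ` W)" and N: "open N" "N \<subseteq> S"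
  shows "open (f ` N)"
proof (rule openI)
  fix y assume "y \<in> f ` N"
  then obtain z where z: "z \<in> N" "y = f z" by blast
  then obtain W where W: "z \<in> W" "W \<subseteq> S" "biholomorphic3 f W (f ` W)" using assms by blast
  then have "open W" by (simp add: biholomorphic3_def holomorphic3_def)
  then have "open (W \<inter> N)" using N by blast
  from biholomorphic3_subset[OF W(3) this] have "open (f ` (W \<inter> N))"
    by (auto simp: biholomorphic3_def holomorphic3_def)
  then obtain e where "e > 0" "ball y e \<subseteq> f ` (W \<inter> N)"
    using W(1) z open_contains_ball by (metis IntI image_eqI)
  then show "\<exists>e>0. ball y e \<subseteq> f ` N" by blast
qed

lemma Z_inverse_group_carrier:
  assumes "d > 0"
  shows "q \<in> carrier (Z_inverse_group d) \<longleftrightarrow> (\<exists>n. q * of_nat d ^ n \<in> \<int>)"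
proof
  assume "q \<in> carrier (Z_inverse_group d)"
  then obtain k n where "q = of_int k / of_nat d ^ n" by (auto simp: Z_inverse_group_def)
  then have "q * of_nat d ^ n = of_int k" using assms by simp
  then show "\<exists>n. q * of_nat d ^ n \<in> \<int>" by (metis Ints_of_int)
next
  assume "\<exists>n. q * of_nat d ^ n \<in> \<int>"
  then obtain n k where "q * of_nat d ^ n = of_int k" by (auto elim: Ints_cases)
  then have "q = of_int k / of_nat d ^ n" using assms by (simp add: field_simps)
  then show "q \<in> carrier (Z_inverse_group d)" by (auto simp: Z_inverse_group_def)
qed

lemma Ints_power_mono:
  fixes q :: rat
  assumes "q * of_nat d ^ n \<in> \<int>" "n \<le> n'"
  shows "q * of_nat d ^ n' \<in> \<int>"
proof -
  have "q * of_nat d ^ n' = (q * of_nat d ^ n) * of_nat (d ^ (n' - n))"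
    using assms(2) by (simp add: power_add[symmetric] mult.assoc)
  then show ?thesis using assms(1) by (metis Ints_mult Ints_of_nat)
qed

lemma group_Z_inverse_group:
  assumes "d > 0"
  shows "group (Z_inverse_group d)"
proof (rule groupI)
  note carr = Z_inverse_group_carrier[OF assms]
  have ops [simp]: "x \<otimes>\<^bsub>Z_inverse_group d\<^esub> y = x + y" "\<one>\<^bsub>Z_inverse_group d\<^esub> = 0" for x y
    by (simp_all add: Z_inverse_group_def)
  show "x \<otimes>\<^bsub>Z_inverse_group d\<^esub> y \<in> carrier (Z_inverse_group d)"
    if "x \<in> carrier (Z_inverse_group d)" "y \<in> carrier (Z_inverse_group d)" for x y
  proof -
    obtain n n' where "x * of_nat d ^ n \<in> \<int>" "y * of_nat d ^ n' \<in> \<int>" using \<open>x \<in> _\<close> \<open>y \<in> _\<close> carr by blast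
    then have "x * of_nat d ^ (max n n') \<in> \<int>" "y * of_nat d ^ (max n n') \<in> \<int>"
      by (auto intro: Ints_power_mono)
    then have "(x + y) * of_nat d ^ (max n n') \<in> \<int>" by (simp add: distrib_right)
    then show ?thesis unfolding carr ops by blast
  qed
  show "\<one>\<^bsub>Z_inverse_group d\<^esub> \<in> carrier (Z_inverse_group d)" unfolding carr by simp
  show "\<exists>y\<in>carrier (Z_inverse_group d). y \<otimes>\<^bsub>Z_inverse_group d\<^esub> x = \<one>\<^bsub>Z_inverse_group d\<^esub>"
    if "x \<in> carrier (Z_inverse_group d)" for x
    using that by (intro bexI[of _ "- x"]) (auto simp: carr)
qed (auto simp: Z_inverse_group_def add.assoc)

section \<open>The universal cover of the model space\<close>

definition half_space :: "complex3 set" where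
  "half_space = {(l, s, \<tau>). Re \<tau> > 0}"

definition exp3 :: "complex3 \<Rightarrow> complex3" where
  "exp3 = (\<lambda>(l, s, \<tau>). (l, s, exp \<tau>))"

text \<open>Integer q give the deck transformations of \<open>exp3\<close>; the parameter is
  rational so that elements q of \<int>[1/d] and the integers q d^n share one type.\<close>

definition shift :: "rat \<Rightarrow> complex3 \<Rightarrow> complex3" where
  "shift q = (\<lambda>(l, s, \<tau>). (l, s, \<tau> + 2 * of_real pi * \<i> * of_rat q))"

lemma open_half_space: "open half_space"
proof -
  have eq: "half_space = {z. Re (snd (snd z)) > 0}" by (auto simp: half_space_def)
  show ?thesis unfolding eq by (intro open_Collect_less continuous_intros)
qed

lemma convex_half_space: "convex half_space"
proof -
  have eq: "half_space = UNIV \<times> UNIV \<times> {z. Re z > 0}" by (auto simp: half_space_def)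
  show ?thesis unfolding eq by (intro convex_Times convex_UNIV convex_halfspace_Re_gt)
qed

lemma open_model_space: "open model_space"
  unfolding model_space_def by (intro open_Times open_UNIV open_Compl closed_cball)

lemma mem_model_space: "(l, s, t) \<in> model_space \<longleftrightarrow> norm t > 1"
  by (auto simp: model_space_def)

lemma exp3_in_model: "exp3 z \<in> model_space \<longleftrightarrow> z \<in> half_space"
  by (cases z) (auto simp: exp3_def half_space_def mem_model_space)

lemma exp3_image: "exp3 ` half_space = model_space"
proof (intro equalityI subsetI)
  fix z assume z: "z \<in> model_space"
  obtain l s t where lst: "z = (l, s, t)" by (metis prod.exhaust)
  then have "t \<noteq> 0" using z by (auto simp: mem_model_space)
  then have "z = exp3 (l, s, Ln t)" by (simp add: exp3_def lst)
  then show "z \<in> exp3 ` half_space" using z exp3_in_model by blast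
qed (use exp3_in_model in auto)

lemma holomorphic3_exp3: "holomorphic3 exp3 UNIV"
proof -
  have "holomorphic3 (\<lambda>z. (fst z, fst (snd z), exp (snd (snd z)))) UNIV"
    by (intro holomorphic3_components hol_intros open_UNIV)
  then show ?thesis by (simp add: exp3_def split_beta')
qed

lemma holomorphic3_shift: "holomorphic3 (shift q) UNIV"
proof -
  have "holomorphic3 (\<lambda>z. (fst z, fst (snd z), snd (snd z) + 2 * of_real pi * \<i> * of_rat q)) UNIV"
    by (intro holomorphic3_components hol_intros open_UNIV)
  then show ?thesis by (simp add: shift_def split_beta')
qed

lemma shift_add: "shift q (shift q' z) = shift (q + q') z"
  by (cases z) (simp add: shift_def of_rat_add algebra_simps)

lemma shift_0 [simp]: "shift 0 z = z"
  by (cases z) (simp add: shift_def)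

lemma shift_half_space [simp]: "shift q z \<in> half_space \<longleftrightarrow> z \<in> half_space"
proof -
  have "(of_rat q :: complex) = of_real (of_rat q)"
    by (cases q) (simp add: of_rat_rat)
  then have "Re (2 * of_real pi * \<i> * of_rat q) = 0" by simp
  then show ?thesis by (cases z) (simp add: shift_def half_space_def)
qed

lemma shift_eq_imp: "shift q z = shift q' z \<Longrightarrow> q = q'"
  by (cases z) (simp add: shift_def)

lemma exp3_eq_iff: "exp3 z = exp3 z' \<longleftrightarrow> (\<exists>k\<in>\<int>. z' = shift k z)"
proof -
  obtain l s \<tau> l' s' \<tau>' where z: "z = (l, s, \<tau>)" "z' = (l', s', \<tau>')" by (metis prod.exhaust)
  have "exp \<tau>' = exp \<tau> \<longleftrightarrow> (\<exists>k\<in>\<int>. \<tau>' = \<tau> + 2 * of_real pi * \<i> * of_rat k)"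
    unfolding exp_eq by (auto simp: Ints_def mult_ac)
  then show ?thesis by (auto simp: z exp3_def shift_def)
qed

lemma exp3_local_biholomorphic:
  assumes "open S" and S: "\<And>l s \<tau>. (l, s, \<tau>) \<in> S \<Longrightarrow> \<bar>Im \<tau> - a\<bar> < pi"
  shows "biholomorphic3 exp3 S (exp3 ` S)"
proof -
  have "biholomorphic3 (\<lambda>(l, s, \<tau>). (l, s, (\<lambda>(l, s, \<tau>). exp \<tau>) (l, s, \<tau>))) S
      ((\<lambda>(l, s, \<tau>). (l, s, (\<lambda>(l, s, \<tau>). exp \<tau>) (l, s, \<tau>))) ` S)"
  proof (rule biholomorphic3_shear3)
    have "hol (\<lambda>z. exp (snd (snd z))) S" by (intro hol_intros assms(1))
    then show "hol (\<lambda>(l, s, \<tau>). exp \<tau>) S" by (simp add: split_beta')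
    show "inj_on (\<lambda>x. (\<lambda>(l, s, \<tau>). exp \<tau>) (l, s, x)) {x. (l, s, x) \<in> S}" for l s
    proof (rule inj_onI)
      fix x y assume xy: "x \<in> {x. (l, s, x) \<in> S}" "y \<in> {x. (l, s, x) \<in> S}"
        "(\<lambda>(l, s, \<tau>). exp \<tau>) (l, s, x) = (\<lambda>(l, s, \<tau>). exp \<tau>) (l, s, y)"
      then have "\<bar>Im x - Im y\<bar> < 2 * pi" using S[of l s x] S[of l s y] by (simp add: abs_less_iff)
      then show "x = y" using xy(3) by (auto intro: exp_complex_eqI)
    qed
    show "deriv (\<lambda>x. (\<lambda>(l, s, \<tau>). exp \<tau>) (l, s, x)) \<tau> \<noteq> 0" for l s \<tau>
      by (simp add: DERIV_imp_deriv[OF DERIV_exp])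
  qed
  then show ?thesis by (simp add: exp3_def)
qed

lemma exp3_nbhd:
  assumes z: "z \<in> half_space" and e: "0 < e" "e \<le> pi"
  defines "S \<equiv> half_space \<inter> {y. \<bar>Im (snd (snd y)) - Im (snd (snd z))\<bar> < e}"
  shows "open S" "z \<in> S" "biholomorphic3 exp3 S (exp3 ` S)"
proof -
  show S: "open S" unfolding S_def
    by (intro open_Int open_half_space open_Collect_less continuous_intros)
  show "z \<in> S" using assms by (simp add: S_def)
  show "biholomorphic3 exp3 S (exp3 ` S)"
    by (rule exp3_local_biholomorphic[OF S, of "Im (snd (snd z))"]) (use e in \<open>auto simp: S_def\<close>)
qed

lemma exp3_open_map: "open N \<Longrightarrow> N \<subseteq> half_space \<Longrightarrow> open (exp3 ` N)"
  by (rule local_biholomorphic_open_map[of half_space])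
    (use exp3_nbhd[OF _ pi_gt_zero order_refl] in blast)+

lemma exp3_cont: "continuous_on S exp3"
  using holomorphic3_imp_continuous_on[OF holomorphic3_exp3] continuous_on_subset by blast

text \<open>Gives at once that \<open>exp3\<close> is a covering and that the fundamental group of
  the model is \<int>.\<close>

interpretation exp_deck: deck_action integer_group half_space exp3 model_space "\<lambda>k. shift (of_int k)"
proof (intro deck_action.intro deck_action_axioms.intro group_integer_group)
  show "\<exists>N. open N \<and> z \<in> N \<and> N \<subseteq> half_space \<and> inj_on exp3 N" if "z \<in> half_space" for z
    using exp3_nbhd[OF that pi_gt_zero order_refl]
    by (intro exI[of _ "half_space \<inter> {y. \<bar>Im (snd (snd y)) - Im (snd (snd z))\<bar> < pi}"])
      (auto simp: biholomorphic3_def bij_betw_def)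
  show "continuous_on half_space (shift (of_int g))" for g
    using holomorphic3_imp_continuous_on[OF holomorphic3_shift] continuous_on_subset by blast
  show "g = \<one>\<^bsub>integer_group\<^esub>" if "shift (of_int g) z = z" for g z
    using shift_eq_imp[of "of_int g" z 0] that by (simp add: integer_group_def)
  show "exp3 z = exp3 z' \<longleftrightarrow> (\<exists>g\<in>carrier integer_group. z' = shift (of_int g) z)" for z z'
    by (auto simp: exp3_eq_iff Ints_def)
qed (auto simp: open_half_space exp3_cont exp3_image exp3_open_map integer_group_def shift_add)

section \<open>The covering of the escaping region by the model, and its deck group on the universal
  cover\<close>

locale henon_covering =
  fixes d :: nat and c \<delta> :: complex and Q :: "complex \<Rightarrow> complex poly" and H :: "complex3 \<Rightarrow> complex3"
    and V U :: "complex3 set" and \<Psi> :: "complex3 \<Rightarrow> complex3"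
  assumes d: "d \<ge> 2" and c: "c \<noteq> 0" and \<delta>: "\<delta> \<noteq> 0"
    and hol_Q: "hol (\<lambda>(l, s, t). poly (Q l) t) UNIV"
    and H: "biholomorphic3 H UNIV UNIV"
    and U: "U = (\<Union>n. (H ^^ n) -` V)"
    and \<Psi>: "biholomorphic3 \<Psi> V (\<Psi> ` V)" "\<Psi> ` V \<subseteq> model_space"
    and H_V: "\<And>z. z \<in> V \<Longrightarrow> H z \<in> V"
    and \<Psi>_H: "\<And>z. z \<in> V \<Longrightarrow> \<Psi> (H z) = model_map d c \<delta> Q (\<Psi> z)"
    and absorb: "\<And>z. z \<in> model_space \<Longrightarrow> \<exists>n. (model_map d c \<delta> Q ^^ n) z \<in> \<Psi> ` V"
begin

abbreviation "F \<equiv> model_map d c \<delta> Q"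

text \<open>\<open>F\<close> is d-to-one in t, but with t = exp \<tau> it lifts to a triangular map
  with \<tau> \<mapsto> d \<tau>, which can be solved for l, then \<tau>, then s.\<close>

definition Ft :: "complex3 \<Rightarrow> complex3" where
  "Ft = (\<lambda>(l, s, \<tau>). (c * l, \<delta> / of_nat d * s + poly (Q l) (exp \<tau>), of_nat d * \<tau>))"

definition Fti :: "complex3 \<Rightarrow> complex3" where
  "Fti = (\<lambda>(l, s, \<tau>). (l / c, of_nat d / \<delta> * (s - poly (Q (l / c)) (exp (\<tau> / of_nat d))), \<tau> / of_nat d))"

definition Hi :: "complex3 \<Rightarrow> complex3" where
  "Hi = the_inv_into UNIV H"

definition \<Psi>i :: "complex3 \<Rightarrow> complex3" where
  "\<Psi>i = the_inv_into V \<Psi>"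

lemma Ft_inv [simp]: "Fti (Ft z) = z" "Ft (Fti z) = z"
  using d c \<delta> by (cases z; simp add: Ft_def Fti_def)+

lemma hol_Q_compose: "hol f S \<Longrightarrow> hol g S \<Longrightarrow> hol (\<lambda>z. poly (Q (f z)) (g z)) S"
  using hol_compose3[OF hol_Q, of f S "\<lambda>_. 0" g] hol_open by auto

lemma Ft_biholomorphic: "biholomorphic3 Ft UNIV UNIV" "biholomorphic3 Fti UNIV UNIV"
proof -
  have "holomorphic3 (\<lambda>z. (c * fst z, \<delta> / of_nat d * fst (snd z) + poly (Q (fst z)) (exp (snd (snd z))),
      of_nat d * snd (snd z))) UNIV"
    by (intro holomorphic3_components hol_intros hol_Q_compose open_UNIV)
  then have 1: "holomorphic3 Ft UNIV" by (simp add: Ft_def split_beta')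
  have "holomorphic3 (\<lambda>z. (fst z / c, of_nat d / \<delta> * (fst (snd z) - poly (Q (fst z / c)) (exp (snd (snd z) / of_nat d))),
      snd (snd z) / of_nat d)) UNIV"
    using c d by (intro holomorphic3_components hol_intros hol_Q_compose hol_divide open_UNIV) auto
  then have 2: "holomorphic3 Fti UNIV" by (simp add: Fti_def split_beta')
  show "biholomorphic3 Ft UNIV UNIV" "biholomorphic3 Fti UNIV UNIV"
    by (rule biholomorphic3I[OF 1 2] biholomorphic3I[OF 2 1]; simp)+
qed

lemma Ft_iter_inv [simp]: "(Fti ^^ n) ((Ft ^^ n) z) = z" "(Ft ^^ n) ((Fti ^^ n) z) = z"
  by (induction n arbitrary: z) (simp_all add: funpow_swap1)

lemma Hi [simp]: "Hi (H z) = z" "H (Hi z) = z"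
  using H by (auto simp: Hi_def biholomorphic3_def bij_betw_def the_inv_into_f_f f_the_inv_into_f)

lemma H_iter_inv [simp]: "(Hi ^^ n) ((H ^^ n) z) = z" "(H ^^ n) ((Hi ^^ n) z) = z"
  by (induction n arbitrary: z) (simp_all add: funpow_swap1)

lemma Hi_biholomorphic: "biholomorphic3 Hi UNIV UNIV"
  using H by (intro biholomorphic3_inverse[of H]) (auto simp: biholomorphic3_def Hi_def[symmetric])

lemma \<Psi>i: "z \<in> V \<Longrightarrow> \<Psi>i (\<Psi> z) = z" "w \<in> \<Psi> ` V \<Longrightarrow> \<Psi>i w \<in> V" "w \<in> \<Psi> ` V \<Longrightarrow> \<Psi> (\<Psi>i w) = w"
  using \<Psi>(1) by (auto simp: \<Psi>i_def biholomorphic3_def bij_betw_def the_inv_into_f_f)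

lemma \<Psi>i_biholomorphic: "biholomorphic3 \<Psi>i (\<Psi> ` V) V"
  using \<Psi>(1) \<Psi>i by (intro biholomorphic3_inverse[of \<Psi>]) (auto simp: biholomorphic3_def \<Psi>i_def[symmetric])

lemma F_\<Psi>V: "w \<in> \<Psi> ` V \<Longrightarrow> F w \<in> \<Psi> ` V" "w \<in> \<Psi> ` V \<Longrightarrow> \<Psi>i (F w) = H (\<Psi>i w)"
  using \<Psi>_H H_V \<Psi>i(1) by (metis image_iff)+

lemma F_iter_\<Psi>V: "w \<in> \<Psi> ` V \<Longrightarrow> (F ^^ n) w \<in> \<Psi> ` V"
  by (induction n) (auto simp: F_\<Psi>V)

lemma F_iter_mono: "(F ^^ n) w \<in> \<Psi> ` V \<Longrightarrow> n \<le> n' \<Longrightarrow> (F ^^ n') w \<in> \<Psi> ` V"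
  using F_iter_\<Psi>V[of "(F ^^ n) w" "n' - n"] by (simp add: funpow_add[symmetric, THEN fun_cong, unfolded o_def])

definition proj :: "complex3 \<Rightarrow> complex3" where
  "proj z = (let n = LEAST n. (F ^^ n) z \<in> \<Psi> ` V in (Hi ^^ n) (\<Psi>i ((F ^^ n) z)))"

text \<open>Any entry time gives the same point, since \<open>\<Psi>i\<close> turns \<open>F\<close>
  into \<open>H\<close> on the image of \<open>V\<close>, and the additional step is undone by one
  more \<open>Hi\<close>.\<close>

lemma proj_eq:
  assumes "(F ^^ n) z \<in> \<Psi> ` V"
  shows "proj z = (Hi ^^ n) (\<Psi>i ((F ^^ n) z))"
proof -
  define N where "N = (LEAST n. (F ^^ n) z \<in> \<Psi> ` V)"
  have N: "(F ^^ N) z \<in> \<Psi> ` V" "N \<le> n"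
    unfolding N_def using assms by (rule LeastI, rule Least_le)
  have "(Hi ^^ (N + j)) (\<Psi>i ((F ^^ (N + j)) z)) = (Hi ^^ N) (\<Psi>i ((F ^^ N) z))" for j
  proof (induction j)
    case (Suc j)
    have "(F ^^ (N + j)) z \<in> \<Psi> ` V" using F_iter_mono[OF N(1)] by simp
    then have "\<Psi>i ((F ^^ (N + Suc j)) z) = H (\<Psi>i ((F ^^ (N + j)) z))" by (simp add: F_\<Psi>V)
    then show ?case using Suc by (simp add: funpow_swap1)
  qed simp
  from this[of "n - N"] show ?thesis using N(2) by (simp add: proj_def N_def[symmetric])
qed

lemma F_model: "z \<in> model_space \<Longrightarrow> F z \<in> model_space"
  using d by (cases z) (auto simp: model_map_def mem_model_space norm_power intro: one_less_power)

lemma F_exp3: "F (exp3 z) = exp3 (Ft z)"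
  by (cases z) (simp add: model_map_def exp3_def Ft_def exp_of_nat_mult)

lemma F_iter_exp3: "(F ^^ n) (exp3 z) = exp3 ((Ft ^^ n) z)"
  by (induction n) (auto simp: F_exp3)

lemma Ft_third: "snd (snd ((Ft ^^ n) z)) = of_nat d ^ n * snd (snd z)"
  by (induction n) (auto simp: Ft_def split_beta)

lemma Ft_half_space: "(Ft ^^ n) z \<in> half_space \<longleftrightarrow> z \<in> half_space"
proof -
  have mem: "y \<in> half_space \<longleftrightarrow> Re (snd (snd y)) > 0" for y by (auto simp: half_space_def)
  have "Re (of_nat d ^ n * w) = real d ^ n * Re w" for w
    by (simp flip: of_nat_power)
  then show ?thesis using d unfolding mem Ft_third by (simp add: zero_less_mult_iff)
qed

lemma Fti_half_space: "(Fti ^^ n) z \<in> half_space \<longleftrightarrow> z \<in> half_space"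
  using Ft_half_space[of n "(Fti ^^ n) z"] by simp

text \<open>For surjectivity the chart value of H^n u has to be pulled back n steps under the
  non-injective \<open>F\<close>; a preimage is found by lifting to the half-space and applying
  \<open>Fti\<close>.\<close>

lemma proj_U: "proj ` model_space = U"
proof (intro equalityI subsetI)
  fix u assume "u \<in> proj ` model_space"
  then obtain z where z: "z \<in> model_space" "u = proj z" by blast
  then obtain n where n: "(F ^^ n) z \<in> \<Psi> ` V" using absorb by blast
  then have "(H ^^ n) u \<in> V" using proj_eq[OF n] z \<Psi>i(2)[OF n] by simp
  then show "u \<in> U" unfolding U by blast
next
  fix u assume "u \<in> U"
  then obtain n where n: "(H ^^ n) u \<in> V" unfolding U by blast
  then have w: "\<Psi> ((H ^^ n) u) \<in> \<Psi> ` V" by blast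
  then obtain e where e: "e \<in> half_space" "\<Psi> ((H ^^ n) u) = exp3 e"
    using \<Psi>(2) exp3_image by blast
  have F: "(F ^^ n) (exp3 ((Fti ^^ n) e)) = \<Psi> ((H ^^ n) u)"
    by (simp add: F_iter_exp3 e(2))
  then have "proj (exp3 ((Fti ^^ n) e)) = u"
    using proj_eq[of n "exp3 ((Fti ^^ n) e)"] w \<Psi>i(1)[OF n] by simp
  moreover have "exp3 ((Fti ^^ n) e) \<in> model_space"
    using e Fti_half_space exp3_in_model by blast
  ultimately show "u \<in> proj ` model_space" by blast
qed

lemma proj_F:
  assumes "z \<in> model_space"
  shows "proj (F z) = H (proj z)"
proof -
  obtain n where n: "(F ^^ n) (F z) \<in> \<Psi> ` V" using absorb F_model[OF assms] by blast
  have S: "(F ^^ Suc n) z = (F ^^ n) (F z)" by (simp add: funpow_swap1)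
  then have "(F ^^ Suc n) z \<in> \<Psi> ` V" using n by (simp only:)
  from proj_eq[OF this] have "proj z = Hi (proj (F z))"
    unfolding S proj_eq[OF n] by simp
  then show ?thesis by simp
qed

text \<open>At a common late time both orbits are in the image of the chart, where
  \<open>\<Psi>i\<close> is injective, and H^n is a bijection; orbits that have merged stay
  merged.\<close>

lemma proj_eq_iff:
  assumes "z \<in> model_space" "z' \<in> model_space"
  shows "proj z = proj z' \<longleftrightarrow> (\<exists>n. (F ^^ n) z = (F ^^ n) z')"
proof -
  obtain n0 n1 where "(F ^^ n0) z \<in> \<Psi> ` V" "(F ^^ n1) z' \<in> \<Psi> ` V" using absorb assms by blast
  then have n: "(F ^^ n) z \<in> \<Psi> ` V" "(F ^^ n) z' \<in> \<Psi> ` V" if "n \<ge> max n0 n1" for n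
    using F_iter_mono that by auto
  show ?thesis
  proof
    assume "proj z = proj z'"
    let ?n = "max n0 n1"
    have "(H ^^ ?n) (proj z) = \<Psi>i ((F ^^ ?n) z)" "(H ^^ ?n) (proj z') = \<Psi>i ((F ^^ ?n) z')"
      using proj_eq[OF n(1)[OF order_refl]] proj_eq[OF n(2)[OF order_refl]] by simp_all
    then have "\<Psi> (\<Psi>i ((F ^^ ?n) z)) = \<Psi> (\<Psi>i ((F ^^ ?n) z'))" using \<open>proj z = proj z'\<close> by simp
    then have "(F ^^ ?n) z = (F ^^ ?n) z'" using \<Psi>i(3) n by simp
    then show "\<exists>n. (F ^^ n) z = (F ^^ n) z'" by blast
  next
    assume "\<exists>n. (F ^^ n) z = (F ^^ n) z'"
    then obtain k where "(F ^^ k) z = (F ^^ k) z'" by blast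
    then have "(F ^^ (max n0 n1 + k)) z = (F ^^ (max n0 n1 + k)) z'"
      by (simp add: funpow_add)
    then show "proj z = proj z'"
      using proj_eq[OF n(1)[of "max n0 n1 + k"]] proj_eq[OF n(2)[of "max n0 n1 + k"]] by simp
  qed
qed

lemma proj_exp3_local:
  assumes z: "z \<in> half_space"
  obtains S where "open S" "z \<in> S" "S \<subseteq> half_space" "biholomorphic3 exp3 S (exp3 ` S)"
    "biholomorphic3 (\<lambda>z. proj (exp3 z)) S ((\<lambda>z. proj (exp3 z)) ` S)"
proof -
  obtain n where n: "(F ^^ n) (exp3 z) \<in> \<Psi> ` V" using absorb z exp3_in_model by blast
  \<comment> \<open>\<open>Ft\<close>^n multiplies a strip of half-height e by d^n; the image has
    half-height pi, the largest on which \<open>exp3\<close> is injective.\<close>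
  define e where "e = pi / of_nat d ^ n"
  have dn: "real d ^ n \<ge> 1" using d by (simp add: one_le_power)
  then have dnp: "real d ^ n > 0" by linarith
  then have e: "0 < e" "e \<le> pi"
    using mult_left_mono[OF dn, of pi] by (auto simp: e_def divide_le_eq)
  define S0 where "S0 = half_space \<inter> {y. \<bar>Im (snd (snd y)) - Im (snd (snd z))\<bar> < e}"
  define S where "S = S0 \<inter> (\<lambda>y. exp3 ((Ft ^^ n) y)) -` (\<Psi> ` V)"
  note S0 = exp3_nbhd[OF z e, folded S0_def]
  have cF: "continuous_on UNIV (Ft ^^ n)" for n
    using biholomorphic3_funpow[OF Ft_biholomorphic(1)] holomorphic3_imp_continuous_on
    by (auto simp: biholomorphic3_def)
  have oV: "open (\<Psi> ` V)" using \<Psi>(1) by (auto simp: biholomorphic3_def holomorphic3_def)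
  have "continuous_on S0 (\<lambda>y. exp3 ((Ft ^^ n) y))"
    by (intro continuous_on_compose2[OF exp3_cont[of UNIV]] continuous_on_subset[OF cF]) auto
  then have oS: "open S" unfolding S_def using S0(1) oV by (rule continuous_open_preimage)
  have zS: "z \<in> S" using S0(2) n by (simp add: S_def F_iter_exp3)
  have SH: "S \<subseteq> half_space" by (auto simp: S_def S0_def)
  have bS: "biholomorphic3 exp3 S (exp3 ` S)"
    by (rule biholomorphic3_subset[OF S0(3) oS]) (auto simp: S_def)
  have b1: "biholomorphic3 (Ft ^^ n) S ((Ft ^^ n) ` S)"
    by (rule biholomorphic3_subset[OF biholomorphic3_funpow[OF Ft_biholomorphic(1)] oS]) auto
  have "biholomorphic3 exp3 ((Ft ^^ n) ` S) (exp3 ` (Ft ^^ n) ` S)"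
  proof (rule exp3_local_biholomorphic[of _ "real d ^ n * Im (snd (snd z))"])
    show "open ((Ft ^^ n) ` S)" using b1 by (auto simp: biholomorphic3_def holomorphic3_def)
    fix l s \<tau> assume "(l, s, \<tau>) \<in> (Ft ^^ n) ` S"
    then obtain y where y: "y \<in> S" "(l, s, \<tau>) = (Ft ^^ n) y" by blast
    have "\<tau> = of_nat d ^ n * snd (snd y)" using Ft_third[of n y] by (simp flip: y(2))
    then have "Im \<tau> = real d ^ n * Im (snd (snd y))" by (simp flip: of_nat_power)
    then have "\<bar>Im \<tau> - real d ^ n * Im (snd (snd z))\<bar> = real d ^ n * \<bar>Im (snd (snd y)) - Im (snd (snd z))\<bar>"
      using dn by (simp flip: right_diff_distrib add: abs_mult)
    also have "\<dots> < real d ^ n * e"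
      using y(1) d by (intro mult_strict_left_mono) (auto simp: S_def S0_def)
    also have "\<dots> = pi" using d by (simp add: e_def)
    finally show "\<bar>Im \<tau> - real d ^ n * Im (snd (snd z))\<bar> < pi" .
  qed
  note b2 = biholomorphic3_compose_image[OF b1 this order_refl]
  have Vi: "biholomorphic3 \<Psi>i (\<Psi> ` V) (\<Psi>i ` \<Psi> ` V)"
    using \<Psi>i_biholomorphic by (simp add: biholomorphic3_def bij_betw_def)
  have b3: "biholomorphic3 (\<lambda>y. \<Psi>i (exp3 ((Ft ^^ n) y))) S ((\<lambda>y. \<Psi>i (exp3 ((Ft ^^ n) y))) ` S)"
    by (rule biholomorphic3_compose_image[OF b2 Vi]) (auto simp: S_def)
  have Hin: "biholomorphic3 (Hi ^^ n) UNIV ((Hi ^^ n) ` UNIV)"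
    using biholomorphic3_funpow[OF Hi_biholomorphic, of n] by (simp add: biholomorphic3_def bij_betw_def)
  have "biholomorphic3 (\<lambda>y. (Hi ^^ n) (\<Psi>i (exp3 ((Ft ^^ n) y)))) S ((\<lambda>y. (Hi ^^ n) (\<Psi>i (exp3 ((Ft ^^ n) y)))) ` S)"
    by (rule biholomorphic3_compose_image[OF b3 Hin]) simp
  moreover have eq: "proj (exp3 y) = (Hi ^^ n) (\<Psi>i (exp3 ((Ft ^^ n) y)))" if "y \<in> S" for y
    using proj_eq[of n "exp3 y"] that by (simp add: S_def F_iter_exp3)
  then have "(\<lambda>y. (Hi ^^ n) (\<Psi>i (exp3 ((Ft ^^ n) y)))) ` S = (\<lambda>z. proj (exp3 z)) ` S"
    by auto
  ultimately have "biholomorphic3 (\<lambda>z. proj (exp3 z)) S ((\<lambda>z. proj (exp3 z)) ` S)"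
    using biholomorphic3_cong[OF _ eq] by auto
  with oS zS SH bS show thesis using that by blast
qed

lemma proj_local:
  assumes "z \<in> model_space"
  shows "\<exists>W. z \<in> W \<and> W \<subseteq> model_space \<and> biholomorphic3 proj W (proj ` W)"
proof -
  obtain e where e: "e \<in> half_space" "z = exp3 e" using assms exp3_image by blast
  obtain S where S: "open S" "e \<in> S" "S \<subseteq> half_space" "biholomorphic3 exp3 S (exp3 ` S)"
    "biholomorphic3 (\<lambda>z. proj (exp3 z)) S ((\<lambda>z. proj (exp3 z)) ` S)"
    using proj_exp3_local[OF e(1)] .
  obtain g where g: "holomorphic3 exp3 S" "holomorphic3 g (exp3 ` S)" "\<And>z. z \<in> S \<Longrightarrow> exp3 z \<in> exp3 ` S \<and> g (exp3 z) = z"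
    "\<And>z. z \<in> exp3 ` S \<Longrightarrow> g z \<in> S \<and> exp3 (g z) = z"
    by (rule biholomorphic3E[OF S(4)]) blast
  have "biholomorphic3 (\<lambda>z. proj (exp3 (g z))) (exp3 ` S) ((\<lambda>z. proj (exp3 z)) ` S)"
    by (rule biholomorphic3_compose[OF biholomorphic3_inverse[OF g] S(5)])
  then have "biholomorphic3 proj (exp3 ` S) ((\<lambda>z. proj (exp3 z)) ` S)"
    by (rule biholomorphic3_cong) (use g(4) in auto)
  then have "biholomorphic3 proj (exp3 ` S) (proj ` exp3 ` S)"
    by (simp only: image_image)
  then show ?thesis
    using S(2,3) e exp3_image by (intro exI[of _ "exp3 ` S"]) auto
qed

lemma holomorphic3_proj: "holomorphic3 proj model_space"
  by (rule holomorphic3_local[OF open_model_space]) (use proj_local in \<open>unfold biholomorphic3_def, blast\<close>)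

definition level :: "rat \<Rightarrow> nat" where
  "level q = (LEAST n. q * of_nat d ^ n \<in> \<int>)"

text \<open>The lift to the universal cover of the deck transformation \<open>t \<mapsto> exp (2 \<pi> i q) t\<close>.\<close>

definition deck :: "rat \<Rightarrow> complex3 \<Rightarrow> complex3" where
  "deck q z = (Fti ^^ level q) (shift (q * of_nat d ^ level q) ((Ft ^^ level q) z))"

text \<open>An integer shift leaves exp \<tau>, and hence the polynomial term, unchanged. This
  argument breaks down for fractional q, so \<open>deck\<close> applies \<open>Ft\<close> until q
  d^n is an integer.\<close>

lemma Ft_shift:
  assumes "q \<in> \<int>"
  shows "Ft (shift q z) = shift (q * of_nat d) (Ft z)"
proof -
  obtain l s \<tau> where z: "z = (l, s, \<tau>)" by (metis prod.exhaust)
  have "exp3 (shift q z) = exp3 z" using exp3_eq_iff assms by metis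
  then have "exp (\<tau> + 2 * of_real pi * \<i> * of_rat q) = exp \<tau>" by (simp add: exp3_def shift_def z)
  then show ?thesis
    by (simp add: Ft_def shift_def z of_rat_mult algebra_simps)
qed

text \<open>Once q d^n is an integer, a further step cancels by \<open>Ft_shift\<close>; a common n
  can then be chosen for several group elements.\<close>

lemma deck_eq:
  assumes "q * of_nat d ^ n \<in> \<int>"
  shows "deck q z = (Fti ^^ n) (shift (q * of_nat d ^ n) ((Ft ^^ n) z))"
proof -
  let ?N = "level q"
  have N: "q * of_nat d ^ ?N \<in> \<int>" "?N \<le> n"
    unfolding level_def using assms by (rule LeastI, rule Least_le)
  have "(Fti ^^ (?N + j)) (shift (q * of_nat d ^ (?N + j)) ((Ft ^^ (?N + j)) z)) = deck q z" for j
  proof (induction j)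
    case 0
    then show ?case by (simp add: deck_def)
  next
    case (Suc j)
    let ?w = "(Ft ^^ (?N + j)) z" and ?q = "q * of_nat d ^ (?N + j)"
    have i: "?q \<in> \<int>" by (rule Ints_power_mono[OF N(1)]) simp
    have "shift (q * of_nat d ^ (?N + Suc j)) ((Ft ^^ (?N + Suc j)) z) = Ft (shift ?q ?w)"
      unfolding Ft_shift[OF i] by (simp add: mult_ac)
    then have "(Fti ^^ (?N + Suc j)) (shift (q * of_nat d ^ (?N + Suc j)) ((Ft ^^ (?N + Suc j)) z)) =
        (Fti ^^ (?N + j)) (Fti (Ft (shift ?q ?w)))"
      by (simp add: funpow_swap1)
    then show ?case using Suc by simp
  qed
  from this[of "n - ?N"] show ?thesis using N(2) by simp
qed

lemma deck_int: "q \<in> \<int> \<Longrightarrow> deck q z = shift q z"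
  using deck_eq[of q 0 z] by simp

lemma deck_half_space: "deck q z \<in> half_space \<longleftrightarrow> z \<in> half_space"
  by (simp add: deck_def Fti_half_space Ft_half_space)

lemma Fti_third: "snd (snd ((Fti ^^ n) z)) = snd (snd z) / of_nat d ^ n"
  using Ft_third[of n "(Fti ^^ n) z"] d by (simp add: field_simps)

text \<open>The third coordinates of \<open>Ft\<close> and \<open>Fti\<close> are linear, so the
  shift of \<tau> is known whatever happens to s; freeness of the action rests on this.\<close>

lemma deck_third: "snd (snd (deck q z)) = snd (snd z) + 2 * of_real pi * \<i> * of_rat q"
proof -
  have "snd (snd (shift x y)) = snd (snd y) + 2 * of_real pi * \<i> * of_rat x" for x y
    by (cases y) (simp add: shift_def)
  then show ?thesis
    using d by (simp add: deck_def Fti_third Ft_third of_rat_mult of_rat_power field_simps)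
qed

text \<open>Orbits on the model have merged after n steps exactly when the lifted orbits differ by
  an integer shift k at time n; undoing the n steps gives the group element q = k / d^n.\<close>

lemma proj_deck: "proj (exp3 z) = proj (exp3 z') \<longleftrightarrow> (\<exists>q\<in>carrier (Z_inverse_group d). z' = deck q z)"
  if "z \<in> half_space" "z' \<in> half_space"
proof -
  have d0: "d > 0" using d by simp
  have "proj (exp3 z) = proj (exp3 z') \<longleftrightarrow> (\<exists>n. exp3 ((Ft ^^ n) z) = exp3 ((Ft ^^ n) z'))"
    using proj_eq_iff[of "exp3 z" "exp3 z'"] that by (simp add: exp3_in_model F_iter_exp3)
  also have "\<dots> \<longleftrightarrow> (\<exists>n. \<exists>k\<in>\<int>. (Ft ^^ n) z' = shift k ((Ft ^^ n) z))"
    by (simp only: exp3_eq_iff)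
  also have "\<dots> \<longleftrightarrow> (\<exists>q\<in>carrier (Z_inverse_group d). z' = deck q z)"
  proof
    assume "\<exists>n. \<exists>k\<in>\<int>. (Ft ^^ n) z' = shift k ((Ft ^^ n) z)"
    then obtain n k where k: "k \<in> \<int>" "(Ft ^^ n) z' = shift k ((Ft ^^ n) z)" by blast
    have q: "k / of_nat d ^ n * of_nat d ^ n = k" using d0 by simp
    have "z' = (Fti ^^ n) (shift k ((Ft ^^ n) z))" using k(2) Ft_iter_inv(1) by metis
    then have "z' = deck (k / of_nat d ^ n) z" using deck_eq[of "k / of_nat d ^ n" n z] k(1) q by simp
    moreover have "k / of_nat d ^ n \<in> carrier (Z_inverse_group d)"
      unfolding Z_inverse_group_carrier[OF d0] using q k(1) by metis
    ultimately show "\<exists>q\<in>carrier (Z_inverse_group d). z' = deck q z" by blast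
  next
    assume "\<exists>q\<in>carrier (Z_inverse_group d). z' = deck q z"
    then obtain q n where q: "z' = deck q z" "q * of_nat d ^ n \<in> \<int>"
      using Z_inverse_group_carrier[OF d0] by blast
    then have "(Ft ^^ n) z' = shift (q * of_nat d ^ n) ((Ft ^^ n) z)"
      using deck_eq[OF q(2), of z] by simp
    with q(2) show "\<exists>n. \<exists>k\<in>\<int>. (Ft ^^ n) z' = shift k ((Ft ^^ n) z)" by blast
  qed
  finally show ?thesis .
qed

lemma deck_action_proj: "deck_action (Z_inverse_group d) half_space (\<lambda>z. proj (exp3 z)) U deck"
proof (intro deck_action.intro deck_action_axioms.intro)
  have d0: "d > 0" using d by simp
  show "group (Z_inverse_group d)" by (rule group_Z_inverse_group[OF d0])
  show "open half_space" by (rule open_half_space)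
  show "continuous_on half_space (\<lambda>z. proj (exp3 z))"
    by (rule continuous_on_compose2[OF holomorphic3_imp_continuous_on[OF holomorphic3_proj] exp3_cont])
      (use exp3_image in auto)
  have "(\<lambda>z. proj (exp3 z)) ` half_space = proj ` exp3 ` half_space" by (simp only: image_image)
  then show "(\<lambda>z. proj (exp3 z)) ` half_space = U" by (simp only: exp3_image proj_U)
  show "open ((\<lambda>z. proj (exp3 z)) ` N)" if "open N" "N \<subseteq> half_space" for N
  proof (rule local_biholomorphic_open_map[OF _ that])
    fix z assume "z \<in> half_space"
    then show "\<exists>W. z \<in> W \<and> W \<subseteq> half_space \<and>
        biholomorphic3 (\<lambda>z. proj (exp3 z)) W ((\<lambda>z. proj (exp3 z)) ` W)"
      by (rule proj_exp3_local) blast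
  qed
  show "\<exists>N. open N \<and> z \<in> N \<and> N \<subseteq> half_space \<and> inj_on (\<lambda>z. proj (exp3 z)) N" if "z \<in> half_space" for z
    by (rule proj_exp3_local[OF that]) (auto simp: biholomorphic3_def bij_betw_def)
  show "deck g z \<in> half_space" if "z \<in> half_space" for g z using that deck_half_space by blast
  show "continuous_on half_space (deck g)" for g
  proof -
    have "continuous_on UNIV (Ft ^^ n)" "continuous_on UNIV (Fti ^^ n)" for n
      using biholomorphic3_funpow[OF Ft_biholomorphic(1)] biholomorphic3_funpow[OF Ft_biholomorphic(2)]
        holomorphic3_imp_continuous_on by (auto simp: biholomorphic3_def)
    then have "continuous_on UNIV (\<lambda>z. (Fti ^^ level g) (shift (g * of_nat d ^ level g) ((Ft ^^ level g) z)))"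
      by (intro continuous_on_compose2[OF _ continuous_on_compose2[OF
            holomorphic3_imp_continuous_on[OF holomorphic3_shift]]]) auto
    then show ?thesis unfolding deck_def[abs_def] using continuous_on_subset by blast
  qed
  show "deck \<one>\<^bsub>Z_inverse_group d\<^esub> z = z" for z
    using deck_int[of 0 z] by (simp add: Z_inverse_group_def)
  show "deck (g \<otimes>\<^bsub>Z_inverse_group d\<^esub> h) z = deck g (deck h z)"
    if gh: "g \<in> carrier (Z_inverse_group d)" "h \<in> carrier (Z_inverse_group d)" for g h z
  proof -
    obtain n n' where "g * of_nat d ^ n \<in> \<int>" "h * of_nat d ^ n' \<in> \<int>"
      using gh Z_inverse_group_carrier[OF d0] by blast
    then have i: "g * of_nat d ^ (max n n') \<in> \<int>" "h * of_nat d ^ (max n n') \<in> \<int>"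
      by (auto intro: Ints_power_mono)
    then have "(g + h) * of_nat d ^ (max n n') \<in> \<int>" by (simp add: distrib_right)
    from deck_eq[OF this, of z] deck_eq[OF i(1)] deck_eq[OF i(2)] show ?thesis
      by (simp add: Z_inverse_group_def shift_add distrib_right)
  qed
  show "g = \<one>\<^bsub>Z_inverse_group d\<^esub>" if "deck g z = z" for g z
    using deck_third[of g z] that by (simp add: Z_inverse_group_def)
  show "proj (exp3 z) = proj (exp3 z') \<longleftrightarrow> (\<exists>g\<in>carrier (Z_inverse_group d). z' = deck g z)"
    if "z \<in> half_space" "z' \<in> half_space" for z z' by (rule proj_deck[OF that])
qed

end


section \<open>The fundamental group of the escaping region and the subgroup coming from V\<close>

lemma henon_map_biholomorphic:
  assumes "c \<noteq> 0" "\<delta> \<noteq> 0"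
  shows "biholomorphic3 (henon_map d c \<delta> C) UNIV UNIV"
proof (rule biholomorphic3I)
  have "holomorphic3 (\<lambda>z. (c * fst z, snd (snd z),
      (\<Sum>j\<le>d. poly (C j) (fst z) * snd (snd z) ^ j) - \<delta> * fst (snd z))) UNIV"
    by (intro holomorphic3_components hol_intros open_UNIV)
  then show "holomorphic3 (henon_map d c \<delta> C) UNIV" by (simp add: henon_map_def split_beta')
  let ?g = "\<lambda>(l, x, y). (l / c, ((\<Sum>j\<le>d. poly (C j) (l / c) * x ^ j) - y) / \<delta>, x)"
  have "holomorphic3 (\<lambda>z. (fst z / c, ((\<Sum>j\<le>d. poly (C j) (fst z / c) * fst (snd z) ^ j) - snd (snd z)) / \<delta>,
      fst (snd z))) UNIV"
    using assms by (intro holomorphic3_components hol_intros hol_divide open_UNIV) auto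
  then show "holomorphic3 ?g UNIV" by (simp add: split_beta')
  show "henon_map d c \<delta> C z \<in> UNIV \<and> ?g (henon_map d c \<delta> C z) = z" for z
    using assms by (cases z) (simp add: henon_map_def)
  show "?g z \<in> UNIV \<and> henon_map d c \<delta> C (?g z) = z" for z
    using assms by (cases z) (simp add: henon_map_def)
qed

theorem theorem1p3:
  fixes d :: nat and c \<delta> cd :: complex and C :: "nat \<Rightarrow> complex poly"
  assumes "d \<ge> 2"
    and "norm c > 1"
    and "\<delta> \<noteq> 0"
    and "cd \<noteq> 0"
    and "C d = [:cd:]"
  shows "\<exists>R0>0. \<forall>R\<ge>R0. \<forall>a \<in> V_plus d C R.
    let H = henon_map d c \<delta> C;
        V = V_plus d C R;
        U = U_plus d c \<delta> C R
    in \<exists>\<phi> \<in> iso (fundamental_group U a) (Z_inverse_group d).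
         \<phi> ` induced_map U id ` carrier (fundamental_group V a) = \<int> \<and>
         (\<exists>p b Q.
            holomorphic_covering model_space p U \<and>
            corresponds_to_subgroup model_space b p U a
              {A \<in> carrier (fundamental_group U a). \<phi> A \<in> \<int>} \<and>
            fundamental_group model_space b \<cong> integer_group \<and>
            (\<forall>l. degree (Q l) = d + 1) \<and>
            holomorphic3 (model_map d c \<delta> Q) model_space \<and>
            model_map d c \<delta> Q \<in> model_space \<rightarrow> model_space \<and>
            (\<forall>z\<in>model_space. p (model_map d c \<delta> Q z) = H (p z)))"
proof -
  obtain R0 where R0: "R0 > 0"
    and main: "\<And>R. R \<ge> R0 \<Longrightarrow> \<exists>\<Psi> \<alpha> g Q. henon_chart d c \<delta> C R \<Psi> \<alpha> g Q"
    using henon_semiconjugacy[where C = C and d = d, OF assms] by blast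
  show ?thesis
    unfolding Let_def
  proof (intro exI[of _ R0] conjI R0 allI impI ballI)
    fix R a assume R: "R \<ge> R0" and aV: "a \<in> V_plus d C R"
    let ?H = "henon_map d c \<delta> C" and ?V = "V_plus d C R" and ?U = "U_plus d c \<delta> C R"
    obtain \<Psi> \<alpha> g Q where chart: "henon_chart d c \<delta> C R \<Psi> \<alpha> g Q"
      using main[OF R] by blast
    then have \<Psi>: "biholomorphic3 \<Psi> ?V (\<Psi> ` ?V)" "\<Psi> ` ?V \<subseteq> model_space"
      and g: "continuous_on ?V g"
      and comps: "\<forall>l x y. (l, x, y) \<in> ?V \<longrightarrow>
        fst (\<Psi> (l, x, y)) = l \<and> snd (snd (\<Psi> (l, x, y))) = \<alpha> * y * exp (g (l, x, y))"
      and step: "\<forall>z\<in>?V. ?H z \<in> ?V \<and> \<Psi> (?H z) = model_map d c \<delta> Q (\<Psi> z)"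
      and absorb: "\<forall>z\<in>model_space. \<exists>n. (model_map d c \<delta> Q ^^ n) z \<in> \<Psi> ` ?V"
      and degQ: "\<forall>l. degree (Q l) = d + 1" and holQ: "hol (\<lambda>(l, s, t). poly (Q l) t) UNIV"
      and \<alpha>: "\<alpha> \<noteq> 0"
      unfolding henon_chart_def by blast+
    interpret cov: henon_covering d c \<delta> Q ?H ?V ?U \<Psi>
    proof
      show "c \<noteq> 0" using assms(2) by auto
      then show "biholomorphic3 ?H UNIV UNIV" using henon_map_biholomorphic assms(3) by blast
    qed (use assms \<Psi> step absorb holQ in \<open>auto simp: U_plus_def\<close>)
    interpret D: deck_action "Z_inverse_group d" half_space "\<lambda>z. cov.proj (exp3 z)" ?U cov.deck
      by (rule cov.deck_action_proj)
    obtain l x y where a: "a = (l, x, y)" by (metis prod.exhaust)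
    have lxyV: "(l, x, y) \<in> ?V" using aV a by simp
    have y0: "y \<noteq> 0" using lxyV R R0 by (auto simp: mem_V_plus)
    have cont_\<Psi>: "continuous_on ?V \<Psi>"
      using \<Psi>(1) holomorphic3_imp_continuous_on by (auto simp: biholomorphic3_def)
    \<comment> \<open>A lift of \<Psi> z to the half-space, given a logarithm \<eta> of the
      y-coordinate of z; the other summands are single-valued, so all monodromy is in
      \<eta>.\<close>
    define lift where "lift z \<eta> = (fst z, fst (snd (\<Psi> z)), Ln \<alpha> + \<eta> + g z)" for z :: complex3 and \<eta>
    have exp3_lift: "exp3 (lift z \<eta>) = \<Psi> z \<and> lift z \<eta> \<in> half_space"
      if z: "z \<in> ?V" and \<eta>: "exp \<eta> = snd (snd z)" for z \<eta>
    proof -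
      have "fst (\<Psi> z) = fst z" "snd (snd (\<Psi> z)) = \<alpha> * snd (snd z) * exp (g z)"
        using comps[rule_format, of "fst z" "fst (snd z)" "snd (snd z)"] z by simp_all
      then have "exp3 (lift z \<eta>) = \<Psi> z"
        using \<alpha> \<eta> by (simp add: lift_def exp3_def exp_add prod_eq_iff)
      then show ?thesis using z \<Psi>(2) exp3_in_model by (metis image_subset_iff)
    qed
    define e where "e = lift a (Ln y)"
    define b where "b = \<Psi> a"
    have e: "e \<in> half_space" "exp3 e = b"
      using exp3_lift[OF aV, of "Ln y"] y0 by (simp_all add: e_def b_def a)
    have proj_\<Psi>: "cov.proj (\<Psi> z) = z" if "z \<in> ?V" for z
      using cov.proj_eq[of 0 "\<Psi> z"] that cov.\<Psi>i(1) by simp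
    have Pe: "cov.proj (exp3 e) = a" using proj_\<Psi>[OF aV] e by (simp add: b_def)
    have sc: "simply_connected half_space"
      by (rule convex_imp_simply_connected[OF convex_half_space])
    have covM: "covering_space half_space exp3 model_space" by (rule exp_deck.covering)
    have Z: "\<int> \<subseteq> carrier (Z_inverse_group d)"
    proof
      fix q :: rat assume "q \<in> \<int>"
      then have "q * of_nat d ^ 0 \<in> \<int>" by simp
      then show "q \<in> carrier (Z_inverse_group d)"
        using Z_inverse_group_carrier[of d q] assms(1) by auto
    qed
    have exp3_deck: "exp3 z = exp3 z' \<longleftrightarrow> (\<exists>k\<in>\<int>. z' = cov.deck k z)" for z z'
      by (auto simp: exp3_eq_iff cov.deck_int)
    have cont_proj: "continuous_on model_space cov.proj"
      by (rule holomorphic3_imp_continuous_on[OF cov.holomorphic3_proj])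
    \<comment> \<open>The case K = \<int>: by \<open>exp3_deck\<close> the integers inside
      \<int>[1/d] have exactly the fibres of \<open>exp3\<close> as orbits, so their quotient is the
      model.\<close>
    have cov_proj: "covering_space model_space cov.proj ?U"
      by (rule D.intermediate_covering[OF Z exp3_cont exp3_image exp3_open_map cont_proj refl exp3_deck])
    define \<phi> where "\<phi> = D.deck_of e"
    have iso: "\<phi> \<in> iso (fundamental_group ?U a) (Z_inverse_group d)"
      using D.deck_of_iso[OF e(1) sc] by (simp add: \<phi>_def Pe)
    have sub: "induced_map ?U cov.proj ` carrier (fundamental_group model_space b) =
        {A \<in> carrier (fundamental_group ?U a). \<phi> A \<in> \<int>}"
      using D.intermediate_subgroup[OF e(1) sc Z covM cont_proj refl exp3_deck] e(2) Pe by (simp add: \<phi>_def)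
    have VU: "?V \<subseteq> ?U"
    proof
      fix z assume "z \<in> ?V"
      then have "(?H ^^ 0) z \<in> ?V" by simp
      then show "z \<in> ?U" unfolding U_plus_def by blast
    qed
    have carrV: "carrier (fundamental_group ?V a) = path_class ?V ` loops_at ?V a"
      by (simp add: fundamental_group_def)
    have ind: "induced_map ?U id (path_class ?V \<gamma>) = path_class ?U \<gamma>" if "\<gamma> \<in> loops_at ?V a" for \<gamma>
      using induced_map_path_class[OF continuous_on_id' _ that, of ?U] VU by (simp add: id_def o_def)
    have "\<phi> ` induced_map ?U id ` carrier (fundamental_group ?V a) = \<int>"
    proof (intro equalityI subsetI)
      fix q assume "q \<in> \<phi> ` induced_map ?U id ` carrier (fundamental_group ?V a)"
      then obtain \<gamma> where \<gamma>: "\<gamma> \<in> loops_at ?V a" "q = \<phi> (path_class ?U \<gamma>)"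
        using ind carrV by auto
      have pth: "path \<gamma>" "path_image \<gamma> \<subseteq> ?V" "pathstart \<gamma> = a" "pathfinish \<gamma> = a"
        using \<gamma>(1) by (auto simp: loops_at_def)
      have l: "\<Psi> \<circ> \<gamma> \<in> loops_at model_space b"
        using pth \<Psi>(2) continuous_on_subset[OF cont_\<Psi> pth(2)]
        by (auto simp: loops_at_def b_def path_image_compose pathstart_compose pathfinish_compose
            intro!: path_continuous_image)
      \<comment> \<open>A loop in V is the projection of its image under \<Psi>, a loop in the
        model, so \<open>sub\<close> makes its value under \<phi> an integer.\<close>
      have "homotopic_paths ?U \<gamma> (cov.proj \<circ> (\<Psi> \<circ> \<gamma>))"
      proof (rule homotopic_paths_eq)
        show "\<gamma> u = (cov.proj \<circ> (\<Psi> \<circ> \<gamma>)) u" if "u \<in> {0..1}" for u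
        proof -
          have "\<gamma> u \<in> ?V" using that pth(2) by (auto simp: path_image_def)
          from proj_\<Psi>[OF this] show ?thesis by simp
        qed
      qed (use pth VU in auto)
      then have "path_class ?U \<gamma> = induced_map ?U cov.proj (path_class model_space (\<Psi> \<circ> \<gamma>))"
        using induced_map_path_class[OF cont_proj _ l, of ?U] cov.proj_U path_class_eqI by simp
      moreover have "path_class model_space (\<Psi> \<circ> \<gamma>) \<in> carrier (fundamental_group model_space b)"
        using l by (simp add: fundamental_group_def)
      ultimately have "path_class ?U \<gamma> \<in> {A \<in> carrier (fundamental_group ?U a). \<phi> A \<in> \<int>}"
        using sub by blast
      then show "q \<in> \<int>" using \<gamma> by simp
    next
      fix q :: rat assume q: "q \<in> \<int>"
      then obtain k where k: "q = of_int k" by (rule Ints_cases)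
      \<comment> \<open>The circle (l, e^\<omega> x, e^\<omega> y) stays in V, whose conditions
        involve only |l|, |x| and |y|. Along it a logarithm of the last coordinate is Ln y +
        \<omega>, so the lift ends at the shift of \<open>e\<close> by k.\<close>
      define \<omega> where "\<omega> u = 2 * of_real pi * \<i> * of_int k * of_real u" for u :: real
      define \<gamma> where "\<gamma> u = (l, exp (\<omega> u) * x, exp (\<omega> u) * y)" for u :: real
      have Re\<omega>: "Re (\<omega> u) = 0" for u by (simp add: \<omega>_def)
      have \<gamma>V: "\<gamma> u \<in> ?V" for u
        using lxyV by (simp add: \<gamma>_def mem_V_plus norm_mult Re\<omega>)
      have \<omega>01: "exp (\<omega> 0) = 1" "exp (\<omega> 1) = 1"
      proof -
        have "\<omega> 1 = 2 * of_int k * of_real pi * \<i>" by (simp add: \<omega>_def)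
        then show "exp (\<omega> 1) = 1" using exp_integer_2pi[of "of_int k"] by simp
      qed (simp add: \<omega>_def)
      have \<gamma>01: "\<gamma> 0 = a" "\<gamma> 1 = a" by (simp_all add: \<gamma>_def a \<omega>01)
      have cont\<gamma>: "continuous_on S \<gamma>" for S
        unfolding \<gamma>_def \<omega>_def by (intro continuous_intros)
      have \<gamma>: "\<gamma> \<in> loops_at ?V a"
        using \<gamma>V \<gamma>01 cont\<gamma> by (auto simp: loops_at_def path_def path_image_def pathstart_def pathfinish_def)
      define \<beta> where "\<beta> u = lift (\<gamma> u) (Ln y + \<omega> u)" for u
      have \<beta>: "exp3 (\<beta> u) = \<Psi> (\<gamma> u)" "\<beta> u \<in> half_space" for u
        using exp3_lift[OF \<gamma>V, of "Ln y + \<omega> u" u] y0 by (simp_all add: \<beta>_def \<gamma>_def exp_add mult.commute)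
      have "continuous_on {0..1} \<beta>"
        unfolding \<beta>_def lift_def \<omega>_def using \<gamma>V
        by (intro continuous_intros continuous_on_compose2[OF cont_\<Psi> cont\<gamma>] continuous_on_compose2[OF g cont\<gamma>] cont\<gamma>) auto
      then have p\<beta>: "path \<beta>" "path_image \<beta> \<subseteq> half_space"
        using \<beta>(2) by (auto simp: path_def path_image_def)
      have s\<beta>: "pathstart \<beta> = e" by (simp add: pathstart_def \<beta>_def \<gamma>01 e_def \<omega>_def)
      have "\<beta> 1 = shift q e"
        by (simp add: \<beta>_def \<gamma>01 e_def lift_def shift_def \<omega>_def k)
      then have f\<beta>: "pathfinish \<beta> = cov.deck q e"
        using q by (simp add: pathfinish_def cov.deck_int)
      have "homotopic_paths ?U ((\<lambda>z. cov.proj (exp3 z)) \<circ> \<beta>) \<gamma>"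
        using D.path_P[OF p\<beta>] proj_\<Psi>[OF \<gamma>V] \<beta>(1) by (intro homotopic_paths_eq) auto
      then have "path_class ?U ((\<lambda>z. cov.proj (exp3 z)) \<circ> \<beta>) = path_class ?U \<gamma>"
        by (rule path_class_eqI)
      then have "\<phi> (path_class ?U \<gamma>) = q"
        using D.deck_of_eq[OF e(1) _ p\<beta> s\<beta> f\<beta>] q Z by (auto simp: \<phi>_def)
      then show "q \<in> \<phi> ` induced_map ?U id ` carrier (fundamental_group ?V a)"
        using ind[OF \<gamma>] \<gamma> carrV by (metis image_eqI)
    qed
    moreover have "holomorphic_covering model_space cov.proj ?U"
      using cov_proj cov.holomorphic3_proj cov.proj_local by (simp add: holomorphic_covering_def)
    moreover have "corresponds_to_subgroup model_space b cov.proj ?U a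
        {A \<in> carrier (fundamental_group ?U a). \<phi> A \<in> \<int>}"
    proof -
      have "connected model_space"
        using connected_continuous_image[OF exp3_cont convex_connected[OF convex_half_space]]
        by (simp add: exp3_image)
      moreover have "b \<in> model_space" using e exp3_image by blast
      ultimately show ?thesis
        using sub proj_\<Psi>[OF aV] by (simp add: corresponds_to_subgroup_def b_def)
    qed
    moreover have "fundamental_group model_space b \<cong> integer_group"
      using exp_deck.deck_of_iso[OF e(1) sc] e(2) by (auto simp: is_iso_def)
    moreover have "holomorphic3 (model_map d c \<delta> Q) model_space"
    proof -
      have "holomorphic3 (\<lambda>z. (c * fst z, \<delta> / of_nat d * fst (snd z) + poly (Q (fst z)) (snd (snd z)),
          snd (snd z) ^ d)) model_space"
        by (intro holomorphic3_components hol_intros cov.hol_Q_compose open_model_space)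
      then show ?thesis by (simp add: model_map_def split_beta')
    qed
    moreover have "model_map d c \<delta> Q \<in> model_space \<rightarrow> model_space"
      using cov.F_model by blast
    ultimately show "\<exists>\<phi>\<in>iso (fundamental_group ?U a) (Z_inverse_group d).
         \<phi> ` induced_map ?U id ` carrier (fundamental_group ?V a) = \<int> \<and>
         (\<exists>p b Q.
            holomorphic_covering model_space p ?U \<and>
            corresponds_to_subgroup model_space b p ?U a
              {A \<in> carrier (fundamental_group ?U a). \<phi> A \<in> \<int>} \<and>
            fundamental_group model_space b \<cong> integer_group \<and>
            (\<forall>l. degree (Q l) = d + 1) \<and>
            holomorphic3 (model_map d c \<delta> Q) model_space \<and>
            model_map d c \<delta> Q \<in> model_space \<rightarrow> model_space \<and>
            (\<forall>z\<in>model_space. p (model_map d c \<delta> Q z) = ?H (p z)))"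
      using iso degQ cov.proj_F
      by (intro bexI[of _ \<phi>] conjI exI[of _ cov.proj] exI[of _ b] exI[of _ Q]) auto
  qed
qed

end
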